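(* Let $d$ be a thin dimension vector with $e(d)=1$. Let $J=J(d)$, $K=\operatorname{supp} d\setminus J$, $T=\Delta(J)$ and $S=\Delta(K)$. Then: (a) $\mathrm{Ext}^1_{\mathcal A_{t,1}}(T,S)\cong k$ and $\mathrm{Ext}^1_{\mathcal A_{t,1}}(S,T)=0$. (b) If $0\to S\to M\to T\to 0$ is a non-split short exact sequence of $\mathcal A_{t,1}$-modules (such $M$ is unique up to isomorphism), then $\mathrm{Ext}^1_{\mathcal A_{t,1}}(M,M)=0$.
   Context: Let $k$ be an algebraically closed field. A thin dimension vector is $d=(d_1,\dots,d_t)\in\{0,1\}^t$ with $d_1=d_t=1$ and no two consecutive entries equal to $0$; $\operatorname{supp} d=\{i: d_i=1\}$. Write its entries as maximal strings of consecutive ones of lengths $a_0,a_1,\dots,a_{r+1}$ (in order, separated by single zeros); the strings of lengths $a_1,\dots,a_r$ are called internal, and $e(d)=\#\{1\le i\le r: a_i\text{ even}\}$. Let $b_1<\dots<b_{e(d)}$ be the positions of the last entries of the internal strings of even length. Define $J(d)$ as the set of $j\in\{1,\dots,t\}$ such that either $j\le b_1-1$ and $j\equiv b_1-1\pmod 2$; or $b_i+2\le j\le b_{i+1}-1$ and $j\equiv b_i \pmod 2$ for some $1\le i<e(d)$; or $j\ge b_{e(d)}+2$ and $j\equiv b_{e(d)}\pmod 2$. $\mathcal A_{t,1}$ is the quotient of the path algebra over $k$ of the quiver with vertices $1,\dots,t$, arrows $\alpha_i:i\to i+1$ ($1\le i\le t-1$) and $\beta_j:j+2\to j$ ($1\le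 j\le t-2$), by the relations $\beta_1\alpha_2=0$ and $\beta_{i+1}\alpha_{i+2}=\alpha_i\beta_i$ for $1\le i\le t-3$ (compositions right to left); modules are representations satisfying these relations. A subset $J\subseteq\{1,\dots,t\}$ is standard if $j\in J\Rightarrow j+1\notin J$. For nonempty standard $J$, $\Delta(J)_i=k^{l}$ with $l=\#\{j\in J: j\le i\}$ and basis $e_1,\dots,e_l$; $\alpha_i$ is the inclusion $e_h\mapsto e_h$, and $\beta_j(e_h)=e_{h-1}$ for $h\ge 2$, $\beta_j(e_1)=0$. *)

theory Defs
  imports "Jordan_Normal_Form.Matrix"
begin

definition alg_closed :: "'a::field itself \<Rightarrow> bool" where
  "alg_closed _ \<longleftrightarrow> (\<forall>n::nat. n \<ge> 1 \<longrightarrow>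
      (\<forall>c::nat \<Rightarrow> 'a. \<exists>x::'a. x ^ n + (\<Sum>i<n. c i * x ^ i) = 0))"

definition thin_dimvec :: "nat \<Rightarrow> (nat \<Rightarrow> nat) \<Rightarrow> bool" where
  "thin_dimvec t d \<longleftrightarrow> t \<ge> 1 \<and> (\<forall>i\<in>{1..t}. d i \<in> {0,1}) \<and> d 1 = 1 \<and> d t = 1 \<and>
     (\<forall>i\<in>{1..<t}. \<not> (d i = 0 \<and> d (i+1) = 0))"

definition supp :: "nat \<Rightarrow> (nat \<Rightarrow> nat) \<Rightarrow> nat set" where
  "supp t d = {i\<in>{1..t}. d i = 1}"

text \<open>p is the position of the last entry of an internal maximal string of ones
  (i.e. one that is neither the first nor the last string) of even length.
  The string occupies positions s..p with d (s-1) = 0, s > 1, d (p+1) = 0, p < t.\<close>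
definition even_internal_end :: "nat \<Rightarrow> (nat \<Rightarrow> nat) \<Rightarrow> nat \<Rightarrow> bool" where
  "even_internal_end t d p \<longleftrightarrow> p \<in> {1..t} \<and> p < t \<and> d p = 1 \<and> d (p+1) = 0 \<and>
     (\<exists>s. 1 < s \<and> s \<le> p \<and> d (s-1) = 0 \<and> (\<forall>q\<in>{s..p}. d q = 1) \<and> even (p - s + 1))"

definition bpos :: "nat \<Rightarrow> (nat \<Rightarrow> nat) \<Rightarrow> nat list" where
  "bpos t d = sorted_list_of_set {p. even_internal_end t d p}"

definition e_num :: "nat \<Rightarrow> (nat \<Rightarrow> nat) \<Rightarrow> nat" where
  "e_num t d = card {p. even_internal_end t d p}"

definition Jset :: "nat \<Rightarrow> (nat \<Rightarrow> nat) \<Rightarrow> nat set" where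
  "Jset t d = (let bs = bpos t d; e = length bs; b = (\<lambda>i. bs ! (i - 1)) in
     {j\<in>{1..t}.
        (e \<ge> 1 \<and> j + 1 \<le> b 1 \<and> j mod 2 = (b 1 - 1) mod 2)
      \<or> (\<exists>i. 1 \<le> i \<and> i < e \<and> b i + 2 \<le> j \<and> j + 1 \<le> b (i+1) \<and> j mod 2 = b i mod 2)
      \<or> (e \<ge> 1 \<and> b e + 2 \<le> j \<and> j mod 2 = b e mod 2)})"

text \<open>dimv M i = dimension of the space at vertex i (identified with k^n),
  amap M i = matrix of alpha_i : i \<rightarrow> i+1, bmap M j = matrix of beta_j : j+2 \<rightarrow> j.\<close>
record 'a rep =
  dimv :: "nat \<Rightarrow> nat"
  amap :: "nat \<Rightarrow> 'a mat"
  bmap :: "nat \<Rightarrow> 'a mat"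

definition is_module :: "nat \<Rightarrow> 'a::field rep \<Rightarrow> bool" where
  "is_module t M \<longleftrightarrow>
     (\<forall>i. 1 \<le> i \<and> i + 1 \<le> t \<longrightarrow> amap M i \<in> carrier_mat (dimv M (i+1)) (dimv M i)) \<and>
     (\<forall>j. 1 \<le> j \<and> j + 2 \<le> t \<longrightarrow> bmap M j \<in> carrier_mat (dimv M j) (dimv M (j+2))) \<and>
     (3 \<le> t \<longrightarrow> bmap M 1 * amap M 2 = 0\<^sub>m (dimv M 1) (dimv M 2)) \<and>
     (\<forall>i. 1 \<le> i \<and> i + 3 \<le> t \<longrightarrow> bmap M (i+1) * amap M (i+2) = amap M i * bmap M i)"

definition is_hom :: "nat \<Rightarrow> 'a::field rep \<Rightarrow> 'a rep \<Rightarrow> (nat \<Rightarrow> 'a mat) \<Rightarrow> bool" where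
  "is_hom t M N \<phi> \<longleftrightarrow>
     (\<forall>i\<in>{1..t}. \<phi> i \<in> carrier_mat (dimv N i) (dimv M i)) \<and>
     (\<forall>i. 1 \<le> i \<and> i + 1 \<le> t \<longrightarrow> amap N i * \<phi> i = \<phi> (i+1) * amap M i) \<and>
     (\<forall>j. 1 \<le> j \<and> j + 2 \<le> t \<longrightarrow> bmap N j * \<phi> (j+2) = \<phi> j * bmap M j)"

definition is_iso :: "nat \<Rightarrow> 'a::field rep \<Rightarrow> 'a rep \<Rightarrow> bool" where
  "is_iso t M N \<longleftrightarrow> (\<exists>\<phi> \<psi>. is_hom t M N \<phi> \<and> is_hom t N M \<psi> \<and>
     (\<forall>i\<in>{1..t}. \<psi> i * \<phi> i = 1\<^sub>m (dimv M i) \<and> \<phi> i * \<psi> i = 1\<^sub>m (dimv N i)))"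

definition is_ses :: "nat \<Rightarrow> 'a::field rep \<Rightarrow> 'a rep \<Rightarrow> 'a rep \<Rightarrow>
    (nat \<Rightarrow> 'a mat) \<Rightarrow> (nat \<Rightarrow> 'a mat) \<Rightarrow> bool" where
  "is_ses t S M T \<iota> \<pi> \<longleftrightarrow> is_hom t S M \<iota> \<and> is_hom t M T \<pi> \<and>
     (\<forall>i\<in>{1..t}.
        (\<forall>v\<in>carrier_vec (dimv S i). \<iota> i *\<^sub>v v = 0\<^sub>v (dimv M i) \<longrightarrow> v = 0\<^sub>v (dimv S i)) \<and>
        (\<forall>v\<in>carrier_vec (dimv M i). \<pi> i *\<^sub>v v = 0\<^sub>v (dimv T i) \<longleftrightarrow>
            (\<exists>u\<in>carrier_vec (dimv S i). v = \<iota> i *\<^sub>v u)) \<and>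
        (\<forall>w\<in>carrier_vec (dimv T i). \<exists>v\<in>carrier_vec (dimv M i). \<pi> i *\<^sub>v v = w))"

definition ses_splits :: "nat \<Rightarrow> 'a::field rep \<Rightarrow> 'a rep \<Rightarrow> (nat \<Rightarrow> 'a mat) \<Rightarrow> bool" where
  "ses_splits t M T \<pi> \<longleftrightarrow> (\<exists>\<sigma>. is_hom t T M \<sigma> \<and> (\<forall>i\<in>{1..t}. \<pi> i * \<sigma> i = 1\<^sub>m (dimv T i)))"

text \<open>An extension 0 \<rightarrow> N \<rightarrow> E \<rightarrow> X \<rightarrow> 0 can be written with E_i = N_i \<oplus> X_i and
  arrow matrices [[N_a, f_a],[0, X_a]]; f = (fa, fb) must make E satisfy the relations.
  Ext^1(X,N) = cocycles / coboundaries.\<close>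
definition ext_cocycle :: "nat \<Rightarrow> 'a::field rep \<Rightarrow> 'a rep \<Rightarrow>
    (nat \<Rightarrow> 'a mat) \<times> (nat \<Rightarrow> 'a mat) \<Rightarrow> bool" where
  "ext_cocycle t X N f \<longleftrightarrow> (let fa = fst f; fb = snd f in
     (\<forall>i. 1 \<le> i \<and> i + 1 \<le> t \<longrightarrow> fa i \<in> carrier_mat (dimv N (i+1)) (dimv X i)) \<and>
     (\<forall>j. 1 \<le> j \<and> j + 2 \<le> t \<longrightarrow> fb j \<in> carrier_mat (dimv N j) (dimv X (j+2))) \<and>
     (3 \<le> t \<longrightarrow> bmap N 1 * fa 2 + fb 1 * amap X 2 = 0\<^sub>m (dimv N 1) (dimv X 2)) \<and>
     (\<forall>i. 1 \<le> i \<and> i + 3 \<le> t \<longrightarrow>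
        bmap N (i+1) * fa (i+2) + fb (i+1) * amap X (i+2) = amap N i * fb i + fa i * bmap X i))"

definition ext_coboundary :: "nat \<Rightarrow> 'a::field rep \<Rightarrow> 'a rep \<Rightarrow>
    (nat \<Rightarrow> 'a mat) \<times> (nat \<Rightarrow> 'a mat) \<Rightarrow> bool" where
  "ext_coboundary t X N f \<longleftrightarrow> (\<exists>h. (\<forall>i\<in>{1..t}. h i \<in> carrier_mat (dimv N i) (dimv X i)) \<and>
     (\<forall>i. 1 \<le> i \<and> i + 1 \<le> t \<longrightarrow> fst f i = amap N i * h i - h (i+1) * amap X i) \<and>
     (\<forall>j. 1 \<le> j \<and> j + 2 \<le> t \<longrightarrow> snd f j = bmap N j * h (j+2) - h j * bmap X j))"

definition ext_comb :: "'a::field \<Rightarrow> (nat \<Rightarrow> 'a mat) \<times> (nat \<Rightarrow> 'a mat) \<Rightarrow>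
    (nat \<Rightarrow> 'a mat) \<times> (nat \<Rightarrow> 'a mat) \<Rightarrow> (nat \<Rightarrow> 'a mat) \<times> (nat \<Rightarrow> 'a mat)" where
  "ext_comb c f g = (\<lambda>i. fst f i - c \<cdot>\<^sub>m fst g i, \<lambda>i. snd f i - c \<cdot>\<^sub>m snd g i)"

definition ext1_zero :: "nat \<Rightarrow> 'a::field rep \<Rightarrow> 'a rep \<Rightarrow> bool" where
  "ext1_zero t X N \<longleftrightarrow> (\<forall>f. ext_cocycle t X N f \<longrightarrow> ext_coboundary t X N f)"

definition ext1_dim_one :: "nat \<Rightarrow> 'a::field rep \<Rightarrow> 'a rep \<Rightarrow> bool" where
  "ext1_dim_one t X N \<longleftrightarrow> (\<exists>g. ext_cocycle t X N g \<and> \<not> ext_coboundary t X N g \<and>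
     (\<forall>f. ext_cocycle t X N f \<longrightarrow> (\<exists>c. ext_coboundary t X N (ext_comb c f g))))"

definition Delta :: "nat set \<Rightarrow> 'a::field rep" where
  "Delta J = \<lparr> dimv = (\<lambda>i. card {j\<in>J. j \<le> i}),
     amap = (\<lambda>i. mat (card {j\<in>J. j \<le> i+1}) (card {j\<in>J. j \<le> i})
                     (\<lambda>(r,c). if r = c then 1 else 0)),
     bmap = (\<lambda>j. mat (card {x\<in>J. x \<le> j}) (card {x\<in>J. x \<le> j+2})
                     (\<lambda>(r,c). if r + 1 = c then 1 else 0)) \<rparr>"

end

theory Submission
  imports Defs "HOL-Library.Function_Algebras"
begin

text \<open>
  Part (b) is formal: since \<open>Ext\<^sup>1(T,S)\<close> is one-dimensional, the connecting map
  \<open>Hom(T,T) \<rightarrow> Ext\<^sup>1(T,S)\<close> of a non-split sequence is onto, and together with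
  \<open>Ext\<^sup>1(T,T) = Ext\<^sup>1(S,S) = Ext\<^sup>1(S,T) = 0\<close> the long exact sequences give
  \<open>Ext\<^sup>1(T,M) = Ext\<^sup>1(S,M) = 0\<close> and then \<open>Ext\<^sup>1(M,M) = 0\<close>.

  For (a), write \<open>x\<^sub>c\<close> and \<open>y\<^sub>r\<close> for the elements of \<open>X\<close> and \<open>Y\<close> in increasing order.
  Every class in \<open>Ext\<^sup>1(\<Delta>(X),\<Delta>(Y))\<close> has a representative with zero \<open>\<alpha>\<close>-part, which
  amounts to a matrix \<open>f\<close> with entries at the positions \<open>(r,c)\<close> where \<open>y\<^sub>r \<le> x\<^sub>c - 2\<close>; it is a
  coboundary iff \<open>f\<^sub>r\<^sub>c = u\<^sub>r\<^sub>+\<^sub>1\<^sub>,\<^sub>c - u\<^sub>r\<^sub>,\<^sub>c\<^sub>-\<^sub>1\<close> for a matrix \<open>u\<close> with entries where \<open>y\<^sub>r \<le> x\<^sub>c\<close>.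
  Along each diagonal this is a path whose edges are the \<open>f\<close>-entries and whose vertices are the
  \<open>u\<close>-entries; the cokernel counts the components missing both end vertices. For \<open>(X,Y) = (J,K)\<close>
  the only such component is the single edge with \<open>y\<^sub>r = b\<^sub>1\<close> and \<open>x\<^sub>c = b\<^sub>1 + 2\<close>.
\<close>

subsection \<open>Matrices as elements of one ring\<close>

text \<open>The \<open>\<alpha>\<close>-part of a cocycle can be removed because every
  \<open>\<alpha>\<close> of \<open>Delta X\<close> is injective, and the relations then force all
  \<open>\<beta>\<close>-parts to be truncations of one matrix; this is the matrix f. The edge (r,c)
  joins the vertices (r,c-1) and (r+1,c), and a solution u is found by solving for one of the two
  ends. Which end works depends on the pair. For (K,J), (J,J) and (K,K), a missing vertex (r+1,c)
  forces the edge (r,c) and the vertex (r,c-1) to be missing as well, so u can be computed by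
  increasing r. For (J,K) this fails and u is computed in the opposite direction: J proceeds in
  steps of two, and if x_(c-1) = x_c - 2, then a present edge (r,c) always has its end (r,c-1). The
  one exception in J is the jump from b-1 to b+2, where edges need y_r <= b but vertices y_r <= b-1.
  The only edge lost is the one with y_r = b. There is a single jump because e(d) = 1, and this is
  where the dimension one comes from.\<close>

text \<open>Rectangular matrices of all sizes act on sequences by zero padding; in the ring of additive
  maps the homological algebra below is plain noncommutative ring arithmetic.\<close>
typedef (overloaded) 'v endo = "{f :: 'v::ab_group_add \<Rightarrow> 'v. \<forall>x y. f (x + y) = f x + f y}"
  by (rule exI[of _ "\<lambda>_. 0"]) auto

setup_lifting type_definition_endo

instantiation endo :: (ab_group_add) ring
begin

lift_definition zero_endo :: "'a endo" is "\<lambda>_. 0" by simp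
lift_definition plus_endo :: "'a endo \<Rightarrow> 'a endo \<Rightarrow> 'a endo" is "\<lambda>f g x. f x + g x"
  by (simp add: algebra_simps)
lift_definition uminus_endo :: "'a endo \<Rightarrow> 'a endo" is "\<lambda>f x. - f x" by simp
lift_definition minus_endo :: "'a endo \<Rightarrow> 'a endo \<Rightarrow> 'a endo" is "\<lambda>f g x. f x - g x"
  by (simp add: algebra_simps)
lift_definition times_endo :: "'a endo \<Rightarrow> 'a endo \<Rightarrow> 'a endo" is "\<lambda>f g x. f (g x)" by simp

instance
  by standard (transfer; simp add: fun_eq_iff algebra_simps)+

end

lift_definition endo_of_mat :: "'a::field mat \<Rightarrow> (nat \<Rightarrow> 'a) endo" is
  "\<lambda>A v i. if i < dim_row A then \<Sum>j<dim_col A. A $$ (i, j) * v j else 0"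
  by (auto simp: fun_eq_iff sum.distrib algebra_simps)

text \<open>Scalars enter the ring as elements, since \<open>endo\<close> carries no scalar
  multiplication; they commute with all matrices by \<open>endo_of_mat_scal\<close>.\<close>

lift_definition scal :: "'a::field \<Rightarrow> (nat \<Rightarrow> 'a) endo" is "\<lambda>c v i. c * v i"
  by (auto simp: fun_eq_iff algebra_simps)

lemma endo_of_mat_mult:
  assumes "dim_col A = dim_row B"
  shows "endo_of_mat (A * B) = endo_of_mat A * endo_of_mat B"
  using assms
proof (transfer, intro ext, goal_cases)
  case (1 A B v i)
  show ?case
  proof (cases "i < dim_row A")
    case True
    have "(\<Sum>j<dim_col B. (A * B) $$ (i, j) * v j)
        = (\<Sum>j<dim_col B. \<Sum>k<dim_row B. A $$ (i, k) * B $$ (k, j) * v j)"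
      using 1 True by (intro sum.cong) (auto simp: scalar_prod_def sum_distrib_right lessThan_atLeast0)
    also have "\<dots> = (\<Sum>k<dim_row B. A $$ (i, k) * (\<Sum>j<dim_col B. B $$ (k, j) * v j))"
      by (subst sum.swap) (simp add: sum_distrib_left mult.assoc)
    finally show ?thesis using 1 True by simp
  qed simp
qed

lemma endo_of_mat_add:
  "dim_row A = dim_row B \<Longrightarrow> dim_col A = dim_col B \<Longrightarrow>
    endo_of_mat (A + B) = endo_of_mat A + endo_of_mat B"
  by transfer (auto simp: fun_eq_iff sum.distrib algebra_simps)

lemma endo_of_mat_diff:
  "dim_row A = dim_row B \<Longrightarrow> dim_col A = dim_col B \<Longrightarrow>
    endo_of_mat (A - B) = endo_of_mat A - endo_of_mat B"
  by transfer (auto simp: fun_eq_iff sum_subtractf algebra_simps)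

lemma endo_of_mat_smult: "endo_of_mat (c \<cdot>\<^sub>m A) = scal c * endo_of_mat A"
  by transfer (auto simp: fun_eq_iff sum_distrib_left algebra_simps)

lemma endo_of_mat_scal: "endo_of_mat A * scal c = scal c * endo_of_mat A"
  by transfer (auto simp: fun_eq_iff sum_distrib_left algebra_simps)

lemma endo_of_mat_zero: "endo_of_mat (0\<^sub>m m n) = 0"
  by transfer (auto simp: fun_eq_iff)

lemma scal_mult: "scal a * scal b = scal (a * b)"
  by transfer (auto simp: fun_eq_iff)

lemma scal_0: "scal 0 = 0"
  by transfer (auto simp: fun_eq_iff)

lemma scal_1_mult: "scal 1 * x = x"
  by transfer (auto simp: fun_eq_iff)

text \<open>Padding forgets the size of a matrix (all zero matrices become 0), so equality can be
  reflected only between matrices of the same format. Entries are recovered by evaluating at unit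
  sequences.\<close>

lemma endo_of_mat_inj:
  assumes "A \<in> carrier_mat m n" "B \<in> carrier_mat m n" "endo_of_mat A = endo_of_mat B"
  shows "A = B"
proof (rule eq_matI)
  fix i j assume ij: "i < dim_row B" "j < dim_col B"
  have ent: "C $$ (i, j) = Rep_endo (endo_of_mat C) (\<lambda>k. if k = j then 1 else 0) i"
    if "i < dim_row C" "j < dim_col C" for C :: "'a mat"
    using that by (auto simp: endo_of_mat.rep_eq if_distrib[of "\<lambda>x. _ * x"] cong: if_cong)
  show "A $$ (i, j) = B $$ (i, j)"
    using ij assms ent[of A] ent[of B] by auto
qed (use assms in auto)

text \<open>The linear maps from k^m to k^n, source first; the order is the reverse of that in
  \<open>carrier_mat\<close>.\<close>

definition lin :: "nat \<Rightarrow> nat \<Rightarrow> (nat \<Rightarrow> 'a::field) endo set" where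
  "lin m n = endo_of_mat ` carrier_mat n m"

text \<open>Inside the ring this is the idempotent that truncates a sequence to its first n entries.
  It acts as an identity only on elements of a suitable \<open>lin\<close>, which is why dimensions
  are carried along in the arguments below.\<close>

definition idn :: "nat \<Rightarrow> (nat \<Rightarrow> 'a::field) endo" where
  "idn n = endo_of_mat (1\<^sub>m n)"

lemma lin_mult: "x \<in> lin l m \<Longrightarrow> y \<in> lin k l \<Longrightarrow> x * y \<in> lin k m"
  unfolding lin_def by (auto simp: endo_of_mat_mult[symmetric] image_iff intro!: bexI[of _ "_ * _"])

lemma lin_add: "x \<in> lin m n \<Longrightarrow> y \<in> lin m n \<Longrightarrow> x + y \<in> lin m n"
  unfolding lin_def by (auto simp: endo_of_mat_add[symmetric] image_iff intro!: bexI[of _ "_ + _"])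

lemma lin_diff: "x \<in> lin m n \<Longrightarrow> y \<in> lin m n \<Longrightarrow> x - y \<in> lin m n"
  unfolding lin_def
  by (auto simp: endo_of_mat_diff[symmetric] image_iff intro!: bexI[of _ "_ - _"] minus_carrier_mat)

lemma lin_scal: "x \<in> lin m n \<Longrightarrow> scal c * x \<in> lin m n"
  unfolding lin_def by (auto simp: endo_of_mat_smult[symmetric])

lemma lin_0: "0 \<in> lin m n"
  unfolding lin_def by (rule image_eqI[of _ _ "0\<^sub>m n m"]) (auto simp: endo_of_mat_zero)

lemma lin_idn: "idn n \<in> lin n n"
  unfolding lin_def idn_def by auto

lemma lin_scal_commute: "x \<in> lin m n \<Longrightarrow> x * scal c = scal c * x"
  unfolding lin_def by (auto simp: endo_of_mat_scal)

lemma idn_mult_left: "x \<in> lin m n \<Longrightarrow> idn n * x = x"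
  unfolding lin_def idn_def by (auto simp: endo_of_mat_mult[symmetric])

lemma idn_mult_right: "x \<in> lin m n \<Longrightarrow> x * idn m = x"
  unfolding lin_def idn_def by (auto simp: endo_of_mat_mult[symmetric])

lemma endo_of_mat_in_lin: "A \<in> carrier_mat n m \<Longrightarrow> endo_of_mat A \<in> lin m n"
  unfolding lin_def by simp

text \<open>The way back from the ring to matrices, with one choice made for a whole family.\<close>

lemma lin_familyE:
  assumes "\<And>i. i \<in> I \<Longrightarrow> x i \<in> lin (m i) (n i)"
  obtains A where "\<And>i. i \<in> I \<Longrightarrow> A i \<in> carrier_mat (n i) (m i)"
    and "\<And>i. i \<in> I \<Longrightarrow> endo_of_mat (A i) = x i"
proof -
  have "\<forall>i\<in>I. \<exists>A. A \<in> carrier_mat (n i) (m i) \<and> endo_of_mat A = x i"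
    using assms unfolding lin_def by fastforce
  then show thesis using that by (metis (no_types, lifting) bchoice)
qed

subsection \<open>Cochains in that ring\<close>

text \<open>The value at index 0 is set to zero, so that \<open>\<beta>\<^sub>1\<alpha>\<^sub>2 = 0\<close> becomes the instance \<open>i = 0\<close> of
  \<open>\<beta>\<^sub>i\<^sub>+\<^sub>1\<alpha>\<^sub>i\<^sub>+\<^sub>2 = \<alpha>\<^sub>i\<beta>\<^sub>i\<close>.\<close>
definition endo_fam :: "(nat \<Rightarrow> 'a::field mat) \<Rightarrow> nat \<Rightarrow> (nat \<Rightarrow> 'a) endo" where
  "endo_fam F i = (if i = 0 then 0 else endo_of_mat (F i))"

abbreviation \<alpha> :: "'a::field rep \<Rightarrow> nat \<Rightarrow> (nat \<Rightarrow> 'a) endo" where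
  "\<alpha> M \<equiv> endo_fam (amap M)"

abbreviation \<beta> :: "'a::field rep \<Rightarrow> nat \<Rightarrow> (nat \<Rightarrow> 'a) endo" where
  "\<beta> M \<equiv> endo_fam (bmap M)"

definition linear_rep :: "nat \<Rightarrow> 'a::field rep \<Rightarrow> bool" where
  "linear_rep t M \<longleftrightarrow>
     (\<forall>i. 1 \<le> i \<and> i + 1 \<le> t \<longrightarrow> \<alpha> M i \<in> lin (dimv M i) (dimv M (i+1))) \<and>
     (\<forall>j. 1 \<le> j \<and> j + 2 \<le> t \<longrightarrow> \<beta> M j \<in> lin (dimv M (j+2)) (dimv M j)) \<and>
     (\<forall>i. i + 3 \<le> t \<longrightarrow> \<beta> M (i+1) * \<alpha> M (i+2) = \<alpha> M i * \<beta> M i)"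

definition deg0 :: "nat \<Rightarrow> 'a::field rep \<Rightarrow> 'a rep \<Rightarrow> (nat \<Rightarrow> (nat \<Rightarrow> 'a) endo) \<Rightarrow> bool" where
  "deg0 t X N h \<longleftrightarrow> (\<forall>i\<in>{1..t}. h i \<in> lin (dimv X i) (dimv N i))"

definition linear_hom :: "nat \<Rightarrow> 'a::field rep \<Rightarrow> 'a rep \<Rightarrow> (nat \<Rightarrow> (nat \<Rightarrow> 'a) endo) \<Rightarrow> bool" where
  "linear_hom t X N \<phi> \<longleftrightarrow> deg0 t X N \<phi> \<and>
     (\<forall>i. i + 1 \<le> t \<longrightarrow> \<alpha> N i * \<phi> i = \<phi> (i+1) * \<alpha> X i) \<and>
     (\<forall>j. j + 2 \<le> t \<longrightarrow> \<beta> N j * \<phi> (j+2) = \<phi> j * \<beta> X j)"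

definition cochain :: "nat \<Rightarrow> 'a::field rep \<Rightarrow> 'a rep \<Rightarrow>
    (nat \<Rightarrow> (nat \<Rightarrow> 'a) endo) \<Rightarrow> (nat \<Rightarrow> (nat \<Rightarrow> 'a) endo) \<Rightarrow> bool" where
  "cochain t X N fa fb \<longleftrightarrow>
     (\<forall>i. 1 \<le> i \<and> i + 1 \<le> t \<longrightarrow> fa i \<in> lin (dimv X i) (dimv N (i+1))) \<and>
     (\<forall>j. 1 \<le> j \<and> j + 2 \<le> t \<longrightarrow> fb j \<in> lin (dimv X (j+2)) (dimv N j))"

definition cocycle :: "nat \<Rightarrow> 'a::field rep \<Rightarrow> 'a rep \<Rightarrow>
    (nat \<Rightarrow> (nat \<Rightarrow> 'a) endo) \<Rightarrow> (nat \<Rightarrow> (nat \<Rightarrow> 'a) endo) \<Rightarrow> bool" where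
  "cocycle t X N fa fb \<longleftrightarrow> cochain t X N fa fb \<and>
     (\<forall>i. i + 3 \<le> t \<longrightarrow>
        \<beta> N (i+1) * fa (i+2) + fb (i+1) * \<alpha> X (i+2) = \<alpha> N i * fb i + fa i * \<beta> X i)"

text \<open>The cochain h is an argument, so that composing, adding and scaling trivial cocycles
  gives an explicit h for the result.\<close>

definition cobounds :: "nat \<Rightarrow> 'a::field rep \<Rightarrow> 'a rep \<Rightarrow> (nat \<Rightarrow> (nat \<Rightarrow> 'a) endo) \<Rightarrow>
    (nat \<Rightarrow> (nat \<Rightarrow> 'a) endo) \<Rightarrow> (nat \<Rightarrow> (nat \<Rightarrow> 'a) endo) \<Rightarrow> bool" where
  "cobounds t X N h fa fb \<longleftrightarrow> deg0 t X N h \<and>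
     (\<forall>i. 1 \<le> i \<and> i + 1 \<le> t \<longrightarrow> fa i = \<alpha> N i * h i - h (i+1) * \<alpha> X i) \<and>
     (\<forall>j. 1 \<le> j \<and> j + 2 \<le> t \<longrightarrow> fb j = \<beta> N j * h (j+2) - h j * \<beta> X j)"

lemma endo_fam_0: "endo_fam F 0 = 0"
  by (simp add: endo_fam_def)

lemma is_module_carriers:
  assumes "is_module t M"
  shows "1 \<le> i \<Longrightarrow> i + 1 \<le> t \<Longrightarrow> amap M i \<in> carrier_mat (dimv M (i+1)) (dimv M i)"
    and "1 \<le> j \<Longrightarrow> j + 2 \<le> t \<Longrightarrow> bmap M j \<in> carrier_mat (dimv M j) (dimv M (j+2))"
  using assms unfolding is_module_def by auto

lemma linear_rep_of_module:
  assumes M: "is_module t M"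
  shows "linear_rep t M"
proof -
  note c = is_module_carriers[OF M]
  have rel: "\<beta> M (i+1) * \<alpha> M (i+2) = \<alpha> M i * \<beta> M i" if i: "i + 3 \<le> t" for i
  proof (cases "i = 0")
    case True
    have "bmap M 1 * amap M 2 = 0\<^sub>m (dimv M 1) (dimv M 2)"
      using M i unfolding is_module_def by auto
    then have "endo_of_mat (bmap M 1) * endo_of_mat (amap M 2) = 0"
      using c(1)[of 2] c(2)[of 1] i by (auto simp: endo_of_mat_mult[symmetric] endo_of_mat_zero numeral_3_eq_3)
    then show ?thesis using True by (simp add: endo_fam_def numeral_2_eq_2)
  next
    case False
    have "bmap M (i+1) * amap M (i+2) = amap M i * bmap M i"
      using M i False unfolding is_module_def by auto
    then show ?thesis
      using c(1)[of i] c(1)[of "i+2"] c(2)[of i] c(2)[of "i+1"] i False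
      by (auto simp: endo_fam_def endo_of_mat_mult[symmetric] numeral_3_eq_3)
  qed
  show ?thesis
    unfolding linear_rep_def using c rel
    by (auto simp: endo_fam_def intro!: endo_of_mat_in_lin)
qed

lemma linear_hom_of_hom:
  assumes X: "is_module t X" and N: "is_module t N" and \<phi>: "is_hom t X N \<phi>"
  shows "linear_hom t X N (endo_fam \<phi>)"
proof -
  note c = is_module_carriers[OF X] is_module_carriers[OF N]
  have \<phi>c: "\<phi> i \<in> carrier_mat (dimv N i) (dimv X i)" if "1 \<le> i" "i \<le> t" for i
    using \<phi> that unfolding is_hom_def by auto
  have "\<alpha> N i * endo_fam \<phi> i = endo_fam \<phi> (i+1) * \<alpha> X i" if "i + 1 \<le> t" for i
  proof (cases "i = 0")
    case False
    then have "amap N i * \<phi> i = \<phi> (i+1) * amap X i"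
      using \<phi> that unfolding is_hom_def by auto
    then show ?thesis using False that \<phi>c[of i] \<phi>c[of "i+1"] c(1)[of i] c(3)[of i]
      by (auto simp: endo_fam_def endo_of_mat_mult[symmetric])
  qed (simp add: endo_fam_def)
  moreover have "\<beta> N j * endo_fam \<phi> (j+2) = endo_fam \<phi> j * \<beta> X j" if "j + 2 \<le> t" for j
  proof (cases "j = 0")
    case False
    then have "bmap N j * \<phi> (j+2) = \<phi> j * bmap X j"
      using \<phi> that unfolding is_hom_def by auto
    then show ?thesis using False that \<phi>c[of j] \<phi>c[of "j+2"] c(2)[of j] c(4)[of j]
      by (auto simp: endo_fam_def endo_of_mat_mult[symmetric])
  qed (simp add: endo_fam_def)
  ultimately show ?thesis
    unfolding linear_hom_def deg0_def using \<phi>c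
    by (auto simp: endo_fam_def intro!: endo_of_mat_in_lin)
qed

lemma hom_of_linear_hom:
  assumes X: "is_module t X" and N: "is_module t N" and \<phi>: "linear_hom t X N \<phi>"
    and c: "\<And>i. i \<in> {1..t} \<Longrightarrow> F i \<in> carrier_mat (dimv N i) (dimv X i)"
    and F: "\<And>i. i \<in> {1..t} \<Longrightarrow> endo_of_mat (F i) = \<phi> i"
  shows "is_hom t X N F"
  unfolding is_hom_def
proof (intro conjI allI impI ballI, goal_cases)
  case (1 i) then show ?case using c by auto
next
  case (2 i)
  then have "\<alpha> N i * \<phi> i = \<phi> (i+1) * \<alpha> X i"
    using \<phi> unfolding linear_hom_def by auto
  then show ?case
    using 2 c[of i] c[of "i+1"] F[of i] F[of "i+1"] is_module_carriers(1)[OF X, of i] is_module_carriers(1)[OF N, of i]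
    by (intro endo_of_mat_inj[of _ "dimv N (i+1)" "dimv X i"]) (auto simp: endo_of_mat_mult endo_fam_def)
next
  case (3 j)
  then have "\<beta> N j * \<phi> (j+2) = \<phi> j * \<beta> X j"
    using \<phi> unfolding linear_hom_def by auto
  then show ?case
    using 3 c[of j] c[of "j+2"] F[of j] F[of "j+2"] is_module_carriers(2)[OF X, of j] is_module_carriers(2)[OF N, of j]
    by (intro endo_of_mat_inj[of _ "dimv N j" "dimv X (j+2)"]) (auto simp: endo_of_mat_mult endo_fam_def)
qed

context
  fixes t :: nat and X N :: "'a::field rep" and f :: "(nat \<Rightarrow> 'a mat) \<times> (nat \<Rightarrow> 'a mat)"
  assumes X: "is_module t X" and N: "is_module t N"
    and fa: "\<And>i. 1 \<le> i \<Longrightarrow> i + 1 \<le> t \<Longrightarrow> fst f i \<in> carrier_mat (dimv N (i+1)) (dimv X i)"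
    and fb: "\<And>j. 1 \<le> j \<Longrightarrow> j + 2 \<le> t \<Longrightarrow> snd f j \<in> carrier_mat (dimv N j) (dimv X (j+2))"
begin

lemma ext_cocycle_iff: "ext_cocycle t X N f \<longleftrightarrow> cocycle t X N (endo_fam (fst f)) (endo_fam (snd f))"
proof -
  note cX = is_module_carriers[OF X] and cN = is_module_carriers[OF N]
  have cc: "cochain t X N (endo_fam (fst f)) (endo_fam (snd f))"
    unfolding cochain_def using fa fb by (auto simp: endo_fam_def intro!: endo_of_mat_in_lin)
  have rel0: "bmap N 1 * fst f 2 + snd f 1 * amap X 2 = 0\<^sub>m (dimv N 1) (dimv X 2) \<longleftrightarrow>
      \<beta> N 1 * endo_fam (fst f) 2 + endo_fam (snd f) 1 * \<alpha> X 2
        = \<alpha> N 0 * endo_fam (snd f) 0 + endo_fam (fst f) 0 * \<beta> X 0" (is "?l \<longleftrightarrow> ?r") if t: "3 \<le> t"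
  proof -
    have c: "bmap N 1 \<in> carrier_mat (dimv N 1) (dimv N 3)" "fst f 2 \<in> carrier_mat (dimv N 3) (dimv X 2)"
      "snd f 1 \<in> carrier_mat (dimv N 1) (dimv X 3)" "amap X 2 \<in> carrier_mat (dimv X 3) (dimv X 2)"
      using fa[of 2] fb[of 1] cX(1)[of 2] cN(2)[of 1] t by (simp_all add: numeral_3_eq_3)
    have "?l \<longleftrightarrow> endo_of_mat (bmap N 1 * fst f 2 + snd f 1 * amap X 2) = endo_of_mat (0\<^sub>m (dimv N 1) (dimv X 2))"
      using c by (auto intro: endo_of_mat_inj[of _ "dimv N 1" "dimv X 2"])
    also have "\<dots> \<longleftrightarrow> ?r"
      using c by (auto simp: endo_of_mat_add endo_of_mat_mult endo_of_mat_zero endo_fam_def)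
    finally show ?thesis .
  qed
  have rel: "bmap N (i+1) * fst f (i+2) + snd f (i+1) * amap X (i+2) = amap N i * snd f i + fst f i * bmap X i \<longleftrightarrow>
      \<beta> N (i+1) * endo_fam (fst f) (i+2) + endo_fam (snd f) (i+1) * \<alpha> X (i+2)
        = \<alpha> N i * endo_fam (snd f) i + endo_fam (fst f) i * \<beta> X i" (is "?l = ?r \<longleftrightarrow> ?lr")
    if i: "1 \<le> i" "i + 3 \<le> t" for i
  proof -
    have c: "bmap N (i+1) \<in> carrier_mat (dimv N (i+1)) (dimv N (i+3))"
      "fst f (i+2) \<in> carrier_mat (dimv N (i+3)) (dimv X (i+2))"
      "snd f (i+1) \<in> carrier_mat (dimv N (i+1)) (dimv X (i+3))"
      "amap X (i+2) \<in> carrier_mat (dimv X (i+3)) (dimv X (i+2))"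
      "amap N i \<in> carrier_mat (dimv N (i+1)) (dimv N i)"
      "snd f i \<in> carrier_mat (dimv N i) (dimv X (i+2))"
      "fst f i \<in> carrier_mat (dimv N (i+1)) (dimv X i)"
      "bmap X i \<in> carrier_mat (dimv X i) (dimv X (i+2))"
      using fa[of "i+2"] fb[of "i+1"] cX(1)[of "i+2"] cN(2)[of "i+1"]
        fa[of i] fb[of i] cX(2)[of i] cN(1)[of i] i by (simp_all add: numeral_3_eq_3)
    have "?l = ?r \<longleftrightarrow> endo_of_mat ?l = endo_of_mat ?r"
      using c by (auto intro: endo_of_mat_inj[of _ "dimv N (i+1)" "dimv X (i+2)"])
    also have "\<dots> \<longleftrightarrow> ?lr"
      using c i by (auto simp: endo_of_mat_add endo_of_mat_mult endo_fam_def)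
    finally show ?thesis .
  qed
  have "cocycle t X N (endo_fam (fst f)) (endo_fam (snd f)) \<longleftrightarrow> (\<forall>i. i + 3 \<le> t \<longrightarrow> 
      \<beta> N (i+1) * endo_fam (fst f) (i+2) + endo_fam (snd f) (i+1) * \<alpha> X (i+2)
        = \<alpha> N i * endo_fam (snd f) i + endo_fam (fst f) i * \<beta> X i)"
    unfolding cocycle_def using cc by simp
  also have "\<dots> \<longleftrightarrow> (3 \<le> t \<longrightarrow> \<beta> N 1 * endo_fam (fst f) 2 + endo_fam (snd f) 1 * \<alpha> X 2
        = \<alpha> N 0 * endo_fam (snd f) 0 + endo_fam (fst f) 0 * \<beta> X 0) \<and> (\<forall>i. 1 \<le> i \<and> i + 3 \<le> t \<longrightarrow> 
      \<beta> N (i+1) * endo_fam (fst f) (i+2) + endo_fam (snd f) (i+1) * \<alpha> X (i+2)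
        = \<alpha> N i * endo_fam (snd f) i + endo_fam (fst f) i * \<beta> X i)" (is "(\<forall>i. ?Q i) \<longleftrightarrow> ?Qz \<and> (\<forall>i. ?Qs i)")
  proof -
    have "?Q i \<longleftrightarrow> (if i = 0 then ?Qz else ?Qs i)" for i
      by (simp add: numeral_2_eq_2)
    then show ?thesis by (metis not_one_le_zero)
  qed
  also have "\<dots> \<longleftrightarrow> ext_cocycle t X N f"
    unfolding ext_cocycle_def Let_def using rel0 rel fa fb by blast
  finally show ?thesis by simp
qed

lemma ext_coboundary_iff:
  "ext_coboundary t X N f \<longleftrightarrow> (\<exists>h. cobounds t X N h (endo_fam (fst f)) (endo_fam (snd f)))"
proof -
  note cX = is_module_carriers[OF X] and cN = is_module_carriers[OF N]
  have eqs: "fst f i = amap N i * h i - h (i+1) * amap X i \<longleftrightarrow>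
      endo_fam (fst f) i = \<alpha> N i * endo_of_mat (h i) - endo_of_mat (h (i+1)) * \<alpha> X i"
    if h: "\<forall>i\<in>{1..t}. h i \<in> carrier_mat (dimv N i) (dimv X i)" and i: "1 \<le> i" "i + 1 \<le> t" for h i
  proof -
    have c: "h i \<in> carrier_mat (dimv N i) (dimv X i)" "h (i+1) \<in> carrier_mat (dimv N (i+1)) (dimv X (i+1))"
      "amap N i \<in> carrier_mat (dimv N (i+1)) (dimv N i)" "amap X i \<in> carrier_mat (dimv X (i+1)) (dimv X i)"
      "fst f i \<in> carrier_mat (dimv N (i+1)) (dimv X i)"
      using h i cX(1)[of i] cN(1)[of i] fa[of i] by auto
    have "amap N i * h i - h (i+1) * amap X i \<in> carrier_mat (dimv N (i+1)) (dimv X i)"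
      using c by auto
    then have "fst f i = amap N i * h i - h (i+1) * amap X i \<longleftrightarrow>
        endo_of_mat (fst f i) = endo_of_mat (amap N i * h i - h (i+1) * amap X i)"
      using endo_of_mat_inj c(5) by metis
    then show ?thesis
      using c i by (auto simp: endo_of_mat_diff endo_of_mat_mult endo_fam_def)
  qed
  have eqs': "snd f j = bmap N j * h (j+2) - h j * bmap X j \<longleftrightarrow>
      endo_fam (snd f) j = \<beta> N j * endo_of_mat (h (j+2)) - endo_of_mat (h j) * \<beta> X j"
    if h: "\<forall>i\<in>{1..t}. h i \<in> carrier_mat (dimv N i) (dimv X i)" and j: "1 \<le> j" "j + 2 \<le> t" for h j
  proof -
    have c: "h j \<in> carrier_mat (dimv N j) (dimv X j)" "h (j+2) \<in> carrier_mat (dimv N (j+2)) (dimv X (j+2))"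
      "bmap N j \<in> carrier_mat (dimv N j) (dimv N (j+2))" "bmap X j \<in> carrier_mat (dimv X j) (dimv X (j+2))"
      "snd f j \<in> carrier_mat (dimv N j) (dimv X (j+2))"
      using h j cX(2)[of j] cN(2)[of j] fb[of j] by auto
    have "bmap N j * h (j+2) - h j * bmap X j \<in> carrier_mat (dimv N j) (dimv X (j+2))"
      using c by auto
    then have "snd f j = bmap N j * h (j+2) - h j * bmap X j \<longleftrightarrow>
        endo_of_mat (snd f j) = endo_of_mat (bmap N j * h (j+2) - h j * bmap X j)"
      using endo_of_mat_inj c(5) by metis
    then show ?thesis
      using c j by (auto simp: endo_of_mat_diff endo_of_mat_mult endo_fam_def)
  qed
  show ?thesis
  proof
    assume "ext_coboundary t X N f"
    then obtain h where h: "\<forall>i\<in>{1..t}. h i \<in> carrier_mat (dimv N i) (dimv X i)"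
      and e: "\<forall>i. 1 \<le> i \<and> i + 1 \<le> t \<longrightarrow> fst f i = amap N i * h i - h (i+1) * amap X i"
      and e': "\<forall>j. 1 \<le> j \<and> j + 2 \<le> t \<longrightarrow> snd f j = bmap N j * h (j+2) - h j * bmap X j"
      unfolding ext_coboundary_def by blast
    have "cobounds t X N (\<lambda>i. endo_of_mat (h i)) (endo_fam (fst f)) (endo_fam (snd f))"
      unfolding cobounds_def deg0_def using h e e' eqs[OF h] eqs'[OF h] endo_of_mat_in_lin by blast
    then show "\<exists>h. cobounds t X N h (endo_fam (fst f)) (endo_fam (snd f))" by blast
  next
    assume "\<exists>h. cobounds t X N h (endo_fam (fst f)) (endo_fam (snd f))"
    then obtain h where h: "cobounds t X N h (endo_fam (fst f)) (endo_fam (snd f))" by blast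
    then obtain H where Hc: "\<And>i. i \<in> {1..t} \<Longrightarrow> H i \<in> carrier_mat (dimv N i) (dimv X i)"
      and H: "\<And>i. i \<in> {1..t} \<Longrightarrow> endo_of_mat (H i) = h i"
      using lin_familyE[of "{1..t}" h "dimv X" "dimv N"] unfolding cobounds_def deg0_def by blast
    have Hc': "\<forall>i\<in>{1..t}. H i \<in> carrier_mat (dimv N i) (dimv X i)" using Hc by blast
    have "fst f i = amap N i * H i - H (i+1) * amap X i" if "1 \<le> i" "i + 1 \<le> t" for i
      using h that H[of i] H[of "i+1"] unfolding eqs[OF Hc' that] cobounds_def by auto
    moreover have "snd f j = bmap N j * H (j+2) - H j * bmap X j" if "1 \<le> j" "j + 2 \<le> t" for j
      using h that H[of j] H[of "j+2"] unfolding eqs'[OF Hc' that] cobounds_def by auto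
    ultimately show "ext_coboundary t X N f"
      unfolding ext_coboundary_def using Hc' by blast
  qed
qed

end

lemma ext_cocycle_carriers:
  assumes "ext_cocycle t X N f"
  shows "1 \<le> i \<Longrightarrow> i + 1 \<le> t \<Longrightarrow> fst f i \<in> carrier_mat (dimv N (i+1)) (dimv X i)"
    and "1 \<le> j \<Longrightarrow> j + 2 \<le> t \<Longrightarrow> snd f j \<in> carrier_mat (dimv N j) (dimv X (j+2))"
  using assms unfolding ext_cocycle_def Let_def by auto

text \<open>Passing between matrices and ring elements controls the values at actual arrows only.
  Values at index 0 do not matter, as they are multiplied by the zero maps
  \<open>\<alpha> N 0\<close> and \<open>\<beta> X 0\<close>.\<close>

lemma cocycle_cong:
  assumes "\<And>i. 1 \<le> i \<Longrightarrow> i + 1 \<le> t \<Longrightarrow> fa i = ga i" "\<And>j. 1 \<le> j \<Longrightarrow> j + 2 \<le> t \<Longrightarrow> fb j = gb j"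
  shows "cocycle t X N fa fb \<longleftrightarrow> cocycle t X N ga gb"
proof -
  have "\<alpha> N i * fb i = \<alpha> N i * gb i" "fa i * \<beta> X i = ga i * \<beta> X i" if "i + 3 \<le> t" for i
    using assms that by (cases "i = 0"; simp add: endo_fam_0)+
  then show ?thesis
    unfolding cocycle_def cochain_def using assms by auto
qed

lemma cobounds_cong:
  assumes "\<And>i. 1 \<le> i \<Longrightarrow> i + 1 \<le> t \<Longrightarrow> fa i = ga i" "\<And>j. 1 \<le> j \<Longrightarrow> j + 2 \<le> t \<Longrightarrow> fb j = gb j"
  shows "cobounds t X N h fa fb \<longleftrightarrow> cobounds t X N h ga gb"
  unfolding cobounds_def using assms by auto

lemma cocycle_matE:
  assumes X: "is_module t X" and N: "is_module t N" and f: "cocycle t X N fa fb"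
  obtains F where "ext_cocycle t X N F"
    and "\<And>i. 1 \<le> i \<Longrightarrow> i + 1 \<le> t \<Longrightarrow> endo_fam (fst F) i = fa i"
    and "\<And>j. 1 \<le> j \<Longrightarrow> j + 2 \<le> t \<Longrightarrow> endo_fam (snd F) j = fb j"
proof -
  obtain A where A: "\<And>i. i \<in> {i. 1 \<le> i \<and> i + 1 \<le> t} \<Longrightarrow> A i \<in> carrier_mat (dimv N (i+1)) (dimv X i)"
      "\<And>i. i \<in> {i. 1 \<le> i \<and> i + 1 \<le> t} \<Longrightarrow> endo_of_mat (A i) = fa i"
    using f lin_familyE[of "{i. 1 \<le> i \<and> i + 1 \<le> t}" fa "dimv X" "\<lambda>i. dimv N (i+1)"]
    unfolding cocycle_def cochain_def by blast
  obtain B where B: "\<And>i. i \<in> {i. 1 \<le> i \<and> i + 2 \<le> t} \<Longrightarrow> B i \<in> carrier_mat (dimv N i) (dimv X (i+2))"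
      "\<And>i. i \<in> {i. 1 \<le> i \<and> i + 2 \<le> t} \<Longrightarrow> endo_of_mat (B i) = fb i"
    using f lin_familyE[of "{i. 1 \<le> i \<and> i + 2 \<le> t}" fb "\<lambda>i. dimv X (i+2)" "dimv N"]
    unfolding cocycle_def cochain_def by blast
  have eq: "\<And>i. 1 \<le> i \<Longrightarrow> i + 1 \<le> t \<Longrightarrow> endo_fam (fst (A, B)) i = fa i"
    "\<And>j. 1 \<le> j \<Longrightarrow> j + 2 \<le> t \<Longrightarrow> endo_fam (snd (A, B)) j = fb j"
    using A(2) B(2) by (auto simp: endo_fam_def)
  have "cocycle t X N (endo_fam (fst (A, B))) (endo_fam (snd (A, B)))"
    using f cocycle_cong[of t "endo_fam (fst (A, B))" fa "endo_fam (snd (A, B))" fb, OF eq] by blast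
  then have "ext_cocycle t X N (A, B)"
    using A(1) B(1) by (subst ext_cocycle_iff[OF X N]) auto
  then show thesis using that eq by blast
qed

lemma ext1_zero_iff:
  assumes X: "is_module t X" and N: "is_module t N"
  shows "ext1_zero t X N \<longleftrightarrow> (\<forall>fa fb. cocycle t X N fa fb \<longrightarrow> (\<exists>h. cobounds t X N h fa fb))"
proof
  assume z: "ext1_zero t X N"
  show "\<forall>fa fb. cocycle t X N fa fb \<longrightarrow> (\<exists>h. cobounds t X N h fa fb)"
  proof (intro allI impI)
    fix fa fb assume "cocycle t X N fa fb"
    then obtain F where F: "ext_cocycle t X N F"
      and eq: "\<And>i. 1 \<le> i \<Longrightarrow> i + 1 \<le> t \<Longrightarrow> endo_fam (fst F) i = fa i"
        "\<And>j. 1 \<le> j \<Longrightarrow> j + 2 \<le> t \<Longrightarrow> endo_fam (snd F) j = fb j"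
      using cocycle_matE[OF X N] by blast
    then have "\<exists>h. cobounds t X N h (endo_fam (fst F)) (endo_fam (snd F))"
      using z ext_coboundary_iff[OF X N ext_cocycle_carriers[OF F]] unfolding ext1_zero_def by blast
    then show "\<exists>h. cobounds t X N h fa fb" using cobounds_cong[of t "endo_fam (fst F)" fa "endo_fam (snd F)" fb, OF eq] by blast
  qed
next
  assume r: "\<forall>fa fb. cocycle t X N fa fb \<longrightarrow> (\<exists>h. cobounds t X N h fa fb)"
  show "ext1_zero t X N"
    unfolding ext1_zero_def
  proof (intro allI impI)
    fix f assume f: "ext_cocycle t X N f"
    note c = ext_cocycle_carriers[OF f]
    show "ext_coboundary t X N f"
      using r f ext_cocycle_iff[OF X N c] ext_coboundary_iff[OF X N c] by blast
  qed
qed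

text \<open>Only the bound dim <= 1 is exported. A nonzero class is supplied later by the non-split
  sequence itself.\<close>

lemma ext1_dim_oneD:
  assumes X: "is_module t X" and N: "is_module t N" and e: "ext1_dim_one t X N"
  obtains ga gb where "cocycle t X N ga gb" 
    "\<And>fa fb. cocycle t X N fa fb \<Longrightarrow>
      \<exists>c h. cobounds t X N h (\<lambda>i. fa i - scal c * ga i) (\<lambda>j. fb j - scal c * gb j)"
proof -
  obtain g where g: "ext_cocycle t X N g"
    and gen: "\<And>f. ext_cocycle t X N f \<Longrightarrow> \<exists>c. ext_coboundary t X N (ext_comb c f g)"
    using e unfolding ext1_dim_one_def by blast
  note gc = ext_cocycle_carriers[OF g]
  have "\<exists>c h. cobounds t X N h (\<lambda>i. fa i - scal c * endo_fam (fst g) i) (\<lambda>j. fb j - scal c * endo_fam (snd g) j)"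
    if f: "cocycle t X N fa fb" for fa fb
  proof -
    obtain F where F: "ext_cocycle t X N F"
      and eq: "\<And>i. 1 \<le> i \<Longrightarrow> i + 1 \<le> t \<Longrightarrow> endo_fam (fst F) i = fa i"
        "\<And>j. 1 \<le> j \<Longrightarrow> j + 2 \<le> t \<Longrightarrow> endo_fam (snd F) j = fb j"
      using cocycle_matE[OF X N f] by blast
    note Fc = ext_cocycle_carriers[OF F]
    obtain c where c: "ext_coboundary t X N (ext_comb c F g)" using gen[OF F] by blast
    have "fst (ext_comb c F g) i \<in> carrier_mat (dimv N (i+1)) (dimv X i)" if "1 \<le> i" "i + 1 \<le> t" for i
      using that Fc(1)[of i] gc(1)[of i] by (auto simp: ext_comb_def)
    moreover have "snd (ext_comb c F g) i \<in> carrier_mat (dimv N i) (dimv X (i+2))" if "1 \<le> i" "i + 2 \<le> t" for i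
      using that Fc(2)[of i] gc(2)[of i] by (auto simp: ext_comb_def)
    ultimately obtain h where h: "cobounds t X N h (endo_fam (fst (ext_comb c F g))) (endo_fam (snd (ext_comb c F g)))"
      using c ext_coboundary_iff[OF X N, of "ext_comb c F g"] by blast
    have 1: "endo_fam (fst (ext_comb c F g)) i = fa i - scal c * endo_fam (fst g) i" if "1 \<le> i" "i + 1 \<le> t" for i
      using that eq(1)[of i] Fc(1)[of i] gc(1)[of i]
      by (auto simp: ext_comb_def endo_fam_def endo_of_mat_diff endo_of_mat_smult)
    have 2: "endo_fam (snd (ext_comb c F g)) i = fb i - scal c * endo_fam (snd g) i" if "1 \<le> i" "i + 2 \<le> t" for i
      using that eq(2)[of i] Fc(2)[of i] gc(2)[of i]
      by (auto simp: ext_comb_def endo_fam_def endo_of_mat_diff endo_of_mat_smult)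
    have "cobounds t X N h (\<lambda>i. fa i - scal c * endo_fam (fst g) i) (\<lambda>j. fb j - scal c * endo_fam (snd g) j)"
      by (rule cobounds_cong[THEN iffD1, OF _ _ h]) (use 1 2 in auto)
    then show ?thesis by blast
  qed
  then show thesis
    using that g ext_cocycle_iff[OF X N gc] by blast
qed

section \<open>Coboundaries, and composition of cocycles with homomorphisms\<close>

abbreviation d\<alpha> :: "'a::field rep \<Rightarrow> 'a rep \<Rightarrow> (nat \<Rightarrow> (nat \<Rightarrow> 'a) endo) \<Rightarrow> nat \<Rightarrow> (nat \<Rightarrow> 'a) endo" where
  "d\<alpha> X N h i \<equiv> \<alpha> N i * h i - h (i+1) * \<alpha> X i"

abbreviation d\<beta> :: "'a::field rep \<Rightarrow> 'a rep \<Rightarrow> (nat \<Rightarrow> (nat \<Rightarrow> 'a) endo) \<Rightarrow> nat \<Rightarrow> (nat \<Rightarrow> 'a) endo" where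
  "d\<beta> X N h j \<equiv> \<beta> N j * h (j+2) - h j * \<beta> X j"

lemma deg0D: "deg0 t X N h \<Longrightarrow> 1 \<le> i \<Longrightarrow> i \<le> t \<Longrightarrow> h i \<in> lin (dimv X i) (dimv N i)"
  unfolding deg0_def by auto

lemma linear_repD:
  assumes "linear_rep t M"
  shows "1 \<le> i \<Longrightarrow> i + 1 \<le> t \<Longrightarrow> \<alpha> M i \<in> lin (dimv M i) (dimv M (i+1))"
    and "1 \<le> j \<Longrightarrow> j + 2 \<le> t \<Longrightarrow> \<beta> M j \<in> lin (dimv M (j+2)) (dimv M j)"
    and "k + 3 \<le> t \<Longrightarrow> \<beta> M (k+1) * \<alpha> M (k+2) = \<alpha> M k * \<beta> M k"
  using assms unfolding linear_rep_def by auto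

lemma linear_homD:
  assumes "linear_hom t X N \<phi>"
  shows "deg0 t X N \<phi>"
    and "i + 1 \<le> t \<Longrightarrow> \<alpha> N i * \<phi> i = \<phi> (i+1) * \<alpha> X i"
    and "j + 2 \<le> t \<Longrightarrow> \<beta> N j * \<phi> (j+2) = \<phi> j * \<beta> X j"
  using assms unfolding linear_hom_def by auto

lemma cochainD:
  assumes "cochain t X N fa fb"
  shows "1 \<le> i \<Longrightarrow> i + 1 \<le> t \<Longrightarrow> fa i \<in> lin (dimv X i) (dimv N (i+1))"
    and "1 \<le> j \<Longrightarrow> j + 2 \<le> t \<Longrightarrow> fb j \<in> lin (dimv X (j+2)) (dimv N j)"
  using assms unfolding cochain_def by auto

lemma cocycleD:
  assumes "cocycle t X N fa fb"
  shows "cochain t X N fa fb"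
    and "i + 3 \<le> t \<Longrightarrow> \<beta> N (i+1) * fa (i+2) + fb (i+1) * \<alpha> X (i+2) = \<alpha> N i * fb i + fa i * \<beta> X i"
  using assms unfolding cocycle_def by auto

lemma cochain_coboundary:
  assumes X: "linear_rep t X" and N: "linear_rep t N" and h: "deg0 t X N h"
  shows "cochain t X N (d\<alpha> X N h) (d\<beta> X N h)"
  unfolding cochain_def
proof (intro conjI allI impI lin_diff)
  fix i assume i: "1 \<le> i \<and> i + 1 \<le> t"
  show "\<alpha> N i * h i \<in> lin (dimv X i) (dimv N (i+1))"
    using linear_repD(1)[OF N, of i] deg0D[OF h, of i] i by (intro lin_mult) auto
  show "h (i+1) * \<alpha> X i \<in> lin (dimv X i) (dimv N (i+1))"
    using linear_repD(1)[OF X, of i] deg0D[OF h, of "i+1"] i by (intro lin_mult) auto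
next
  fix j assume j: "1 \<le> j \<and> j + 2 \<le> t"
  show "\<beta> N j * h (j+2) \<in> lin (dimv X (j+2)) (dimv N j)"
    using linear_repD(2)[OF N, of j] deg0D[OF h, of "j+2"] j by (intro lin_mult) auto
  show "h j * \<beta> X j \<in> lin (dimv X (j+2)) (dimv N j)"
    using linear_repD(2)[OF X, of j] deg0D[OF h, of j] j by (intro lin_mult) auto
qed

text \<open>The mixed terms \<open>\<beta> N h \<alpha> X\<close> on the left and
  \<open>\<alpha> N h \<beta> X\<close> on the right cancel; what remains agrees by the relations of
  X and N.\<close>

lemma cocycle_coboundary:
  assumes X: "linear_rep t X" and N: "linear_rep t N" and h: "deg0 t X N h"
  shows "cocycle t X N (d\<alpha> X N h) (d\<beta> X N h)"
  unfolding cocycle_def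
proof (intro conjI allI impI cochain_coboundary[OF assms])
  fix i assume i: "i + 3 \<le> t"
  have e: "i + 1 + 2 = i + 3" "i + 2 + 1 = i + 3" by auto
  have "\<beta> N (i+1) * d\<alpha> X N h (i+2) + d\<beta> X N h (i+1) * \<alpha> X (i+2)
      = (\<beta> N (i+1) * \<alpha> N (i+2)) * h (i+2) - h (i+1) * (\<beta> X (i+1) * \<alpha> X (i+2))"
    unfolding e by (simp only: algebra_simps)
  also have "\<dots> = (\<alpha> N i * \<beta> N i) * h (i+2) - h (i+1) * (\<alpha> X i * \<beta> X i)"
    using linear_repD(3)[OF X i] linear_repD(3)[OF N i] by simp
  also have "\<dots> = \<alpha> N i * d\<beta> X N h i + d\<alpha> X N h i * \<beta> X i"
    by (simp add: algebra_simps)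
  finally show "\<beta> N (i+1) * d\<alpha> X N h (i+2) + d\<beta> X N h (i+1) * \<alpha> X (i+2)
      = \<alpha> N i * d\<beta> X N h i + d\<alpha> X N h i * \<beta> X i" .
qed

lemma cochain_diff:
  assumes "cochain t X N fa fb" "cochain t X N ga gb"
  shows "cochain t X N (\<lambda>i. fa i - ga i) (\<lambda>j. fb j - gb j)"
  using assms unfolding cochain_def by (auto intro: lin_diff)

lemma cocycle_diff:
  assumes f: "cocycle t X N fa fb" and g: "cocycle t X N ga gb"
  shows "cocycle t X N (\<lambda>i. fa i - ga i) (\<lambda>j. fb j - gb j)"
  unfolding cocycle_def
proof (intro conjI allI impI cochain_diff cocycleD(1)[OF f] cocycleD(1)[OF g])
  fix i assume i: "i + 3 \<le> t"
  have "\<beta> N (i+1) * (fa (i+2) - ga (i+2)) + (fb (i+1) - gb (i+1)) * \<alpha> X (i+2)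
     = (\<beta> N (i+1) * fa (i+2) + fb (i+1) * \<alpha> X (i+2)) - (\<beta> N (i+1) * ga (i+2) + gb (i+1) * \<alpha> X (i+2))"
    by (simp only: algebra_simps)
  also have "\<dots> = (\<alpha> N i * fb i + fa i * \<beta> X i) - (\<alpha> N i * gb i + ga i * \<beta> X i)"
    using cocycleD(2)[OF f i] cocycleD(2)[OF g i] by simp
  also have "\<dots> = \<alpha> N i * (fb i - gb i) + (fa i - ga i) * \<beta> X i"
    by (simp only: algebra_simps)
  finally show "\<beta> N (i+1) * (fa (i+2) - ga (i+2)) + (fb (i+1) - gb (i+1)) * \<alpha> X (i+2)
     = \<alpha> N i * (fb i - gb i) + (fa i - ga i) * \<beta> X i" .
qed

lemma cochain_postcomp:
  assumes "deg0 t N N' \<phi>" and "cochain t X N fa fb"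
  shows "cochain t X N' (\<lambda>i. \<phi> (i+1) * fa i) (\<lambda>j. \<phi> j * fb j)"
  using assms unfolding cochain_def deg0_def
  by (auto intro!: lin_mult[of _ "dimv N _"])

lemma cochain_precomp:
  assumes "deg0 t X' X \<phi>" and "cochain t X N fa fb"
  shows "cochain t X' N (\<lambda>i. fa i * \<phi> i) (\<lambda>j. fb j * \<phi> (j+2))"
  using assms unfolding cochain_def deg0_def
  by (auto intro!: lin_mult[of _ "dimv X _"])

text \<open>Both sides of the cocycle identity run from vertex i+2 to vertex i+1. A homomorphism
  applied afterwards therefore factors out at i+1, and one applied before factors out at
  i+2.\<close>

lemma postcomp_relation:
  assumes \<phi>: "linear_hom t N N' \<phi>" and i: "i + 3 \<le> t"
  shows "\<beta> N' (i+1) * (\<phi> (i+3) * fa (i+2)) + \<phi> (i+1) * fb (i+1) * \<alpha> X (i+2)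
      = \<phi> (i+1) * (\<beta> N (i+1) * fa (i+2) + fb (i+1) * \<alpha> X (i+2))"
    and "\<alpha> N' i * (\<phi> i * fb i) + \<phi> (i+1) * fa i * \<beta> X i = \<phi> (i+1) * (\<alpha> N i * fb i + fa i * \<beta> X i)"
proof -
  have e: "i + 1 + 2 = i + 3" by simp
  have "\<beta> N' (i+1) * \<phi> (i+3) = \<phi> (i+1) * \<beta> N (i+1)"
    using linear_homD(3)[OF \<phi>, of "i+1"] i unfolding e by simp
  then show "\<beta> N' (i+1) * (\<phi> (i+3) * fa (i+2)) + \<phi> (i+1) * fb (i+1) * \<alpha> X (i+2)
      = \<phi> (i+1) * (\<beta> N (i+1) * fa (i+2) + fb (i+1) * \<alpha> X (i+2))"
    by (simp only: distrib_left mult.assoc[symmetric])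
  have "\<alpha> N' i * \<phi> i = \<phi> (i+1) * \<alpha> N i"
    using linear_homD(2)[OF \<phi>, of i] i by simp
  then show "\<alpha> N' i * (\<phi> i * fb i) + \<phi> (i+1) * fa i * \<beta> X i
      = \<phi> (i+1) * (\<alpha> N i * fb i + fa i * \<beta> X i)"
    by (simp only: distrib_left mult.assoc[symmetric])
qed

lemma precomp_relation:
  assumes \<phi>: "linear_hom t X' X \<phi>" and i: "i + 3 \<le> t"
  shows "\<beta> N (i+1) * (fa (i+2) * \<phi> (i+2)) + fb (i+1) * \<phi> (i+3) * \<alpha> X' (i+2)
      = (\<beta> N (i+1) * fa (i+2) + fb (i+1) * \<alpha> X (i+2)) * \<phi> (i+2)"
    and "\<alpha> N i * (fb i * \<phi> (i+2)) + fa i * \<phi> i * \<beta> X' i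
      = (\<alpha> N i * fb i + fa i * \<beta> X i) * \<phi> (i+2)"
proof -
  have e: "i + 2 + 1 = i + 3" by simp
  have "\<alpha> X (i+2) * \<phi> (i+2) = \<phi> (i+3) * \<alpha> X' (i+2)"
    using linear_homD(2)[OF \<phi>, of "i+2"] i unfolding e by simp
  then show "\<beta> N (i+1) * (fa (i+2) * \<phi> (i+2)) + fb (i+1) * \<phi> (i+3) * \<alpha> X' (i+2)
      = (\<beta> N (i+1) * fa (i+2) + fb (i+1) * \<alpha> X (i+2)) * \<phi> (i+2)"
    by (simp only: distrib_right mult.assoc)
  have "\<beta> X i * \<phi> (i+2) = \<phi> i * \<beta> X' i"
    using linear_homD(3)[OF \<phi>, of i] i by simp
  then show "\<alpha> N i * (fb i * \<phi> (i+2)) + fa i * \<phi> i * \<beta> X' i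
      = (\<alpha> N i * fb i + fa i * \<beta> X i) * \<phi> (i+2)"
    by (simp only: distrib_right mult.assoc)
qed

lemma plus_three: "i + 1 + 2 = i + 3" "i + 2 + 1 = i + 3" for i :: nat
  by auto

lemma cocycle_postcomp:
  assumes \<phi>: "linear_hom t N N' \<phi>" and f: "cocycle t X N fa fb"
  shows "cocycle t X N' (\<lambda>i. \<phi> (i+1) * fa i) (\<lambda>j. \<phi> j * fb j)"
  unfolding cocycle_def
proof (intro conjI allI impI cochain_postcomp[OF linear_homD(1)[OF \<phi>] cocycleD(1)[OF f]])
  fix i assume i: "i + 3 \<le> t"
  show "\<beta> N' (i+1) * (\<phi> (i+2+1) * fa (i+2)) + \<phi> (i+1) * fb (i+1) * \<alpha> X (i+2)
      = \<alpha> N' i * (\<phi> i * fb i) + \<phi> (i+1) * fa i * \<beta> X i"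
    unfolding plus_three postcomp_relation[OF \<phi> i] cocycleD(2)[OF f i] ..
qed

lemma cocycle_precomp:
  assumes \<phi>: "linear_hom t X' X \<phi>" and f: "cocycle t X N fa fb"
  shows "cocycle t X' N (\<lambda>i. fa i * \<phi> i) (\<lambda>j. fb j * \<phi> (j+2))"
  unfolding cocycle_def
proof (intro conjI allI impI cochain_precomp[OF linear_homD(1)[OF \<phi>] cocycleD(1)[OF f]])
  fix i assume i: "i + 3 \<le> t"
  show "\<beta> N (i+1) * (fa (i+2) * \<phi> (i+2)) + fb (i+1) * \<phi> (i+1+2) * \<alpha> X' (i+2)
      = \<alpha> N i * (fb i * \<phi> (i+2)) + fa i * \<phi> i * \<beta> X' i"
    unfolding plus_three precomp_relation[OF \<phi> i] cocycleD(2)[OF f i] ..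
qed

lemma lin_relation_terms:
  assumes X: "linear_rep t X" and N: "linear_rep t N" and g: "cochain t X N ga gb" and i: "i + 3 \<le> t"
  shows "\<beta> N (i+1) * ga (i+2) + gb (i+1) * \<alpha> X (i+2) \<in> lin (dimv X (i+2)) (dimv N (i+1))"
    and "\<alpha> N i * gb i + ga i * \<beta> X i \<in> lin (dimv X (i+2)) (dimv N (i+1))"
proof -
  show "\<beta> N (i+1) * ga (i+2) + gb (i+1) * \<alpha> X (i+2) \<in> lin (dimv X (i+2)) (dimv N (i+1))"
    using linear_repD(2)[OF N, of "i+1"] cochainD(1)[OF g, of "i+2"]
      linear_repD(1)[OF X, of "i+2"] cochainD(2)[OF g, of "i+1"] i
    unfolding plus_three by (intro lin_add lin_mult) auto
  show "\<alpha> N i * gb i + ga i * \<beta> X i \<in> lin (dimv X (i+2)) (dimv N (i+1))"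
  proof (cases "i = 0")
    case False
    then show ?thesis
      using linear_repD(1)[OF N, of i] cochainD(1)[OF g, of i]
        linear_repD(2)[OF X, of i] cochainD(2)[OF g, of i] i
      by (intro lin_add lin_mult) auto
  qed (simp add: endo_fam_0 lin_0)
qed

text \<open>The identity for \<open>\<phi> g\<close> is \<open>\<phi> (i+1)\<close> times the
  identity for g, so a left inverse at the single vertex i+1 cancels it. The epi version cancels at
  i+2.\<close>

lemma cocycle_cancel_mono:
  assumes X: "linear_rep t X" and N: "linear_rep t N" and \<phi>: "linear_hom t N N' \<phi>"
    and r: "\<And>i. 1 \<le> i \<Longrightarrow> i \<le> t \<Longrightarrow> r i * \<phi> i = idn (dimv N i)"
    and g: "cochain t X N ga gb"
    and \<phi>g: "cocycle t X N' (\<lambda>i. \<phi> (i+1) * ga i) (\<lambda>j. \<phi> j * gb j)"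
  shows "cocycle t X N ga gb"
  unfolding cocycle_def
proof (intro conjI allI impI g)
  fix i assume i: "i + 3 \<le> t"
  have "\<phi> (i+1) * (\<beta> N (i+1) * ga (i+2) + gb (i+1) * \<alpha> X (i+2)) = \<phi> (i+1) * (\<alpha> N i * gb i + ga i * \<beta> X i)"
    using cocycleD(2)[OF \<phi>g i] unfolding plus_three postcomp_relation[OF \<phi> i] .
  then have "r (i+1) * (\<phi> (i+1) * (\<beta> N (i+1) * ga (i+2) + gb (i+1) * \<alpha> X (i+2)))
      = r (i+1) * (\<phi> (i+1) * (\<alpha> N i * gb i + ga i * \<beta> X i))" by simp
  moreover have "r (i+1) * \<phi> (i+1) = idn (dimv N (i+1))" using r[of "i+1"] i by simp
  ultimately have "idn (dimv N (i+1)) * (\<beta> N (i+1) * ga (i+2) + gb (i+1) * \<alpha> X (i+2))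
      = idn (dimv N (i+1)) * (\<alpha> N i * gb i + ga i * \<beta> X i)"
    by (simp only: mult.assoc[symmetric])
  then show "\<beta> N (i+1) * ga (i+2) + gb (i+1) * \<alpha> X (i+2) = \<alpha> N i * gb i + ga i * \<beta> X i"
    by (simp only: idn_mult_left[OF lin_relation_terms(1)[OF X N g i]] idn_mult_left[OF lin_relation_terms(2)[OF X N g i]])
qed

lemma cocycle_cancel_epi:
  assumes X: "linear_rep t X" and N: "linear_rep t N" and \<phi>: "linear_hom t X' X \<phi>"
    and s: "\<And>i. 1 \<le> i \<Longrightarrow> i \<le> t \<Longrightarrow> \<phi> i * s i = idn (dimv X i)"
    and g: "cochain t X N ga gb"
    and g\<phi>: "cocycle t X' N (\<lambda>i. ga i * \<phi> i) (\<lambda>j. gb j * \<phi> (j+2))"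
  shows "cocycle t X N ga gb"
  unfolding cocycle_def
proof (intro conjI allI impI g)
  fix i assume i: "i + 3 \<le> t"
  have "(\<beta> N (i+1) * ga (i+2) + gb (i+1) * \<alpha> X (i+2)) * \<phi> (i+2) = (\<alpha> N i * gb i + ga i * \<beta> X i) * \<phi> (i+2)"
    using cocycleD(2)[OF g\<phi> i] unfolding plus_three precomp_relation[OF \<phi> i] .
  then have "(\<beta> N (i+1) * ga (i+2) + gb (i+1) * \<alpha> X (i+2)) * \<phi> (i+2) * s (i+2)
      = (\<alpha> N i * gb i + ga i * \<beta> X i) * \<phi> (i+2) * s (i+2)" by simp
  moreover have "\<phi> (i+2) * s (i+2) = idn (dimv X (i+2))" using s[of "i+2"] i by simp
  ultimately have "(\<beta> N (i+1) * ga (i+2) + gb (i+1) * \<alpha> X (i+2)) * idn (dimv X (i+2))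
      = (\<alpha> N i * gb i + ga i * \<beta> X i) * idn (dimv X (i+2))"
    by (simp only: mult.assoc)
  then show "\<beta> N (i+1) * ga (i+2) + gb (i+1) * \<alpha> X (i+2) = \<alpha> N i * gb i + ga i * \<beta> X i"
    by (simp only: idn_mult_right[OF lin_relation_terms(1)[OF X N g i]] idn_mult_right[OF lin_relation_terms(2)[OF X N g i]])
qed

lemma deg0_mult: "deg0 t M N g \<Longrightarrow> deg0 t X M h \<Longrightarrow> deg0 t X N (\<lambda>i. g i * h i)"
  unfolding deg0_def by (auto intro: lin_mult)

lemma deg0_add: "deg0 t X N g \<Longrightarrow> deg0 t X N h \<Longrightarrow> deg0 t X N (\<lambda>i. g i + h i)"
  unfolding deg0_def by (auto intro: lin_add)

lemma deg0_diff: "deg0 t X N g \<Longrightarrow> deg0 t X N h \<Longrightarrow> deg0 t X N (\<lambda>i. g i - h i)"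
  unfolding deg0_def by (auto intro: lin_diff)

lemma deg0_scal: "deg0 t X N h \<Longrightarrow> deg0 t X N (\<lambda>i. scal c * h i)"
  unfolding deg0_def by (auto intro: lin_scal)

lemma cobounds_postcomp:
  assumes \<phi>: "linear_hom t N N' \<phi>" and h: "cobounds t X N h fa fb"
  shows "cobounds t X N' (\<lambda>i. \<phi> i * h i) (\<lambda>i. \<phi> (i+1) * fa i) (\<lambda>j. \<phi> j * fb j)"
  unfolding cobounds_def
proof (intro conjI allI impI)
  show "deg0 t X N' (\<lambda>i. \<phi> i * h i)"
    using deg0_mult[OF linear_homD(1)[OF \<phi>]] h unfolding cobounds_def by blast
next
  fix i assume i: "1 \<le> i \<and> i + 1 \<le> t"
  then have "fa i = d\<alpha> X N h i" "\<alpha> N' i * \<phi> i = \<phi> (i+1) * \<alpha> N i"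
    using h linear_homD(2)[OF \<phi>] unfolding cobounds_def by auto
  then show "\<phi> (i+1) * fa i = d\<alpha> X N' (\<lambda>i. \<phi> i * h i) i"
    by (simp only: right_diff_distrib mult.assoc[symmetric])
next
  fix j assume j: "1 \<le> j \<and> j + 2 \<le> t"
  then have "fb j = d\<beta> X N h j" "\<beta> N' j * \<phi> (j+2) = \<phi> j * \<beta> N j"
    using h linear_homD(3)[OF \<phi>] unfolding cobounds_def by auto
  then show "\<phi> j * fb j = d\<beta> X N' (\<lambda>i. \<phi> i * h i) j"
    by (simp only: right_diff_distrib mult.assoc[symmetric])
qed

lemma cobounds_precomp:
  assumes \<phi>: "linear_hom t X' X \<phi>" and h: "cobounds t X N h fa fb"
  shows "cobounds t X' N (\<lambda>i. h i * \<phi> i) (\<lambda>i. fa i * \<phi> i) (\<lambda>j. fb j * \<phi> (j+2))"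
  unfolding cobounds_def
proof (intro conjI allI impI)
  show "deg0 t X' N (\<lambda>i. h i * \<phi> i)"
    using deg0_mult[OF _ linear_homD(1)[OF \<phi>]] h unfolding cobounds_def by blast
next
  fix i assume i: "1 \<le> i \<and> i + 1 \<le> t"
  then have "fa i = d\<alpha> X N h i" "\<alpha> X i * \<phi> i = \<phi> (i+1) * \<alpha> X' i"
    using h linear_homD(2)[OF \<phi>] unfolding cobounds_def by auto
  then show "fa i * \<phi> i = d\<alpha> X' N (\<lambda>i. h i * \<phi> i) i"
    by (simp only: left_diff_distrib mult.assoc)
next
  fix j assume j: "1 \<le> j \<and> j + 2 \<le> t"
  then have "fb j = d\<beta> X N h j" "\<beta> X j * \<phi> (j+2) = \<phi> j * \<beta> X' j"
    using h linear_homD(3)[OF \<phi>] unfolding cobounds_def by auto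
  then show "fb j * \<phi> (j+2) = d\<beta> X' N (\<lambda>i. h i * \<phi> i) j"
    by (simp only: left_diff_distrib mult.assoc)
qed

lemma cobounds_add:
  assumes h: "cobounds t X N h fa fb" and k: "cobounds t X N k ga gb"
  shows "cobounds t X N (\<lambda>i. h i + k i) (\<lambda>i. fa i + ga i) (\<lambda>j. fb j + gb j)"
  unfolding cobounds_def
proof (intro conjI allI impI)
  show "deg0 t X N (\<lambda>i. h i + k i)"
    using h k deg0_add unfolding cobounds_def by blast
next
  fix i assume "1 \<le> i \<and> i + 1 \<le> t"
  then have "fa i = d\<alpha> X N h i" "ga i = d\<alpha> X N k i"
    using h k unfolding cobounds_def by auto
  then show "fa i + ga i = d\<alpha> X N (\<lambda>i. h i + k i) i"
    by (simp only: distrib_left distrib_right add_diff_add)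
next
  fix j assume "1 \<le> j \<and> j + 2 \<le> t"
  then have "fb j = d\<beta> X N h j" "gb j = d\<beta> X N k j"
    using h k unfolding cobounds_def by auto
  then show "fb j + gb j = d\<beta> X N (\<lambda>i. h i + k i) j"
    by (simp only: distrib_left distrib_right add_diff_add)
qed

lemma lin_scal_left_commute: "x \<in> lin m n \<Longrightarrow> x * (scal c * y) = scal c * (x * y)"
  using lin_scal_commute[of x m n c] by (simp only: mult.assoc[symmetric])

lemma cobounds_scal:
  assumes N: "linear_rep t N" and h: "cobounds t X N h fa fb"
  shows "cobounds t X N (\<lambda>i. scal c * h i) (\<lambda>i. scal c * fa i) (\<lambda>j. scal c * fb j)"
  unfolding cobounds_def
proof (intro conjI allI impI)
  show "deg0 t X N (\<lambda>i. scal c * h i)"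
    using h deg0_scal unfolding cobounds_def by blast
next
  fix i assume i: "1 \<le> i \<and> i + 1 \<le> t"
  then have "fa i = d\<alpha> X N h i" "\<alpha> N i * (scal c * h i) = scal c * (\<alpha> N i * h i)"
    using h lin_scal_left_commute[OF linear_repD(1)[OF N]] unfolding cobounds_def by auto
  then show "scal c * fa i = d\<alpha> X N (\<lambda>i. scal c * h i) i"
    by (simp only: right_diff_distrib mult.assoc)
next
  fix j assume j: "1 \<le> j \<and> j + 2 \<le> t"
  then have "fb j = d\<beta> X N h j" "\<beta> N j * (scal c * h (j+2)) = scal c * (\<beta> N j * h (j+2))"
    using h lin_scal_left_commute[OF linear_repD(2)[OF N]] unfolding cobounds_def by auto
  then show "scal c * fb j = d\<beta> X N (\<lambda>i. scal c * h i) j"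
    by (simp only: right_diff_distrib mult.assoc)
qed

lemma cobounds_self: "deg0 t X N h \<Longrightarrow> cobounds t X N h (d\<alpha> X N h) (d\<beta> X N h)"
  unfolding cobounds_def by simp

text \<open>Modulo coboundaries f = c1 g and x = c2 g. Since x is nontrivial, c2 is nonzero and f =
  (c1/c2) x, so any nontrivial class can replace the given generator.\<close>

lemma dim_one_generator:
  assumes N: "linear_rep t N"
    and gen: "\<And>fa fb. cocycle t X N fa fb \<Longrightarrow>
      \<exists>c h. cobounds t X N h (\<lambda>i. fa i - scal c * ga i) (\<lambda>j. fb j - scal c * gb j)"
    and x: "cocycle t X N xa xb" and nx: "\<nexists>h. cobounds t X N h xa xb"
    and f: "cocycle t X N fa fb"
  obtains c h where "cobounds t X N h (\<lambda>i. fa i - scal c * xa i) (\<lambda>j. fb j - scal c * xb j)"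
proof -
  obtain c1 h1 where 1: "cobounds t X N h1 (\<lambda>i. fa i - scal c1 * ga i) (\<lambda>j. fb j - scal c1 * gb j)"
    using gen[OF f] by blast
  obtain c2 h2 where 2: "cobounds t X N h2 (\<lambda>i. xa i - scal c2 * ga i) (\<lambda>j. xb j - scal c2 * gb j)"
    using gen[OF x] by blast
  have "c2 \<noteq> 0" using 2 nx by (auto simp: scal_0)
  then have c: "scal (- (c1 / c2)) * (y - scal c2 * z) = - (scal (c1 / c2) * y) + scal c1 * z" for y z :: "(nat \<Rightarrow> 'a) endo"
  proof -
    have neg: "scal (- a) = - scal a" for a :: 'a by transfer (auto simp: fun_eq_iff)
    have "scal (c1 / c2) * (scal c2 * z) = scal c1 * z"
      using \<open>c2 \<noteq> 0\<close> by (simp add: mult.assoc[symmetric] scal_mult)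
    then show ?thesis by (simp add: neg right_diff_distrib)
  qed
  have "cobounds t X N (\<lambda>i. h1 i + scal (- (c1 / c2)) * h2 i)
      (\<lambda>i. fa i - scal (c1 / c2) * xa i) (\<lambda>j. fb j - scal (c1 / c2) * xb j)"
    using cobounds_add[OF 1 cobounds_scal[OF N 2, of "- (c1 / c2)"]] unfolding c by simp
  then show thesis by (rule that)
qed

subsection \<open>Long exact sequences\<close>

text \<open>A short exact sequence together with a splitting r, s by linear maps at each vertex. The
  identities are those of a biproduct; r and s are in general not compatible with the arrows, and
  their failure to be so is the extension class.\<close>

locale split_ses =
  fixes t :: nat and S M T :: "'a::field rep" and \<iota> \<pi> r s :: "nat \<Rightarrow> (nat \<Rightarrow> 'a) endo"
  assumes S: "linear_rep t S" and M: "linear_rep t M" and T: "linear_rep t T"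
    and \<iota>: "linear_hom t S M \<iota>" and \<pi>: "linear_hom t M T \<pi>"
    and r: "deg0 t M S r" and s: "deg0 t T M s"
    and r\<iota>: "1 \<le> i \<Longrightarrow> i \<le> t \<Longrightarrow> r i * \<iota> i = idn (dimv S i)"
    and \<pi>s: "1 \<le> i \<Longrightarrow> i \<le> t \<Longrightarrow> \<pi> i * s i = idn (dimv T i)"
    and \<pi>\<iota>: "1 \<le> i \<Longrightarrow> i \<le> t \<Longrightarrow> \<pi> i * \<iota> i = 0"
    and rs: "1 \<le> i \<Longrightarrow> i \<le> t \<Longrightarrow> r i * s i = 0"
    and \<iota>r_s\<pi>: "1 \<le> i \<Longrightarrow> i \<le> t \<Longrightarrow> \<iota> i * r i + s i * \<pi> i = idn (dimv M i)"
begin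

lemma factor_\<iota>:
  assumes i: "1 \<le> i" "i \<le> t" and x: "x \<in> lin m (dimv M i)" and 0: "\<pi> i * x = 0"
  shows "\<iota> i * (r i * x) = x"
proof -
  have "\<iota> i * (r i * x) = (\<iota> i * r i + s i * \<pi> i) * x - s i * (\<pi> i * x)"
    by (simp add: algebra_simps)
  then show ?thesis using \<iota>r_s\<pi>[OF i] idn_mult_left[OF x] 0 by simp
qed

lemma factor_\<pi>:
  assumes i: "1 \<le> i" "i \<le> t" and x: "x \<in> lin (dimv M i) n" and 0: "x * \<iota> i = 0"
  shows "x * s i * \<pi> i = x"
proof -
  have "x * s i * \<pi> i = x * (\<iota> i * r i + s i * \<pi> i) - x * \<iota> i * r i"
    by (simp add: algebra_simps)
  then show ?thesis using \<iota>r_s\<pi>[OF i] idn_mult_right[OF x] 0 by simp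
qed

text \<open>Exactness of Ext(X,S), Ext(X,M), Ext(X,T) in the middle. If f dies in T via h, subtract
  the coboundary of the lift \<open>s h\<close>: the remainder is killed by \<open>\<pi>\<close>,
  hence comes from S through r.\<close>

lemma cocycle_lift:
  assumes X: "linear_rep t X" and f: "cocycle t X M fa fb"
    and h: "cobounds t X T h (\<lambda>i. \<pi> (i+1) * fa i) (\<lambda>j. \<pi> j * fb j)"
  obtains ga gb where "cocycle t X S ga gb"
    and "\<And>i. 1 \<le> i \<Longrightarrow> i + 1 \<le> t \<Longrightarrow> fa i = d\<alpha> X M (\<lambda>i. s i * h i) i + \<iota> (i+1) * ga i"
    and "\<And>j. 1 \<le> j \<Longrightarrow> j + 2 \<le> t \<Longrightarrow> fb j = d\<beta> X M (\<lambda>i. s i * h i) j + \<iota> j * gb j"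
proof -
  define h' where "h' = (\<lambda>i. s i * h i)"
  have h0: "deg0 t X T h" using h unfolding cobounds_def by blast
  have h': "deg0 t X M h'" unfolding h'_def by (rule deg0_mult[OF s h0])
  have \<pi>h': "\<pi> i * h' i = h i" if "1 \<le> i" "i \<le> t" for i
    using \<pi>s[OF that] idn_mult_left[OF deg0D[OF h0 that]] by (simp add: h'_def mult.assoc[symmetric])
  define fa' where "fa' = (\<lambda>i. fa i - d\<alpha> X M h' i)"
  define fb' where "fb' = (\<lambda>j. fb j - d\<beta> X M h' j)"
  have f': "cocycle t X M fa' fb'"
    unfolding fa'_def fb'_def by (rule cocycle_diff[OF f cocycle_coboundary[OF X M h']])
  have cc': "cochain t X M fa' fb'" by (rule cocycleD(1)[OF f'])
  have \<pi>fa': "\<pi> (i+1) * fa' i = 0" if i: "1 \<le> i" "i + 1 \<le> t" for i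
  proof -
    have "\<pi> (i+1) * fa' i = \<pi> (i+1) * fa i - (\<pi> (i+1) * \<alpha> M i * h' i - \<pi> (i+1) * h' (i+1) * \<alpha> X i)"
      by (simp only: fa'_def right_diff_distrib mult.assoc)
    also have "\<pi> (i+1) * \<alpha> M i * h' i = \<alpha> T i * h i"
      using linear_homD(2)[OF \<pi>, of i] \<pi>h'[of i] i by (metis add_leD1 mult.assoc)
    also have "\<pi> (i+1) * h' (i+1) = h (i+1)" using \<pi>h'[of "i+1"] i by simp
    also have "\<pi> (i+1) * fa i = d\<alpha> X T h i" using h i unfolding cobounds_def by simp
    finally show ?thesis by simp
  qed
  have \<pi>fb': "\<pi> j * fb' j = 0" if j: "1 \<le> j" "j + 2 \<le> t" for j
  proof -
    have "\<pi> j * fb' j = \<pi> j * fb j - (\<pi> j * \<beta> M j * h' (j+2) - \<pi> j * h' j * \<beta> X j)"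
      by (simp only: fb'_def right_diff_distrib mult.assoc)
    also have "\<pi> j * \<beta> M j * h' (j+2) = \<beta> T j * h (j+2)"
      using linear_homD(3)[OF \<pi>, of j, symmetric] \<pi>h'[of "j+2"] j by (simp add: mult.assoc)
    also have "\<pi> j * h' j = h j" using \<pi>h'[of j] j by simp
    also have "\<pi> j * fb j = d\<beta> X T h j" using h j unfolding cobounds_def by simp
    finally show ?thesis by simp
  qed
  define ga where "ga = (\<lambda>i. r (i+1) * fa' i)"
  define gb where "gb = (\<lambda>j. r j * fb' j)"
  have ga: "\<iota> (i+1) * ga i = fa' i" if "1 \<le> i" "i + 1 \<le> t" for i
    unfolding ga_def using factor_\<iota>[OF _ _ cochainD(1)[OF cc'] \<pi>fa'] that by simp
  have gb: "\<iota> j * gb j = fb' j" if "1 \<le> j" "j + 2 \<le> t" for j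
    unfolding gb_def using factor_\<iota>[OF _ _ cochainD(2)[OF cc'] \<pi>fb'] that by simp
  have "cochain t X S ga gb"
    unfolding ga_def gb_def by (rule cochain_postcomp[OF r cc'])
  moreover have "cocycle t X M (\<lambda>i. \<iota> (i+1) * ga i) (\<lambda>j. \<iota> j * gb j)"
    by (rule cocycle_cong[THEN iffD2, OF _ _ f']) (use ga gb in auto)
  ultimately have "cocycle t X S ga gb"
    using cocycle_cancel_mono[OF X S \<iota> r\<iota>] by blast
  then show thesis
    using that ga gb unfolding fa'_def fb'_def h'_def by (metis diff_add_cancel add.commute)
qed

text \<open>The part coming from S is asked to bound only in M. This matters for X = T, where it
  need not bound in S.\<close>

lemma cobounds_lift:
  assumes "deg0 t X T h"
    and "\<And>i. 1 \<le> i \<Longrightarrow> i + 1 \<le> t \<Longrightarrow> fa i = d\<alpha> X M (\<lambda>i. s i * h i) i + \<iota> (i+1) * ga i"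
    and "\<And>j. 1 \<le> j \<Longrightarrow> j + 2 \<le> t \<Longrightarrow> fb j = d\<beta> X M (\<lambda>i. s i * h i) j + \<iota> j * gb j"
    and "cobounds t X M u (\<lambda>i. \<iota> (i+1) * ga i) (\<lambda>j. \<iota> j * gb j)"
  shows "cobounds t X M (\<lambda>i. s i * h i + u i) fa fb"
  by (rule cobounds_cong[THEN iffD2, OF _ _ cobounds_add[OF cobounds_self[OF deg0_mult[OF s assms(1)]] assms(4)]])
    (use assms(2,3) in auto)

lemma ext_middle_covariant:
  assumes X: "linear_rep t X"
    and XS: "\<And>fa fb. cocycle t X S fa fb \<Longrightarrow> \<exists>h. cobounds t X S h fa fb"
    and XT: "\<And>fa fb. cocycle t X T fa fb \<Longrightarrow> \<exists>h. cobounds t X T h fa fb"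
    and f: "cocycle t X M fa fb"
  shows "\<exists>h. cobounds t X M h fa fb"
proof -
  obtain h where h: "cobounds t X T h (\<lambda>i. \<pi> (i+1) * fa i) (\<lambda>j. \<pi> j * fb j)"
    using XT[OF cocycle_postcomp[OF \<pi> f]] by blast
  obtain ga gb where g: "cocycle t X S ga gb"
    and eq: "\<And>i. 1 \<le> i \<Longrightarrow> i + 1 \<le> t \<Longrightarrow> fa i = d\<alpha> X M (\<lambda>i. s i * h i) i + \<iota> (i+1) * ga i"
      "\<And>j. 1 \<le> j \<Longrightarrow> j + 2 \<le> t \<Longrightarrow> fb j = d\<beta> X M (\<lambda>i. s i * h i) j + \<iota> j * gb j"
    using cocycle_lift[OF X f h] by metis
  obtain u where "cobounds t X S u ga gb" using XS[OF g] by blast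
  then have "cobounds t X M (\<lambda>i. \<iota> i * u i) (\<lambda>i. \<iota> (i+1) * ga i) (\<lambda>j. \<iota> j * gb j)"
    by (rule cobounds_postcomp[OF \<iota>])
  then show ?thesis
    using cobounds_lift[OF _ eq] h unfolding cobounds_def by blast
qed

lemma ext_middle_contravariant:
  assumes X: "linear_rep t X"
    and SX: "\<And>fa fb. cocycle t S X fa fb \<Longrightarrow> \<exists>h. cobounds t S X h fa fb"
    and TX: "\<And>fa fb. cocycle t T X fa fb \<Longrightarrow> \<exists>h. cobounds t T X h fa fb"
    and f: "cocycle t M X fa fb"
  shows "\<exists>h. cobounds t M X h fa fb"
proof -
  obtain h where h: "cobounds t S X h (\<lambda>i. fa i * \<iota> i) (\<lambda>j. fb j * \<iota> (j+2))"
    using SX[OF cocycle_precomp[OF \<iota> f]] by blast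
  \<comment> \<open>Dual to \<open>cocycle_lift\<close>: extending h along r leaves a remainder that
    vanishes on the image of \<open>\<iota>\<close> and therefore factors through
    \<open>\<pi>\<close>.\<close>
  define h' where "h' = (\<lambda>i. h i * r i)"
  have h0: "deg0 t S X h" using h unfolding cobounds_def by blast
  have h': "deg0 t M X h'" unfolding h'_def by (rule deg0_mult[OF h0 r])
  have h'\<iota>: "h' i * \<iota> i = h i" if "1 \<le> i" "i \<le> t" for i
    using r\<iota>[OF that] idn_mult_right[OF deg0D[OF h0 that]] by (simp add: h'_def mult.assoc)
  define fa' where "fa' = (\<lambda>i. fa i - d\<alpha> M X h' i)"
  define fb' where "fb' = (\<lambda>j. fb j - d\<beta> M X h' j)"
  have f': "cocycle t M X fa' fb'"
    unfolding fa'_def fb'_def by (rule cocycle_diff[OF f cocycle_coboundary[OF M X h']])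
  have cc': "cochain t M X fa' fb'" by (rule cocycleD(1)[OF f'])
  have fa'\<iota>: "fa' i * \<iota> i = 0" if i: "1 \<le> i" "i + 1 \<le> t" for i
  proof -
    have "fa' i * \<iota> i = fa i * \<iota> i - (\<alpha> X i * (h' i * \<iota> i) - h' (i+1) * (\<alpha> M i * \<iota> i))"
      by (simp only: fa'_def left_diff_distrib mult.assoc)
    also have "h' (i+1) * (\<alpha> M i * \<iota> i) = h (i+1) * \<alpha> S i"
      using linear_homD(2)[OF \<iota>, of i] h'\<iota>[of "i+1"] i by (simp add: mult.assoc[symmetric])
    also have "h' i * \<iota> i = h i" using h'\<iota>[of i] i by simp
    also have "fa i * \<iota> i = d\<alpha> S X h i" using h i unfolding cobounds_def by simp
    finally show ?thesis by simp
  qed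
  have fb'\<iota>: "fb' j * \<iota> (j+2) = 0" if j: "1 \<le> j" "j + 2 \<le> t" for j
  proof -
    have "fb' j * \<iota> (j+2) = fb j * \<iota> (j+2) - (\<beta> X j * (h' (j+2) * \<iota> (j+2)) - h' j * (\<beta> M j * \<iota> (j+2)))"
      by (simp only: fb'_def left_diff_distrib mult.assoc)
    also have "h' j * (\<beta> M j * \<iota> (j+2)) = h j * \<beta> S j"
      using linear_homD(3)[OF \<iota>, of j] h'\<iota>[of j] j by (simp add: mult.assoc[symmetric])
    also have "h' (j+2) * \<iota> (j+2) = h (j+2)" using h'\<iota>[of "j+2"] j by simp
    also have "fb j * \<iota> (j+2) = d\<beta> S X h j" using h j unfolding cobounds_def by simp
    finally show ?thesis by simp
  qed
  define ga where "ga = (\<lambda>i. fa' i * s i)"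
  define gb where "gb = (\<lambda>j. fb' j * s (j+2))"
  have ga: "ga i * \<pi> i = fa' i" if "1 \<le> i" "i + 1 \<le> t" for i
    unfolding ga_def using factor_\<pi>[OF _ _ cochainD(1)[OF cc'] fa'\<iota>] that by simp
  have gb: "gb j * \<pi> (j+2) = fb' j" if "1 \<le> j" "j + 2 \<le> t" for j
    unfolding gb_def using factor_\<pi>[OF _ _ cochainD(2)[OF cc'] fb'\<iota>] that by simp
  have "cochain t T X ga gb"
    unfolding ga_def gb_def by (rule cochain_precomp[OF s cc'])
  moreover have "cocycle t M X (\<lambda>i. ga i * \<pi> i) (\<lambda>j. gb j * \<pi> (j+2))"
    by (rule cocycle_cong[THEN iffD2, OF _ _ f']) (use ga gb in auto)
  ultimately have "cocycle t T X ga gb"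
    using cocycle_cancel_epi[OF T X \<pi> \<pi>s] by blast
  then obtain u where "cobounds t T X u ga gb" using TX by blast
  then have u: "cobounds t M X (\<lambda>i. u i * \<pi> i) (\<lambda>i. ga i * \<pi> i) (\<lambda>j. gb j * \<pi> (j+2))"
    by (rule cobounds_precomp[OF \<pi>])
  have "cobounds t M X (\<lambda>i. h' i + u i * \<pi> i) fa fb"
    by (rule cobounds_cong[THEN iffD2, OF _ _ cobounds_add[OF cobounds_self[OF h'] u]])
      (simp_all only: ga gb, simp_all add: fa'_def fb'_def)
  then show ?thesis by blast
qed

text \<open>The class of the extension is represented by the cocycle that measures the failure of the
  vertexwise section \<open>s\<close> to be a homomorphism.\<close>
lemma extension_class:
  obtains xa xb where "cocycle t T S xa xb"
    and "\<And>i. 1 \<le> i \<Longrightarrow> i + 1 \<le> t \<Longrightarrow> d\<alpha> T M s i = \<iota> (i+1) * xa i"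
    and "\<And>j. 1 \<le> j \<Longrightarrow> j + 2 \<le> t \<Longrightarrow> d\<beta> T M s j = \<iota> j * xb j"
proof -
  have f: "cocycle t T M (d\<alpha> T M s) (d\<beta> T M s)"
    by (rule cocycle_coboundary[OF T M s])
  have "cobounds t T T (\<lambda>i. \<pi> i * s i) (\<lambda>i. \<pi> (i+1) * d\<alpha> T M s i) (\<lambda>j. \<pi> j * d\<beta> T M s j)"
    by (rule cobounds_postcomp[OF \<pi> cobounds_self[OF s]])
  then have "\<pi> (i+1) * d\<alpha> T M s i = 0" if "1 \<le> i" "i + 1 \<le> t" for i
    using that \<pi>s[of i] \<pi>s[of "i+1"] idn_mult_left[OF linear_repD(1)[OF T, of i]] idn_mult_right[OF linear_repD(1)[OF T, of i]]
    unfolding cobounds_def by simp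
  moreover have "\<pi> j * d\<beta> T M s j = 0" if "1 \<le> j" "j + 2 \<le> t" for j
    using that \<pi>s[of j] \<pi>s[of "j+2"] idn_mult_left[OF linear_repD(2)[OF T, of j]] idn_mult_right[OF linear_repD(2)[OF T, of j]]
      \<open>cobounds t T T (\<lambda>i. \<pi> i * s i) _ _\<close>
    unfolding cobounds_def by simp
  \<comment> \<open>\<open>\<pi>\<close> times the coboundary of s is the coboundary of the
    identity, which is 0. So \<open>cocycle_lift\<close> applies with h = 0, and the defect of s is
    \<open>\<iota>\<close> times a cocycle without any correction term.\<close>
  ultimately have "cobounds t T T (\<lambda>i. 0) (\<lambda>i. \<pi> (i+1) * d\<alpha> T M s i) (\<lambda>j. \<pi> j * d\<beta> T M s j)"
    unfolding cobounds_def deg0_def by (simp add: lin_0)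
  from cocycle_lift[OF T f this] show thesis using that by (metis (no_types, lifting) add.left_neutral diff_0_right mult_zero_left mult_zero_right)
qed

text \<open>If x is the coboundary of u, then s and \<open>\<iota> u\<close> have the same
  coboundary, so \<open>s - \<iota> u\<close> is a homomorphism. It is still a section because
  \<open>\<pi> \<iota> = 0\<close>.\<close>

lemma splits_if_class_trivial:
  assumes x: "\<And>i. 1 \<le> i \<Longrightarrow> i + 1 \<le> t \<Longrightarrow> d\<alpha> T M s i = \<iota> (i+1) * xa i"
      "\<And>j. 1 \<le> j \<Longrightarrow> j + 2 \<le> t \<Longrightarrow> d\<beta> T M s j = \<iota> j * xb j"
    and u: "cobounds t T S u xa xb"
  shows "\<exists>\<sigma>. linear_hom t T M \<sigma> \<and> (\<forall>i\<in>{1..t}. \<pi> i * \<sigma> i = idn (dimv T i))"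
proof -
  define \<sigma> where "\<sigma> = (\<lambda>i. s i - \<iota> i * u i)"
  have u0: "deg0 t T S u" using u unfolding cobounds_def by blast
  have \<iota>u: "cobounds t T M (\<lambda>i. \<iota> i * u i) (\<lambda>i. \<iota> (i+1) * xa i) (\<lambda>j. \<iota> j * xb j)"
    by (rule cobounds_postcomp[OF \<iota> u])
  have "deg0 t T M \<sigma>"
    unfolding \<sigma>_def by (rule deg0_diff[OF s deg0_mult[OF linear_homD(1)[OF \<iota>] u0]])
  moreover have "\<alpha> M i * \<sigma> i = \<sigma> (i+1) * \<alpha> T i" if i: "i + 1 \<le> t" for i
  proof (cases "i = 0")
    case False
    then have "d\<alpha> T M (\<lambda>i. \<iota> i * u i) i = d\<alpha> T M s i"
      using \<iota>u x(1)[of i] i unfolding cobounds_def by simp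
    then show ?thesis by (simp add: \<sigma>_def algebra_simps)
  qed (simp add: endo_fam_0)
  moreover have "\<beta> M j * \<sigma> (j+2) = \<sigma> j * \<beta> T j" if j: "j + 2 \<le> t" for j
  proof (cases "j = 0")
    case False
    then have "d\<beta> T M (\<lambda>i. \<iota> i * u i) j = d\<beta> T M s j"
      using \<iota>u x(2)[of j] j unfolding cobounds_def by simp
    then show ?thesis by (simp add: \<sigma>_def algebra_simps)
  qed (simp add: endo_fam_0)
  moreover have "\<pi> i * \<sigma> i = idn (dimv T i)" if "i \<in> {1..t}" for i
    using that \<pi>s[of i] \<pi>\<iota>[of i] by (simp add: \<sigma>_def right_diff_distrib mult.assoc[symmetric])
  ultimately show ?thesis unfolding linear_hom_def by blast
qed

text \<open>The connecting map \<open>Hom(T,T) \<rightarrow> Ext\<^sup>1(T,S)\<close> hits the class of the extension, hence is onto.\<close>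
lemma ext_middle_of_generator:
  assumes gen: "\<And>fa fb. cocycle t T S fa fb \<Longrightarrow>
      \<exists>c h. cobounds t T S h (\<lambda>i. fa i - scal c * ga i) (\<lambda>j. fb j - scal c * gb j)"
    and TT: "\<And>fa fb. cocycle t T T fa fb \<Longrightarrow> \<exists>h. cobounds t T T h fa fb"
    and ns: "\<nexists>\<sigma>. linear_hom t T M \<sigma> \<and> (\<forall>i\<in>{1..t}. \<pi> i * \<sigma> i = idn (dimv T i))"
    and f: "cocycle t T M fa fb"
  shows "\<exists>h. cobounds t T M h fa fb"
proof -
  obtain h where h: "cobounds t T T h (\<lambda>i. \<pi> (i+1) * fa i) (\<lambda>j. \<pi> j * fb j)"
    using TT[OF cocycle_postcomp[OF \<pi> f]] by blast
  obtain ya yb where y: "cocycle t T S ya yb"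
    and eq: "\<And>i. 1 \<le> i \<Longrightarrow> i + 1 \<le> t \<Longrightarrow> fa i = d\<alpha> T M (\<lambda>i. s i * h i) i + \<iota> (i+1) * ya i"
      "\<And>j. 1 \<le> j \<Longrightarrow> j + 2 \<le> t \<Longrightarrow> fb j = d\<beta> T M (\<lambda>i. s i * h i) j + \<iota> j * yb j"
    using cocycle_lift[OF T f h] by metis
  obtain xa xb where x: "cocycle t T S xa xb"
    and xs: "\<And>i. 1 \<le> i \<Longrightarrow> i + 1 \<le> t \<Longrightarrow> d\<alpha> T M s i = \<iota> (i+1) * xa i"
      "\<And>j. 1 \<le> j \<Longrightarrow> j + 2 \<le> t \<Longrightarrow> d\<beta> T M s j = \<iota> j * xb j"
    using extension_class by metis
  have "\<nexists>h. cobounds t T S h xa xb" using splits_if_class_trivial[OF xs] ns by blast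
  then obtain c u where u: "cobounds t T S u (\<lambda>i. ya i - scal c * xa i) (\<lambda>j. yb j - scal c * xb j)"
    using dim_one_generator[OF S gen x _ y] by metis
  \<comment> \<open>Here y = c x + du, and \<open>\<iota> x\<close> is the coboundary of s. Hence
    \<open>\<iota> y\<close> is the coboundary of \<open>\<iota> u + c s\<close> in M.\<close>
  have \<iota>u: "cobounds t T M (\<lambda>i. \<iota> i * u i + scal c * s i)
     (\<lambda>i. \<iota> (i+1) * (ya i - scal c * xa i) + scal c * d\<alpha> T M s i)
     (\<lambda>j. \<iota> j * (yb j - scal c * xb j) + scal c * d\<beta> T M s j)"
    by (rule cobounds_add[OF cobounds_postcomp[OF \<iota> u] cobounds_scal[OF M cobounds_self[OF s]]])
  have "cobounds t T M (\<lambda>i. \<iota> i * u i + scal c * s i) (\<lambda>i. \<iota> (i+1) * ya i) (\<lambda>j. \<iota> j * yb j)"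
  proof (rule cobounds_cong[THEN iffD1, OF _ _ \<iota>u])
    fix i assume i: "1 \<le> i" "i + 1 \<le> t"
    have "\<iota> (i+1) * (scal c * xa i) = scal c * (\<iota> (i+1) * xa i)"
      using deg0D[OF linear_homD(1)[OF \<iota>], of "i+1"] i by (intro lin_scal_left_commute) auto
    then show "\<iota> (i+1) * (ya i - scal c * xa i) + scal c * d\<alpha> T M s i = \<iota> (i+1) * ya i"
      unfolding xs(1)[OF i] by (simp add: right_diff_distrib)
  next
    fix j assume j: "1 \<le> j" "j + 2 \<le> t"
    have "\<iota> j * (scal c * xb j) = scal c * (\<iota> j * xb j)"
      using deg0D[OF linear_homD(1)[OF \<iota>], of j] j by (intro lin_scal_left_commute) auto
    then show "\<iota> j * (yb j - scal c * xb j) + scal c * d\<beta> T M s j = \<iota> j * yb j"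
      unfolding xs(2)[OF j] by (simp add: right_diff_distrib)
  qed
  then show ?thesis
    using cobounds_lift[OF _ eq] h unfolding cobounds_def by blast
qed

end

lemma deg0_inverse_hom:
  assumes M: "linear_rep t M" and N: "linear_rep t N"
    and \<phi>: "linear_hom t M N \<phi>" and \<psi>: "deg0 t N M \<psi>"
    and \<psi>\<phi>: "\<And>i. 1 \<le> i \<Longrightarrow> i \<le> t \<Longrightarrow> \<psi> i * \<phi> i = idn (dimv M i)"
    and \<phi>\<psi>: "\<And>i. 1 \<le> i \<Longrightarrow> i \<le> t \<Longrightarrow> \<phi> i * \<psi> i = idn (dimv N i)"
  shows "linear_hom t N M \<psi>"
  unfolding linear_hom_def
proof (intro conjI allI impI \<psi>)
  fix i assume i: "i + 1 \<le> t"
  show "\<alpha> M i * \<psi> i = \<psi> (i+1) * \<alpha> N i"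
  proof (cases "i = 0")
    case False
    have "\<alpha> M i * \<psi> i = (\<psi> (i+1) * \<phi> (i+1)) * \<alpha> M i * \<psi> i"
      using \<psi>\<phi>[of "i+1"] idn_mult_left[OF linear_repD(1)[OF M, of i]] i False by simp
    also have "\<dots> = \<psi> (i+1) * (\<phi> (i+1) * \<alpha> M i) * \<psi> i" by (simp only: mult.assoc)
    also have "\<dots> = \<psi> (i+1) * (\<alpha> N i * (\<phi> i * \<psi> i))"
      unfolding linear_homD(2)[OF \<phi> i, symmetric] by (simp only: mult.assoc)
    also have "\<dots> = \<psi> (i+1) * \<alpha> N i"
      using \<phi>\<psi>[of i] idn_mult_right[OF linear_repD(1)[OF N, of i]] i False by simp
    finally show ?thesis .
  qed (simp add: endo_fam_0)
next
  fix j assume j: "j + 2 \<le> t"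
  show "\<beta> M j * \<psi> (j+2) = \<psi> j * \<beta> N j"
  proof (cases "j = 0")
    case False
    have "\<beta> M j * \<psi> (j+2) = (\<psi> j * \<phi> j) * \<beta> M j * \<psi> (j+2)"
      using \<psi>\<phi>[of j] idn_mult_left[OF linear_repD(2)[OF M, of j]] j False by simp
    also have "\<dots> = \<psi> j * (\<phi> j * \<beta> M j) * \<psi> (j+2)" by (simp only: mult.assoc)
    also have "\<dots> = \<psi> j * (\<beta> N j * (\<phi> (j+2) * \<psi> (j+2)))"
      unfolding linear_homD(3)[OF \<phi> j, symmetric] by (simp only: mult.assoc)
    also have "\<dots> = \<psi> j * \<beta> N j"
      using \<phi>\<psi>[of "j+2"] idn_mult_right[OF linear_repD(2)[OF N, of j]] j False by simp
    finally show ?thesis .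
  qed (simp add: endo_fam_0)
qed

section \<open>Uniqueness of the middle term of a non-split extension\<close>

context split_ses
begin

lemma lins:
  assumes "1 \<le> i" "i \<le> t"
  shows "\<iota> i \<in> lin (dimv S i) (dimv M i)" "\<pi> i \<in> lin (dimv M i) (dimv T i)"
    "r i \<in> lin (dimv M i) (dimv S i)" "s i \<in> lin (dimv T i) (dimv M i)"
  using deg0D[OF linear_homD(1)[OF \<iota>] assms] deg0D[OF linear_homD(1)[OF \<pi>] assms]
    deg0D[OF r assms] deg0D[OF s assms] by auto

lemma zero_if_zero_on_parts:
  assumes i: "1 \<le> i" "i \<le> t" and x: "x \<in> lin (dimv M i) n" and "x * \<iota> i = 0" "x * s i = 0"
  shows "x = 0"
  using factor_\<pi>[OF i x] assms by simp

text \<open>Changes the representative of the class without changing M: if s has the defect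
  \<open>\<iota> y\<close>, the new data have the cocycle (y - du)/c. The maps r and s must change
  together to keep \<open>r s = 0\<close>.\<close>

lemma rescale_and_shift:
  assumes c: "c \<noteq> 0" and u: "deg0 t T S u"
  shows "split_ses t S M T (\<lambda>i. scal c * \<iota> i) \<pi> (\<lambda>i. scal (1/c) * (r i + u i * \<pi> i)) (\<lambda>i. s i - \<iota> i * u i)"
proof
  show "linear_rep t S" "linear_rep t M" "linear_rep t T" "linear_hom t M T \<pi>"
    by (rule S M T \<pi>)+
  note \<iota>0 = linear_homD(1)[OF \<iota>] and \<pi>0 = linear_homD(1)[OF \<pi>]
  show "linear_hom t S M (\<lambda>i. scal c * \<iota> i)"
    unfolding linear_hom_def
  proof (intro conjI allI impI deg0_scal \<iota>0)
    fix i assume i: "i + 1 \<le> t"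
    show "\<alpha> M i * (scal c * \<iota> i) = scal c * \<iota> (i+1) * \<alpha> S i"
      using linear_homD(2)[OF \<iota> i] lin_scal_left_commute[OF linear_repD(1)[OF M _ i]]
      by (cases "i = 0") (simp_all add: endo_fam_0 mult.assoc)
  next
    fix j assume j: "j + 2 \<le> t"
    show "\<beta> M j * (scal c * \<iota> (j+2)) = scal c * \<iota> j * \<beta> S j"
      using linear_homD(3)[OF \<iota> j] lin_scal_left_commute[OF linear_repD(2)[OF M _ j]]
      by (cases "j = 0") (simp_all add: endo_fam_0 mult.assoc)
  qed
  show "deg0 t M S (\<lambda>i. scal (1/c) * (r i + u i * \<pi> i))"
    by (intro deg0_scal deg0_add r deg0_mult[OF u \<pi>0])
  show "deg0 t T M (\<lambda>i. s i - \<iota> i * u i)"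
    by (intro deg0_diff s deg0_mult[OF \<iota>0 u])
next
  fix i assume i: "1 \<le> i" "i \<le> t"
  note [simp] = r\<iota>[OF i] \<pi>s[OF i] \<pi>\<iota>[OF i] rs[OF i]
  note L = lins[OF i] and U = deg0D[OF u i]
  have [simp]: "scal (1/c) * (scal c * y) = y" "scal c * (scal (1/c) * y) = y" for y :: "(nat \<Rightarrow> 'a) endo"
    using c by (simp_all add: mult.assoc[symmetric] scal_mult scal_1_mult)
  have a1: "r i * (\<iota> i * y) = idn (dimv S i) * y" "\<pi> i * (\<iota> i * y) = 0"
    "\<pi> i * (s i * y) = idn (dimv T i) * y" "r i * (s i * y) = 0" for y
    by (simp_all add: mult.assoc[symmetric])
  have ru: "r i + u i * \<pi> i \<in> lin (dimv M i) (dimv S i)"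
    by (intro lin_add lin_mult[OF U] L)
  have "scal (1/c) * (r i + u i * \<pi> i) * (scal c * \<iota> i) = (r i + u i * \<pi> i) * \<iota> i"
    by (simp only: mult.assoc lin_scal_left_commute[OF ru]) simp
  also have "\<dots> = idn (dimv S i)" by (simp add: distrib_right mult.assoc)
  finally show "scal (1/c) * (r i + u i * \<pi> i) * (scal c * \<iota> i) = idn (dimv S i)" .
  show "\<pi> i * (s i - \<iota> i * u i) = idn (dimv T i)"
    by (simp add: right_diff_distrib a1)
  show "\<pi> i * (scal c * \<iota> i) = 0"
    by (simp add: lin_scal_left_commute[OF L(2)])
  have "(r i + u i * \<pi> i) * (s i - \<iota> i * u i) = 0"
    using idn_mult_left[OF U] idn_mult_right[OF U]
    by (simp add: distrib_right right_diff_distrib mult.assoc a1)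
  then show "scal (1/c) * (r i + u i * \<pi> i) * (s i - \<iota> i * u i) = 0"
    by (simp add: mult.assoc)
  have "scal c * \<iota> i * (scal (1/c) * (r i + u i * \<pi> i)) = \<iota> i * (r i + u i * \<pi> i)"
    by (simp only: mult.assoc lin_scal_left_commute[OF L(1)]) simp
  then show "scal c * \<iota> i * (scal (1/c) * (r i + u i * \<pi> i)) + (s i - \<iota> i * u i) * \<pi> i = idn (dimv M i)"
    using \<iota>r_s\<pi>[OF i] by (simp add: distrib_left left_diff_distrib mult.assoc)
qed

text \<open>Both splittings identify the middle terms with S + T at each vertex, and the cocycle is
  the off-diagonal block of the arrows. Equal cocycles thus mean equal arrows, and
  \<open>\<phi>\<close>, \<open>\<psi>\<close> are the resulting identifications.\<close>

lemma iso_of_same_class: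
  assumes M': "split_ses t S M' T \<iota>' \<pi>' r' s'"
    and x: "\<And>i. 1 \<le> i \<Longrightarrow> i + 1 \<le> t \<Longrightarrow> d\<alpha> T M s i = \<iota> (i+1) * xa i"
      "\<And>j. 1 \<le> j \<Longrightarrow> j + 2 \<le> t \<Longrightarrow> d\<beta> T M s j = \<iota> j * xb j"
    and x': "\<And>i. 1 \<le> i \<Longrightarrow> i + 1 \<le> t \<Longrightarrow> d\<alpha> T M' s' i = \<iota>' (i+1) * xa i"
      "\<And>j. 1 \<le> j \<Longrightarrow> j + 2 \<le> t \<Longrightarrow> d\<beta> T M' s' j = \<iota>' j * xb j"
  shows "\<exists>\<phi> \<psi>. linear_hom t M M' \<phi> \<and> linear_hom t M' M \<psi> \<and>
     (\<forall>i\<in>{1..t}. \<psi> i * \<phi> i = idn (dimv M i) \<and> \<phi> i * \<psi> i = idn (dimv M' i))"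
proof -
  interpret M': split_ses t S M' T \<iota>' \<pi>' r' s' by (rule M')
  define \<phi> where "\<phi> = (\<lambda>i. \<iota>' i * r i + s' i * \<pi> i)"
  define \<psi> where "\<psi> = (\<lambda>i. \<iota> i * r' i + s i * \<pi>' i)"
  have \<phi>0: "deg0 t M M' \<phi>" and \<psi>0: "deg0 t M' M \<psi>"
    unfolding \<phi>_def \<psi>_def
    by (intro deg0_add deg0_mult[OF linear_homD(1)[OF M'.\<iota>] r] deg0_mult[OF M'.s linear_homD(1)[OF \<pi>]]
        deg0_mult[OF linear_homD(1)[OF \<iota>] M'.r] deg0_mult[OF s linear_homD(1)[OF M'.\<pi>]])+
  have \<phi>\<iota>: "\<phi> i * \<iota> i = \<iota>' i" and \<phi>s: "\<phi> i * s i = s' i"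
    and \<psi>\<phi>: "\<psi> i * \<phi> i = idn (dimv M i)" and \<phi>\<psi>: "\<phi> i * \<psi> i = idn (dimv M' i)"
    if i: "1 \<le> i" "i \<le> t" for i
  proof -
    have a: "r i * (\<iota> i * y) = idn (dimv S i) * y" "\<pi> i * (\<iota> i * y) = 0"
      "\<pi> i * (s i * y) = idn (dimv T i) * y" "r i * (s i * y) = 0"
      "r' i * (\<iota>' i * y) = idn (dimv S i) * y" "\<pi>' i * (\<iota>' i * y) = 0"
      "\<pi>' i * (s' i * y) = idn (dimv T i) * y" "r' i * (s' i * y) = 0" for y
      using r\<iota>[OF i] \<pi>s[OF i] \<pi>\<iota>[OF i] rs[OF i] M'.r\<iota>[OF i] M'.\<pi>s[OF i] M'.\<pi>\<iota>[OF i] M'.rs[OF i]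
      by (simp_all add: mult.assoc[symmetric])
    note L = lins[OF i] and L' = M'.lins[OF i]
    show "\<phi> i * \<iota> i = \<iota>' i"
      using r\<iota>[OF i] \<pi>\<iota>[OF i] idn_mult_right[OF L'(1)] by (simp add: \<phi>_def distrib_right mult.assoc)
    show "\<phi> i * s i = s' i"
      using rs[OF i] \<pi>s[OF i] idn_mult_right[OF L'(4)] by (simp add: \<phi>_def distrib_right mult.assoc)
    show "\<psi> i * \<phi> i = idn (dimv M i)"
      using \<iota>r_s\<pi>[OF i] idn_mult_left[OF L(3)] idn_mult_left[OF L(2)]
      by (simp add: \<phi>_def \<psi>_def distrib_right distrib_left mult.assoc a)
    show "\<phi> i * \<psi> i = idn (dimv M' i)"
      using M'.\<iota>r_s\<pi>[OF i] idn_mult_left[OF L'(3)] idn_mult_left[OF L'(2)]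
      by (simp add: \<phi>_def \<psi>_def distrib_right distrib_left mult.assoc a)
  qed
  have \<phi>: "linear_hom t M M' \<phi>"
    unfolding linear_hom_def
  proof (intro conjI allI impI \<phi>0)
    fix i assume i: "i + 1 \<le> t"
    show "\<alpha> M' i * \<phi> i = \<phi> (i+1) * \<alpha> M i"
    proof (cases "i = 0")
      case False
      have i1: "1 \<le> i" "i \<le> t" "1 \<le> i + 1" using i False by auto
      \<comment> \<open>Compatibility is tested separately on the images of \<open>\<iota>\<close>
        and s, which together span M. On \<open>\<iota>\<close> it is the homomorphism property, on
        s it is the equality of the cocycles.\<close>
      have "d\<alpha> M M' \<phi> i = 0"
      proof (rule zero_if_zero_on_parts[OF i1(1,2)])
        show "d\<alpha> M M' \<phi> i \<in> lin (dimv M i) (dimv M' (i+1))"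
          by (rule cochainD(1)[OF cochain_coboundary[OF M M'.M \<phi>0] i1(1) i])
        have "d\<alpha> M M' \<phi> i * \<iota> i = \<alpha> M' i * (\<phi> i * \<iota> i) - \<phi> (i+1) * (\<alpha> M i * \<iota> i)"
          by (simp only: left_diff_distrib mult.assoc)
        also have "\<dots> = \<alpha> M' i * \<iota>' i - (\<phi> (i+1) * \<iota> (i+1)) * \<alpha> S i"
          unfolding linear_homD(2)[OF \<iota> i] \<phi>\<iota>[OF i1(1,2)] by (simp only: mult.assoc)
        finally show "d\<alpha> M M' \<phi> i * \<iota> i = 0"
          using linear_homD(2)[OF M'.\<iota> i] \<phi>\<iota>[OF i1(3) i] by simp
        have "d\<alpha> M M' \<phi> i * s i = \<alpha> M' i * (\<phi> i * s i) - \<phi> (i+1) * (\<alpha> M i * s i)"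
          by (simp only: left_diff_distrib mult.assoc)
        also have "\<alpha> M i * s i = \<iota> (i+1) * xa i + s (i+1) * \<alpha> T i"
          using x(1)[OF i1(1) i] by (simp add: diff_eq_eq)
        also have "\<phi> (i+1) * (\<iota> (i+1) * xa i + s (i+1) * \<alpha> T i)
            = (\<phi> (i+1) * \<iota> (i+1)) * xa i + (\<phi> (i+1) * s (i+1)) * \<alpha> T i"
          by (simp only: distrib_left mult.assoc)
        finally show "d\<alpha> M M' \<phi> i * s i = 0"
          using \<phi>\<iota>[OF i1(3) i] \<phi>s[OF i1(3) i] \<phi>s[OF i1(1,2)] x'(1)[OF i1(1) i] by (simp add: diff_eq_eq)
      qed
      then show ?thesis by simp
    qed (simp add: endo_fam_0)
  next
    fix j assume j: "j + 2 \<le> t"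
    show "\<beta> M' j * \<phi> (j+2) = \<phi> j * \<beta> M j"
    proof (cases "j = 0")
      case False
      have j1: "1 \<le> j" "j \<le> t" "1 \<le> j + 2" using j False by auto
      have "d\<beta> M M' \<phi> j = 0"
      proof (rule zero_if_zero_on_parts[OF j1(3) j])
        show "d\<beta> M M' \<phi> j \<in> lin (dimv M (j+2)) (dimv M' j)"
          by (rule cochainD(2)[OF cochain_coboundary[OF M M'.M \<phi>0] j1(1) j])
        have "d\<beta> M M' \<phi> j * \<iota> (j+2) = \<beta> M' j * (\<phi> (j+2) * \<iota> (j+2)) - \<phi> j * (\<beta> M j * \<iota> (j+2))"
          by (simp only: left_diff_distrib mult.assoc)
        also have "\<dots> = \<beta> M' j * \<iota>' (j+2) - (\<phi> j * \<iota> j) * \<beta> S j"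
          unfolding linear_homD(3)[OF \<iota> j] \<phi>\<iota>[OF j1(3) j] by (simp only: mult.assoc)
        finally show "d\<beta> M M' \<phi> j * \<iota> (j+2) = 0"
          using linear_homD(3)[OF M'.\<iota> j] \<phi>\<iota>[OF j1(1,2)] by simp
        have "d\<beta> M M' \<phi> j * s (j+2) = \<beta> M' j * (\<phi> (j+2) * s (j+2)) - \<phi> j * (\<beta> M j * s (j+2))"
          by (simp only: left_diff_distrib mult.assoc)
        also have "\<beta> M j * s (j+2) = \<iota> j * xb j + s j * \<beta> T j"
          using x(2)[OF j1(1) j] by (simp add: diff_eq_eq)
        also have "\<phi> j * (\<iota> j * xb j + s j * \<beta> T j) = (\<phi> j * \<iota> j) * xb j + (\<phi> j * s j) * \<beta> T j"
          by (simp only: distrib_left mult.assoc)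
        finally show "d\<beta> M M' \<phi> j * s (j+2) = 0"
          using \<phi>\<iota>[OF j1(1,2)] \<phi>s[OF j1(1,2)] \<phi>s[OF j1(3) j] x'(2)[OF j1(1) j] by (simp add: diff_eq_eq)
      qed
      then show ?thesis by simp
    qed (simp add: endo_fam_0)
  qed
  have "linear_hom t M' M \<psi>"
    by (rule deg0_inverse_hom[OF M M'.M \<phi> \<psi>0 \<psi>\<phi> \<phi>\<psi>])
  then show ?thesis using \<phi> \<psi>\<phi> \<phi>\<psi> by (metis atLeastAtMost_iff)
qed

text \<open>Two nonzero classes in a space of dimension one are proportional: y = c x + du with c
  nonzero. Rescaling and shifting the data of M' by c and u makes the cocycles equal.\<close>

lemma iso_if_nonsplit:
  assumes M': "split_ses t S M' T \<iota>' \<pi>' r' s'"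
    and gen: "\<And>fa fb. cocycle t T S fa fb \<Longrightarrow>
      \<exists>c h. cobounds t T S h (\<lambda>i. fa i - scal c * ga i) (\<lambda>j. fb j - scal c * gb j)"
    and ns: "\<nexists>\<sigma>. linear_hom t T M \<sigma> \<and> (\<forall>i\<in>{1..t}. \<pi> i * \<sigma> i = idn (dimv T i))"
    and ns': "\<nexists>\<sigma>. linear_hom t T M' \<sigma> \<and> (\<forall>i\<in>{1..t}. \<pi>' i * \<sigma> i = idn (dimv T i))"
  shows "\<exists>\<phi> \<psi>. linear_hom t M M' \<phi> \<and> linear_hom t M' M \<psi> \<and>
     (\<forall>i\<in>{1..t}. \<psi> i * \<phi> i = idn (dimv M i) \<and> \<phi> i * \<psi> i = idn (dimv M' i))"
proof -
  interpret M': split_ses t S M' T \<iota>' \<pi>' r' s' by (rule M')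
  obtain xa xb where x: "cocycle t T S xa xb"
    and xs: "\<And>i. 1 \<le> i \<Longrightarrow> i + 1 \<le> t \<Longrightarrow> d\<alpha> T M s i = \<iota> (i+1) * xa i"
      "\<And>j. 1 \<le> j \<Longrightarrow> j + 2 \<le> t \<Longrightarrow> d\<beta> T M s j = \<iota> j * xb j"
    using extension_class by metis
  obtain ya yb where y: "cocycle t T S ya yb"
    and ys: "\<And>i. 1 \<le> i \<Longrightarrow> i + 1 \<le> t \<Longrightarrow> d\<alpha> T M' s' i = \<iota>' (i+1) * ya i"
      "\<And>j. 1 \<le> j \<Longrightarrow> j + 2 \<le> t \<Longrightarrow> d\<beta> T M' s' j = \<iota>' j * yb j"
    using M'.extension_class by metis
  have "\<nexists>h. cobounds t T S h xa xb" using splits_if_class_trivial[OF xs] ns by blast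
  then obtain c u where u: "cobounds t T S u (\<lambda>i. ya i - scal c * xa i) (\<lambda>j. yb j - scal c * xb j)"
    using dim_one_generator[OF S gen x _ y] by metis
  have "\<nexists>h. cobounds t T S h ya yb" using M'.splits_if_class_trivial[OF ys] ns' by blast
  then have c: "c \<noteq> 0" using u by (auto simp: scal_0)
  have u0: "deg0 t T S u" using u unfolding cobounds_def by blast
  have \<iota>u: "cobounds t T M' (\<lambda>i. \<iota>' i * u i) (\<lambda>i. \<iota>' (i+1) * (ya i - scal c * xa i)) (\<lambda>j. \<iota>' j * (yb j - scal c * xb j))"
    by (rule cobounds_postcomp[OF M'.\<iota> u])
  show ?thesis
  proof (rule iso_of_same_class[OF M'.rescale_and_shift[OF c u0] xs])
    fix i assume i: "1 \<le> i" "i + 1 \<le> t"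
    have "d\<alpha> T M' (\<lambda>i. s' i - \<iota>' i * u i) i = d\<alpha> T M' s' i - d\<alpha> T M' (\<lambda>i. \<iota>' i * u i) i"
      by (simp only: algebra_simps)
    also have "\<dots> = \<iota>' (i+1) * ya i - \<iota>' (i+1) * (ya i - scal c * xa i)"
      using ys(1)[OF i] \<iota>u i unfolding cobounds_def by auto
    also have "\<dots> = \<iota>' (i+1) * (scal c * xa i)" by (simp add: right_diff_distrib)
    also have "\<dots> = scal c * \<iota>' (i+1) * xa i"
      using lin_scal_left_commute[OF M'.lins(1)[of "i+1"]] i by (simp add: mult.assoc)
    finally show "d\<alpha> T M' (\<lambda>i. s' i - \<iota>' i * u i) i = scal c * \<iota>' (i+1) * xa i" .
  next
    fix j assume j: "1 \<le> j" "j + 2 \<le> t"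
    have "d\<beta> T M' (\<lambda>i. s' i - \<iota>' i * u i) j = d\<beta> T M' s' j - d\<beta> T M' (\<lambda>i. \<iota>' i * u i) j"
      by (simp only: algebra_simps)
    also have "\<dots> = \<iota>' j * yb j - \<iota>' j * (yb j - scal c * xb j)"
      using ys(2)[OF j] \<iota>u j unfolding cobounds_def by auto
    also have "\<dots> = \<iota>' j * (scal c * xb j)" by (simp add: right_diff_distrib)
    also have "\<dots> = scal c * \<iota>' j * xb j"
      using lin_scal_left_commute[OF M'.lins(1)[of j]] j by (simp add: mult.assoc)
    finally show "d\<beta> T M' (\<lambda>i. s' i - \<iota>' i * u i) j = scal c * \<iota>' j * xb j" .
  qed
qed

end

section \<open>Splitting exact sequences of matrices, and return to the original definitions\<close>

lemma mat_of_column_choice: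
  assumes "\<And>c. c < n \<Longrightarrow> \<exists>u\<in>carrier_vec m. Q c u"
  obtains U where "U \<in> carrier_mat m n" "\<And>c. c < n \<Longrightarrow> Q c (col U c)"
proof -
  obtain w where w: "\<And>c. c < n \<Longrightarrow> w c \<in> carrier_vec m \<and> Q c (w c)"
    using assms by metis
  define U where "U = mat m n (\<lambda>(i, c). w c $ i)"
  have "col U c = w c" if "c < n" for c
    using w[OF that] that by (intro eq_vecI) (auto simp: U_def)
  then show thesis using that[of U] w by (auto simp: U_def)
qed

text \<open>Preimages of the unit vectors under P form a right inverse, which serves as s. Then 1 -
  sP has its columns in the kernel of P, hence equals I r for some r by exactness, and the remaining
  identities follow by cancelling the injective I on the left.\<close>

lemma split_exact_matrices:
  fixes I P :: "'a::field mat"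
  assumes I: "I \<in> carrier_mat m k" and P: "P \<in> carrier_mat l m"
    and inj: "\<And>v. v \<in> carrier_vec k \<Longrightarrow> I *\<^sub>v v = 0\<^sub>v m \<Longrightarrow> v = 0\<^sub>v k"
    and ex: "\<And>v. v \<in> carrier_vec m \<Longrightarrow> P *\<^sub>v v = 0\<^sub>v l \<longleftrightarrow> (\<exists>u\<in>carrier_vec k. v = I *\<^sub>v u)"
    and surj: "\<And>w. w \<in> carrier_vec l \<Longrightarrow> \<exists>v\<in>carrier_vec m. P *\<^sub>v v = w"
  shows "\<exists>r s. r \<in> lin m k \<and> s \<in> lin l m \<and> r * endo_of_mat I = idn k \<and> endo_of_mat P * s = idn l \<and>
    endo_of_mat P * endo_of_mat I = 0 \<and> r * s = 0 \<and> endo_of_mat I * r + s * endo_of_mat P = idn m"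
proof -
  have cancel: "A = B" if A: "A \<in> carrier_mat k n" and B: "B \<in> carrier_mat k n" and e: "I * A = I * B" for A B n
  proof (rule mat_col_eqI)
    fix c assume c: "c < dim_col B"
    then have cn: "c < n" using B by auto
    have cv: "col A c \<in> carrier_vec k" "col B c \<in> carrier_vec k" using A B cn by auto
    have "I *\<^sub>v (col A c - col B c) = col (I * A) c - col (I * B) c"
      using col_mult2[OF I A cn] col_mult2[OF I B cn] mult_minus_distrib_mat_vec[OF I cv] by simp
    also have "\<dots> = 0\<^sub>v m"
      unfolding e using I by (intro eq_vecI) (auto simp del: index_col)
    finally have "col A c - col B c = 0\<^sub>v k" using inj cv by auto
    then have "\<And>i. i < k \<Longrightarrow> col A c $ i = col B c $ i"
      using cv by (metis carrier_vecD index_minus_vec(1) index_zero_vec(1) right_minus_eq)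
    then show "col A c = col B c" using cv A B by (intro eq_vecI) auto
  qed (use A B in auto)
  have lcancel: "x = y" if xy: "x \<in> lin n k" "y \<in> lin n k" and e: "endo_of_mat I * x = endo_of_mat I * y" for x y n
  proof -
    obtain A B where AB: "A \<in> carrier_mat k n" "B \<in> carrier_mat k n" "x = endo_of_mat A" "y = endo_of_mat B"
      using xy unfolding lin_def by auto
    then have "I * A = I * B"
      using e I by (intro endo_of_mat_inj[of _ m n]) (auto simp: endo_of_mat_mult)
    then show ?thesis using cancel[OF AB(1,2)] AB by simp
  qed
  note lI = endo_of_mat_in_lin[OF I] and lP = endo_of_mat_in_lin[OF P]
  obtain \<Sigma> where \<Sigma>: "\<Sigma> \<in> carrier_mat m l" and P\<Sigma>: "\<And>c. c < l \<Longrightarrow> P *\<^sub>v col \<Sigma> c = unit_vec l c"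
    using mat_of_column_choice[of l m "\<lambda>c u. P *\<^sub>v u = unit_vec l c"] surj[OF unit_vec_carrier] by blast
  have "P * \<Sigma> = 1\<^sub>m l"
    using P \<Sigma> P\<Sigma> by (intro mat_col_eqI) (auto simp: col_mult2[OF P \<Sigma>] simp del: col_mult)
  then have \<pi>s: "endo_of_mat P * endo_of_mat \<Sigma> = idn l"
    using P \<Sigma> by (simp add: idn_def endo_of_mat_mult[symmetric])
  have "P * I = 0\<^sub>m l k"
  proof (rule mat_col_eqI)
    fix c assume "c < dim_col (0\<^sub>m l k)"
    then have c: "c < k" by simp
    have "col I c = I *\<^sub>v unit_vec k c"
      using col_mult2[OF I one_carrier_mat c] I c by simp
    then have "P *\<^sub>v col I c = 0\<^sub>v l" using ex[of "col I c"] I c by auto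
    then show "col (P * I) c = col (0\<^sub>m l k) c" using col_mult2[OF P I c] c by simp
  qed (use P I in auto)
  then have \<pi>\<iota>: "endo_of_mat P * endo_of_mat I = 0"
    using P I by (metis carrier_matD endo_of_mat_mult endo_of_mat_zero)
  \<comment> \<open>The projection onto the kernel of P along the image of the chosen
    section.\<close>
  define D where "D = 1\<^sub>m m - \<Sigma> * P"
  have D: "D \<in> carrier_mat m m" unfolding D_def using \<Sigma> P by auto
  have eD: "endo_of_mat D = idn m - endo_of_mat \<Sigma> * endo_of_mat P"
    using \<Sigma> P by (simp add: D_def idn_def endo_of_mat_diff endo_of_mat_mult)
  have "endo_of_mat P * endo_of_mat D = 0"
    unfolding eD right_diff_distrib mult.assoc[symmetric] \<pi>s
    by (simp add: idn_mult_left[OF lP] idn_mult_right[OF lP])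
  then have PD: "P * D = 0\<^sub>m l m"
    using P D by (intro endo_of_mat_inj[of _ l m]) (auto simp: endo_of_mat_mult endo_of_mat_zero)
  have "\<exists>u\<in>carrier_vec k. col D c = I *\<^sub>v u" if c: "c < m" for c
    using ex[of "col D c"] col_mult2[OF P D c] PD D c by auto
  then obtain R where R: "R \<in> carrier_mat k m" and IR: "\<And>c. c < m \<Longrightarrow> col D c = I *\<^sub>v col R c"
    using mat_of_column_choice[of m k "\<lambda>c u. col D c = I *\<^sub>v u"] by blast
  have "I * R = D"
    using I R D IR by (intro mat_col_eqI) (auto simp: col_mult2[OF I R] simp del: col_mult)
  then have \<iota>r: "endo_of_mat I * endo_of_mat R = idn m - endo_of_mat \<Sigma> * endo_of_mat P"
    using I R eD by (simp add: endo_of_mat_mult[symmetric])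
  note lR = endo_of_mat_in_lin[OF R] and l\<Sigma> = endo_of_mat_in_lin[OF \<Sigma>]
  have "endo_of_mat R * endo_of_mat I = idn k"
  proof (rule lcancel[OF lin_mult[OF lR lI] lin_idn])
    show "endo_of_mat I * (endo_of_mat R * endo_of_mat I) = endo_of_mat I * idn k"
      unfolding mult.assoc[symmetric] \<iota>r
      by (simp add: left_diff_distrib mult.assoc \<pi>\<iota> idn_mult_left[OF lI] idn_mult_right[OF lI])
  qed
  moreover have "endo_of_mat R * endo_of_mat \<Sigma> = 0"
  proof (rule lcancel[OF lin_mult[OF lR l\<Sigma>] lin_0])
    show "endo_of_mat I * (endo_of_mat R * endo_of_mat \<Sigma>) = endo_of_mat I * 0"
      unfolding mult.assoc[symmetric] \<iota>r
      by (simp add: left_diff_distrib mult.assoc \<pi>s idn_mult_left[OF l\<Sigma>] idn_mult_right[OF l\<Sigma>])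
  qed
  ultimately show ?thesis using lR l\<Sigma> \<pi>s \<pi>\<iota> \<iota>r by (metis diff_add_cancel)
qed

lemma split_ses_of_ses:
  assumes S: "is_module t S" and M: "is_module t M" and T: "is_module t T"
    and ses: "is_ses t S M T \<iota> \<pi>"
  obtains r s where "split_ses t S M T (endo_fam \<iota>) (endo_fam \<pi>) r s"
proof -
  have \<iota>: "is_hom t S M \<iota>" and \<pi>: "is_hom t M T \<pi>"
    using ses unfolding is_ses_def by auto
  let ?Q = "\<lambda>i r s. r \<in> lin (dimv M i) (dimv S i) \<and> s \<in> lin (dimv T i) (dimv M i) \<and>
      r * endo_of_mat (\<iota> i) = idn (dimv S i) \<and> endo_of_mat (\<pi> i) * s = idn (dimv T i) \<and>
      endo_of_mat (\<pi> i) * endo_of_mat (\<iota> i) = 0 \<and> r * s = 0 \<and>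
      endo_of_mat (\<iota> i) * r + s * endo_of_mat (\<pi> i) = idn (dimv M i)"
  have "\<forall>i\<in>{1..t}. \<exists>r s. ?Q i r s"
  proof
    fix i assume i: "i \<in> {1..t}"
    show "\<exists>r s. ?Q i r s"
    proof (rule split_exact_matrices)
      show "\<iota> i \<in> carrier_mat (dimv M i) (dimv S i)" "\<pi> i \<in> carrier_mat (dimv T i) (dimv M i)"
        using \<iota> \<pi> i unfolding is_hom_def by auto
    qed (use ses i in \<open>auto simp: is_ses_def\<close>)
  qed
  then obtain r s where rs: "\<And>i. i \<in> {1..t} \<Longrightarrow> ?Q i (r i) (s i)" by metis
  have "split_ses t S M T (endo_fam \<iota>) (endo_fam \<pi>) r s"
    by unfold_locales
      (use rs linear_rep_of_module[OF S] linear_rep_of_module[OF M] linear_rep_of_module[OF T]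
        linear_hom_of_hom[OF S M \<iota>] linear_hom_of_hom[OF M T \<pi>] in \<open>auto simp: deg0_def endo_fam_def\<close>)
  then show thesis by (rule that)
qed

lemma ses_splits_of_linear:
  assumes M: "is_module t M" and T: "is_module t T" and \<pi>: "is_hom t M T \<pi>"
    and \<sigma>: "linear_hom t T M \<sigma>" and \<pi>\<sigma>: "\<forall>i\<in>{1..t}. endo_fam \<pi> i * \<sigma> i = idn (dimv T i)"
  shows "ses_splits t M T \<pi>"
proof -
  obtain F where F: "\<And>i. i \<in> {1..t} \<Longrightarrow> F i \<in> carrier_mat (dimv M i) (dimv T i)"
    "\<And>i. i \<in> {1..t} \<Longrightarrow> endo_of_mat (F i) = \<sigma> i"
    using lin_familyE[of "{1..t}" \<sigma> "dimv T" "dimv M"] linear_homD(1)[OF \<sigma>] unfolding deg0_def by blast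
  have "\<pi> i * F i = 1\<^sub>m (dimv T i)" if i: "i \<in> {1..t}" for i
  proof -
    have "\<pi> i \<in> carrier_mat (dimv T i) (dimv M i)" using \<pi> i unfolding is_hom_def by auto
    then show ?thesis
      using F[OF i] i \<pi>\<sigma> by (intro endo_of_mat_inj[of _ "dimv T i" "dimv T i"])
        (auto simp: endo_of_mat_mult endo_fam_def idn_def)
  qed
  then show ?thesis
    unfolding ses_splits_def using hom_of_linear_hom[OF T M \<sigma> F] by blast
qed

lemma is_iso_of_linear:
  assumes M: "is_module t M" and N: "is_module t N"
    and \<phi>: "linear_hom t M N \<phi>" and \<psi>: "linear_hom t N M \<psi>"
    and inv: "\<forall>i\<in>{1..t}. \<psi> i * \<phi> i = idn (dimv M i) \<and> \<phi> i * \<psi> i = idn (dimv N i)"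
  shows "is_iso t M N"
proof -
  obtain F where F: "\<And>i. i \<in> {1..t} \<Longrightarrow> F i \<in> carrier_mat (dimv N i) (dimv M i)"
    "\<And>i. i \<in> {1..t} \<Longrightarrow> endo_of_mat (F i) = \<phi> i"
    using lin_familyE[of "{1..t}" \<phi> "dimv M" "dimv N"] linear_homD(1)[OF \<phi>] unfolding deg0_def by blast
  obtain G where G: "\<And>i. i \<in> {1..t} \<Longrightarrow> G i \<in> carrier_mat (dimv M i) (dimv N i)"
    "\<And>i. i \<in> {1..t} \<Longrightarrow> endo_of_mat (G i) = \<psi> i"
    using lin_familyE[of "{1..t}" \<psi> "dimv N" "dimv M"] linear_homD(1)[OF \<psi>] unfolding deg0_def by blast
  have "G i * F i = 1\<^sub>m (dimv M i) \<and> F i * G i = 1\<^sub>m (dimv N i)" if i: "i \<in> {1..t}" for i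
  proof
    show "G i * F i = 1\<^sub>m (dimv M i)"
      using F[OF i] G[OF i] i inv by (intro endo_of_mat_inj[of _ "dimv M i" "dimv M i"])
        (auto simp: endo_of_mat_mult idn_def)
    show "F i * G i = 1\<^sub>m (dimv N i)"
      using F[OF i] G[OF i] i inv by (intro endo_of_mat_inj[of _ "dimv N i" "dimv N i"])
        (auto simp: endo_of_mat_mult idn_def)
  qed
  then show ?thesis
    unfolding is_iso_def using hom_of_linear_hom[OF M N \<phi> F] hom_of_linear_hom[OF N M \<psi> G] by blast
qed

subsection \<open>Extensions between the modules \<open>\<Delta>(X)\<close>\<close>

text \<open>The dictionary for all order arguments below: numbering the elements of X from 0 as x_0
  < x_1 < ..., the condition \<open>c < cnt X i\<close> says x_c <= i, and
  \<open>cnt X i \<le> c\<close> says that x_c is larger than i or does not exist.\<close>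

definition cnt :: "nat set \<Rightarrow> nat \<Rightarrow> nat" where
  "cnt X i = card {x\<in>X. x \<le> i}"

text \<open>The clause \<open>0 \<notin> X\<close> gives \<open>cnt X 0 = 0\<close>, so that index 0
  can serve as an empty boundary vertex.\<close>

definition standard :: "nat set \<Rightarrow> bool" where
  "standard X \<longleftrightarrow> 0 \<notin> X \<and> (\<forall>x\<in>X. x + 1 \<notin> X)"

lemma dimv_Delta: "dimv (Delta X) = cnt X"
  by (simp add: Delta_def cnt_def fun_eq_iff)

lemma amap_Delta: "amap (Delta X) i = mat (cnt X (i+1)) (cnt X i) (\<lambda>(r,c). if r = c then 1 else 0)"
  by (simp add: Delta_def cnt_def)

lemma bmap_Delta: "bmap (Delta X) j = mat (cnt X j) (cnt X (j+2)) (\<lambda>(r,c). if r + 1 = c then 1 else 0)"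
  by (simp add: Delta_def cnt_def)

lemma cnt_Suc: "cnt X (Suc i) = cnt X i + (if Suc i \<in> X then 1 else 0)"
proof (cases "Suc i \<in> X")
  case True
  then have "{x\<in>X. x \<le> Suc i} = insert (Suc i) {x\<in>X. x \<le> i}" by (auto simp: le_Suc_eq)
  then show ?thesis using True by (simp add: cnt_def)
next
  case False
  then have "{x\<in>X. x \<le> Suc i} = {x\<in>X. x \<le> i}" by (auto simp: le_Suc_eq)
  then show ?thesis using False by (simp add: cnt_def)
qed

lemma cnt_mono: "i \<le> j \<Longrightarrow> cnt X i \<le> cnt X j"
  by (rule lift_Suc_mono_le[of "cnt X"]) (auto simp: cnt_Suc)

lemma cnt_less_imp: "c < cnt X i \<Longrightarrow> cnt X j \<le> c \<Longrightarrow> j < i"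
  using cnt_mono[of i j X] by (meson leD le_less_trans not_less order_less_le_trans)

lemma cnt_0: "standard X \<Longrightarrow> cnt X 0 = 0"
  unfolding standard_def cnt_def by (auto intro: card_eq_0_iff[THEN iffD2]) 

text \<open>Elements of X are at least 2 apart. In terms of positions: x_(r+1) <= i+2 implies x_r <=
  i.\<close>

lemma cnt_add_2: "standard X \<Longrightarrow> cnt X (i+2) \<le> cnt X i + 1"
  unfolding standard_def by (auto simp: cnt_Suc)

text \<open>The witness p is the element x_c itself, found as the first index at which the count
  exceeds c.\<close>

lemma cnt_element:
  assumes "standard X" "c < cnt X i"
  obtains p where "p \<in> X" "1 \<le> p" "p \<le> i" "cnt X (p-1) = c" "cnt X p = c + 1"
proof -
  define p where "p = (LEAST p. c < cnt X p)"
  have p: "c < cnt X p" unfolding p_def by (rule LeastI[of _ i]) (rule assms)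
  have p0: "p \<noteq> 0" using p cnt_0[OF assms(1)] by (cases p) auto
  have "\<not> c < cnt X (p-1)"
    unfolding p_def by (rule not_less_Least) (use p0 in \<open>simp add: p_def\<close>)
  then have "p \<in> X" "cnt X (p-1) = c" "cnt X p = c + 1"
    using p p0 cnt_Suc[of X "p-1"] by (auto split: if_splits)
  moreover have "p \<le> i" unfolding p_def by (rule Least_le) (rule assms)
  ultimately show thesis using that p0 by auto
qed

lemma sum_delta_mult:
  fixes f :: "nat \<Rightarrow> 'a::field"
  shows "(\<Sum>k = 0..<n. (if a = k then 1 else 0) * f k) = (if a < n then f a else 0)"
    and "(\<Sum>k = 0..<n. f k * (if k = a then 1 else 0)) = (if a < n then f a else 0)"
  by (simp_all add: if_distrib[of "\<lambda>x. x * _"] if_distrib[of "\<lambda>x. _ * x"] cong: if_cong)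

text \<open>The next four formulas evaluate the terms of the cocycle and coboundary equations
  entrywise. On the left, \<open>\<alpha>\<close> appends zero rows and \<open>\<beta>\<close>
  shifts rows up by one; on the right, \<open>\<alpha>\<close> drops columns and
  \<open>\<beta>\<close> shifts columns to the right by one.\<close>

lemma amap_Delta_mult:
  "H \<in> carrier_mat (cnt X i) n \<Longrightarrow> r < cnt X (i+1) \<Longrightarrow> c < n \<Longrightarrow>
    (amap (Delta X) i * H) $$ (r, c) = (if r < cnt X i then H $$ (r, c) else 0)"
  by (auto simp: amap_Delta scalar_prod_def sum_delta_mult)

lemma mult_amap_Delta:
  "H \<in> carrier_mat m (cnt X (i+1)) \<Longrightarrow> r < m \<Longrightarrow> c < cnt X i \<Longrightarrow>
    (H * amap (Delta X) i) $$ (r, c) = H $$ (r, c)"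
  using cnt_mono[of i "i+1" X] by (auto simp: amap_Delta scalar_prod_def sum_delta_mult)

lemma bmap_Delta_mult:
  "H \<in> carrier_mat (cnt X (j+2)) n \<Longrightarrow> r < cnt X j \<Longrightarrow> c < n \<Longrightarrow>
    (bmap (Delta X) j * H) $$ (r, c) = (if r + 1 < cnt X (j+2) then H $$ (r+1, c) else 0)"
  by (auto simp: bmap_Delta scalar_prod_def sum_delta_mult)

lemma mult_bmap_Delta:
  assumes "standard X" "H \<in> carrier_mat m (cnt X j)" "r < m" "c < cnt X (j+2)"
  shows "(H * bmap (Delta X) j) $$ (r, c) = (if c = 0 then 0 else H $$ (r, c-1))"
proof (cases c)
  case (Suc c')
  then have "c' < cnt X j" using assms cnt_add_2[OF assms(1), of j] by simp
  then show ?thesis using assms Suc by (auto simp: bmap_Delta scalar_prod_def sum_delta_mult)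
qed (use assms in \<open>auto simp: bmap_Delta scalar_prod_def\<close>)

lemma amap_Delta_carrier: "amap (Delta X) i \<in> carrier_mat (cnt X (i+1)) (cnt X i)"
  by (simp add: amap_Delta)

lemma bmap_Delta_carrier: "bmap (Delta X) j \<in> carrier_mat (cnt X j) (cnt X (j+2))"
  by (simp add: bmap_Delta)

lemma is_module_Delta:
  assumes X: "standard X"
  shows "is_module t (Delta X :: 'a::field rep)"
  unfolding is_module_def dimv_Delta
proof (intro conjI allI impI)
  have AB: "(bmap (Delta X) (i+1) * amap (Delta X) (i+2)) $$ (r, c) = (if r + 1 = c then 1 else (0::'a))"
    if "r < cnt X (i+1)" "c < cnt X (i+2)" for i r c
    using that amap_Delta_carrier[of X "i+2"] cnt_mono[of "i+2" "i+3" X]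
    by (subst bmap_Delta_mult[of _ _ _ "cnt X (i+2)"]) (auto simp: numeral_3_eq_3 amap_Delta)
  \<comment> \<open>At most one element of X is <= 2, so only column c = 0 occurs and r + 1 = c is
    impossible.\<close>
  show "bmap (Delta X) 1 * amap (Delta X) 2 = (0\<^sub>m (cnt X 1) (cnt X 2) :: 'a mat)"
  proof (rule eq_matI)
    fix r c assume "r < dim_row (0\<^sub>m (cnt X 1) (cnt X 2) :: 'a mat)" "c < dim_col (0\<^sub>m (cnt X 1) (cnt X 2) :: 'a mat)"
    then show "(bmap (Delta X) 1 * amap (Delta X) 2) $$ (r, c) = (0\<^sub>m (cnt X 1) (cnt X 2) :: 'a mat) $$ (r, c)"
      using AB[of r 0 c] cnt_add_2[OF X, of 0] cnt_0[OF X] by (simp add: numeral_2_eq_2)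
  qed (simp_all add: amap_Delta bmap_Delta)
  fix i assume "1 \<le> i \<and> i + 3 \<le> t"
  show "bmap (Delta X) (i+1) * amap (Delta X) (i+2) = (amap (Delta X) i * bmap (Delta X) i :: 'a mat)"
  proof (rule eq_matI)
    fix r c assume "r < dim_row (amap (Delta X) i * bmap (Delta X) i :: 'a mat)"
      "c < dim_col (amap (Delta X) i * bmap (Delta X) i :: 'a mat)"
    then have rc: "r < cnt X (i+1)" "c < cnt X (i+2)" by (simp_all add: amap_Delta bmap_Delta)
    then show "(bmap (Delta X) (i+1) * amap (Delta X) (i+2)) $$ (r, c) = (amap (Delta X) i * bmap (Delta X) i :: 'a mat) $$ (r, c)"
      using cnt_add_2[OF X, of i]
      unfolding AB[OF rc] amap_Delta_mult[OF bmap_Delta_carrier rc] by (auto simp: bmap_Delta)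
  qed (simp_all add: amap_Delta bmap_Delta)
qed (simp_all add: amap_Delta bmap_Delta)

text \<open>The support conditions on entries \<open>(r,c)\<close>: with rows and columns counted from 0, \<open>edge_supp\<close>
  allows the entry if the \<open>r\<close>-th element of \<open>Y\<close> plus 2 is at most the \<open>c\<close>-th element of \<open>X\<close>, and
  \<open>vertex_supp\<close> allows it if the \<open>r\<close>-th element of \<open>Y\<close> is at most the \<open>c\<close>-th element of \<open>X\<close>.\<close>
definition edge_supp :: "nat \<Rightarrow> nat set \<Rightarrow> nat set \<Rightarrow> (nat \<Rightarrow> nat \<Rightarrow> 'a::zero) \<Rightarrow> bool" where
  "edge_supp t X Y x \<longleftrightarrow> (\<forall>j r c. j + 2 \<le> t \<longrightarrow> c < cnt X (j+2) \<longrightarrow> cnt Y j \<le> r \<longrightarrow> x r c = 0)"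

lemma edge_suppD: "edge_supp t X Y x \<Longrightarrow> j + 2 \<le> t \<Longrightarrow> c < cnt X (j+2) \<Longrightarrow> cnt Y j \<le> r \<Longrightarrow> x r c = 0"
  unfolding edge_supp_def by blast

definition vertex_supp :: "nat \<Rightarrow> nat set \<Rightarrow> nat set \<Rightarrow> (nat \<Rightarrow> nat \<Rightarrow> 'a::zero) \<Rightarrow> bool" where
  "vertex_supp t X Y u \<longleftrightarrow> (\<forall>i r c. i \<le> t \<longrightarrow> c < cnt X i \<longrightarrow> cnt Y i \<le> r \<longrightarrow> u r c = 0)"

lemma vertex_suppD: "vertex_supp t X Y u \<Longrightarrow> i \<le> t \<Longrightarrow> c < cnt X i \<Longrightarrow> cnt Y i \<le> r \<Longrightarrow> u r c = 0"
  unfolding vertex_supp_def by blast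

text \<open>Up to the coboundary of h, the cocycle f has zero \<open>\<alpha>\<close>-part, and its
  \<open>\<beta>\<close>-part at every vertex is a truncation of the same array x. The class of f is
  then encoded by x alone.\<close>

definition normal_form :: "nat \<Rightarrow> nat set \<Rightarrow> nat set \<Rightarrow> (nat \<Rightarrow> 'a::field mat) \<times> (nat \<Rightarrow> 'a mat) \<Rightarrow>
    (nat \<Rightarrow> 'a mat) \<Rightarrow> (nat \<Rightarrow> nat \<Rightarrow> 'a) \<Rightarrow> bool" where
  "normal_form t X Y f h x \<longleftrightarrow>
     (\<forall>i\<in>{1..t}. h i \<in> carrier_mat (cnt Y i) (cnt X i)) \<and>
     (\<forall>i. 1 \<le> i \<and> i + 1 \<le> t \<longrightarrow> fst f i = amap (Delta Y) i * h i - h (i+1) * amap (Delta X) i) \<and>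
     (\<forall>j. 1 \<le> j \<and> j + 2 \<le> t \<longrightarrow> snd f j = bmap (Delta Y) j * h (j+2) - h j * bmap (Delta X) j
        + mat (cnt Y j) (cnt X (j+2)) (\<lambda>(r,c). x r c))"

text \<open>The truncations of u commute with \<open>\<alpha>\<close>, because
  \<open>vertex_supp\<close> makes u vanish in the rows that are new at the next vertex. Adding them
  to h leaves the \<open>\<alpha>\<close>-part alone and changes the \<open>\<beta>\<close>-part by
  exactly x.\<close>

lemma ext_coboundary_of_normal_form:
  assumes X: "standard X" and f: "normal_form t X Y f h x" and u: "vertex_supp t X Y u"
    and eq: "\<And>r c. c < cnt X t \<Longrightarrow> x r c = u (Suc r) c - (if c = 0 then 0 else u r (c-1))"
  shows "ext_coboundary t (Delta X) (Delta Y) f"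
proof -
  define U where "U i = mat (cnt Y i) (cnt X i) (\<lambda>(r,c). u r c)" for i
  have U: "U i \<in> carrier_mat (cnt Y i) (cnt X i)" for i by (simp add: U_def)
  have h: "h i \<in> carrier_mat (cnt Y i) (cnt X i)" if "1 \<le> i" "i \<le> t" for i
    using f that unfolding normal_form_def by auto
  have u0: "u r c = 0" if "i \<le> t" "c < cnt X i" "cnt Y i \<le> r" for i r c
    using u that unfolding vertex_supp_def by blast
  have "fst f i = amap (Delta Y) i * (h i + U i) - (h (i+1) + U (i+1)) * amap (Delta X) i"
    if i: "1 \<le> i" "i + 1 \<le> t" for i
  proof (rule eq_matI)
    note hc = h[of i] h[of "i+1"]
    show "dim_row (fst f i) = dim_row (amap (Delta Y) i * (h i + U i) - (h (i+1) + U (i+1)) * amap (Delta X) i)"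
      "dim_col (fst f i) = dim_col (amap (Delta Y) i * (h i + U i) - (h (i+1) + U (i+1)) * amap (Delta X) i)"
      using f i hc U[of "i+1"] unfolding normal_form_def by auto
    fix r c assume "r < dim_row (amap (Delta Y) i * (h i + U i) - (h (i+1) + U (i+1)) * amap (Delta X) i)"
      "c < dim_col (amap (Delta Y) i * (h i + U i) - (h (i+1) + U (i+1)) * amap (Delta X) i)"
    then have rc: "r < cnt Y (i+1)" "c < cnt X i" using U[of "i+1"] by (auto simp: amap_Delta)
    have c1: "c < cnt X (i+1)" using rc(2) cnt_mono[of i "i+1" X] by simp
    have hU: "h i + U i \<in> carrier_mat (cnt Y i) (cnt X i)" "h (i+1) + U (i+1) \<in> carrier_mat (cnt Y (i+1)) (cnt X (i+1))"
      using U by auto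
    have "(amap (Delta Y) i * (h i + U i) - (h (i+1) + U (i+1)) * amap (Delta X) i) $$ (r, c)
        = (amap (Delta Y) i * (h i + U i)) $$ (r, c) - ((h (i+1) + U (i+1)) * amap (Delta X) i) $$ (r, c)"
      using rc U[of "i+1"] by (intro index_minus_mat) (auto simp: amap_Delta)
    also have "\<dots> = (if r < cnt Y i then (h i + U i) $$ (r, c) else 0) - (h (i+1) + U (i+1)) $$ (r, c)"
      unfolding amap_Delta_mult[OF hU(1) rc] mult_amap_Delta[OF hU(2) rc] ..
    also have "\<dots> = (if r < cnt Y i then h i $$ (r, c) else 0) - h (i+1) $$ (r, c)"
      using rc c1 u0[of i c r] i by (auto simp: U_def)
    also have "\<dots> = (amap (Delta Y) i * h i) $$ (r, c) - (h (i+1) * amap (Delta X) i) $$ (r, c)"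
      using amap_Delta_mult[OF hc(1) rc] mult_amap_Delta[OF hc(2) rc] i by simp
    also have "\<dots> = (amap (Delta Y) i * h i - h (i+1) * amap (Delta X) i) $$ (r, c)"
      using rc hc i by (intro index_minus_mat(1)[symmetric]) (auto simp: amap_Delta)
    also have "\<dots> = fst f i $$ (r, c)"
      using f i unfolding normal_form_def by simp
    finally show "fst f i $$ (r, c) = (amap (Delta Y) i * (h i + U i) - (h (i+1) + U (i+1)) * amap (Delta X) i) $$ (r, c)" ..
  qed
  moreover have "snd f j = bmap (Delta Y) j * (h (j+2) + U (j+2)) - (h j + U j) * bmap (Delta X) j"
    if j: "1 \<le> j" "j + 2 \<le> t" for j
  proof (rule eq_matI)
    note hc = h[of j] h[of "j+2"]
    show "dim_row (snd f j) = dim_row (bmap (Delta Y) j * (h (j+2) + U (j+2)) - (h j + U j) * bmap (Delta X) j)"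
      "dim_col (snd f j) = dim_col (bmap (Delta Y) j * (h (j+2) + U (j+2)) - (h j + U j) * bmap (Delta X) j)"
      using f j hc U[of j] unfolding normal_form_def by (auto simp: bmap_Delta)
    fix r c assume "r < dim_row (bmap (Delta Y) j * (h (j+2) + U (j+2)) - (h j + U j) * bmap (Delta X) j)"
      "c < dim_col (bmap (Delta Y) j * (h (j+2) + U (j+2)) - (h j + U j) * bmap (Delta X) j)"
    then have rc: "r < cnt Y j" "c < cnt X (j+2)" using U[of j] by (auto simp: bmap_Delta)
    have ct: "c < cnt X t" using rc(2) cnt_mono[OF j(2), of X] by simp
    have cj: "c - 1 < cnt X j" if "c \<noteq> 0" using that rc(2) cnt_add_2[OF X, of j] by simp
    have hU: "h j + U j \<in> carrier_mat (cnt Y j) (cnt X j)" "h (j+2) + U (j+2) \<in> carrier_mat (cnt Y (j+2)) (cnt X (j+2))"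
      using U by auto
    have "(bmap (Delta Y) j * (h (j+2) + U (j+2)) - (h j + U j) * bmap (Delta X) j) $$ (r, c)
        = (bmap (Delta Y) j * (h (j+2) + U (j+2))) $$ (r, c) - ((h j + U j) * bmap (Delta X) j) $$ (r, c)"
      using rc U[of j] by (intro index_minus_mat) (auto simp: bmap_Delta)
    also have "\<dots> = (if r + 1 < cnt Y (j+2) then (h (j+2) + U (j+2)) $$ (r+1, c) else 0)
        - (if c = 0 then 0 else (h j + U j) $$ (r, c-1))"
      unfolding bmap_Delta_mult[OF hU(2) rc] mult_bmap_Delta[OF X hU(1) rc] ..
    also have "\<dots> = (if r + 1 < cnt Y (j+2) then h (j+2) $$ (r+1, c) else 0)
        - (if c = 0 then 0 else h j $$ (r, c-1)) + x r c"
      using rc cj u0[of "j+2" c "r+1"] j unfolding eq[OF ct] by (auto simp: U_def)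
    also have "\<dots> = (bmap (Delta Y) j * h (j+2)) $$ (r, c) - (h j * bmap (Delta X) j) $$ (r, c) + x r c"
      using bmap_Delta_mult[OF hc(2) rc] mult_bmap_Delta[OF X hc(1) rc] j by simp
    also have "\<dots> = (bmap (Delta Y) j * h (j+2) - h j * bmap (Delta X) j
        + mat (cnt Y j) (cnt X (j+2)) (\<lambda>(r,c). x r c)) $$ (r, c)"
      using rc hc j by (auto simp: bmap_Delta simp del: index_mult_mat(1))
    also have "\<dots> = snd f j $$ (r, c)"
      using f j unfolding normal_form_def by simp
    finally show "snd f j $$ (r, c) = (bmap (Delta Y) j * (h (j+2) + U (j+2)) - (h j + U j) * bmap (Delta X) j) $$ (r, c)" ..
  qed
  moreover have "h i + U i \<in> carrier_mat (cnt Y i) (cnt X i)" for i using U by auto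
  ultimately show ?thesis
    unfolding ext_coboundary_def dimv_Delta by (intro exI[of _ "\<lambda>i. h i + U i"]) blast
qed


text \<open>Since \<open>\<alpha>\<close> of \<open>Delta X\<close> is injective, the
  \<open>\<alpha>\<close>-equations can be solved for h vertex by vertex. The relations for what is
  left say that consecutive \<open>\<beta>\<close>-parts agree where both have entries and vanish in
  new rows (\<open>Z_0\<close>, \<open>Z_Suc\<close>).\<close>

lemma normal_form_of_cocycle:
  fixes f :: "(nat \<Rightarrow> 'a::field mat) \<times> (nat \<Rightarrow> 'a mat)"
  assumes X: "standard X" and Y: "standard Y" and t: "3 \<le> t"
    and f: "ext_cocycle t (Delta X) (Delta Y) f"
  obtains h x where "normal_form t X Y f h x" "edge_supp t X Y x"
proof -
  let ?X = "Delta X :: 'a rep" and ?Y = "Delta Y :: 'a rep"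
  note mX = is_module_Delta[OF X, of t, where 'a = 'a] and mY = is_module_Delta[OF Y, of t, where 'a = 'a]
  note fc = ext_cocycle_carriers[OF f, unfolded dimv_Delta]
  \<comment> \<open>The equation at \<open>\<alpha>\<close> from i to i+1 prescribes the first
    \<open>cnt X i\<close> columns of h at i+1; a column that is new there is set to 0. At i = 0
    nothing is prescribed, as \<open>cnt X 0 = 0\<close>.\<close>
  define H where "H = rec_nat (\<lambda>r c. 0) (\<lambda>i Hi r c. if c < cnt X i
    then (if r < cnt Y i then Hi r c else 0) - fst f i $$ (r, c) else 0)"
  have HSuc: "H (Suc i) r c = (if c < cnt X i
    then (if r < cnt Y i then H i r c else 0) - fst f i $$ (r, c) else 0)" for i r c
    by (simp add: H_def)
  define h where "h i = mat (cnt Y i) (cnt X i) (\<lambda>(r,c). H i r c)" for i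
  have h: "h i \<in> carrier_mat (cnt Y i) (cnt X i)" for i by (simp add: h_def)
  define Z where "Z j = snd f j - (bmap ?Y j * h (j+2) - h j * bmap ?X j)" for j
  have Z: "Z j \<in> carrier_mat (cnt Y j) (cnt X (j+2))" for j
    unfolding Z_def using h[of j] by (intro carrier_matI) (auto simp: bmap_Delta)
  have fa: "fst f i = amap ?Y i * h i - h (i+1) * amap ?X i" if i: "1 \<le> i" "i + 1 \<le> t" for i
  proof (rule eq_matI)
    show "dim_row (fst f i) = dim_row (amap ?Y i * h i - h (i+1) * amap ?X i)"
      "dim_col (fst f i) = dim_col (amap ?Y i * h i - h (i+1) * amap ?X i)"
      using fc(1)[OF i] by (auto simp: h_def amap_Delta)
    fix r c assume "r < dim_row (amap ?Y i * h i - h (i+1) * amap ?X i)"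
      "c < dim_col (amap ?Y i * h i - h (i+1) * amap ?X i)"
    then have rc: "r < cnt Y (i+1)" "c < cnt X i" by (auto simp: h_def amap_Delta)
    have c1: "c < cnt X (i+1)" using rc(2) cnt_mono[of i "i+1" X] by simp
    have "(amap ?Y i * h i - h (i+1) * amap ?X i) $$ (r, c)
        = (amap ?Y i * h i) $$ (r, c) - (h (i+1) * amap ?X i) $$ (r, c)"
      using rc h[of "i+1"] by (intro index_minus_mat) (auto simp: amap_Delta)
    also have "\<dots> = fst f i $$ (r, c)"
      unfolding amap_Delta_mult[OF h rc] mult_amap_Delta[OF h rc]
      using rc c1 by (auto simp: h_def HSuc)
    finally show "fst f i $$ (r, c) = (amap ?Y i * h i - h (i+1) * amap ?X i) $$ (r, c)" ..
  qed
  \<comment> \<open>F is f minus the coboundary of h: again a cocycle, now with zero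
    \<open>\<alpha>\<close>-part.\<close>
  define F where "F = (\<lambda>i. 0\<^sub>m (cnt Y (i+1)) (cnt X i) :: 'a mat, Z)"
  have "ext_cocycle t ?X ?Y F"
  proof -
    define e where "e i = endo_of_mat (h i)" for i
    have e: "deg0 t ?X ?Y e"
      unfolding deg0_def dimv_Delta e_def using h by (auto intro: endo_of_mat_in_lin)
    have "cocycle t ?X ?Y (endo_fam (fst f)) (endo_fam (snd f))"
      using f ext_cocycle_iff[OF mX mY ext_cocycle_carriers[OF f]] by blast
    from cocycle_diff[OF this cocycle_coboundary[OF linear_rep_of_module[OF mX] linear_rep_of_module[OF mY] e]]
    have c: "cocycle t ?X ?Y (\<lambda>i. endo_fam (fst f) i - d\<alpha> ?X ?Y e i) (\<lambda>j. endo_fam (snd f) j - d\<beta> ?X ?Y e j)" .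
    have "cocycle t ?X ?Y (endo_fam (fst F)) (endo_fam (snd F))"
    proof (rule cocycle_cong[THEN iffD1, OF _ _ c])
      fix i assume i: "1 \<le> i" "i + 1 \<le> t"
      show "endo_fam (fst f) i - d\<alpha> ?X ?Y e i = endo_fam (fst F) i"
        using i fa[OF i] h[of i] h[of "i+1"]
        by (auto simp: F_def endo_fam_def endo_of_mat_zero e_def endo_of_mat_diff endo_of_mat_mult amap_Delta)
    next
      fix j assume j: "1 \<le> j" "j + 2 \<le> t"
      show "endo_fam (snd f) j - d\<beta> ?X ?Y e j = endo_fam (snd F) j"
        using j fc(2)[OF j] h[of j] h[of "j+2"]
        by (auto simp: F_def Z_def endo_fam_def e_def endo_of_mat_diff endo_of_mat_mult bmap_Delta)
    qed
    then show ?thesis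
      using Z by (subst ext_cocycle_iff[OF mX mY]) (auto simp: F_def dimv_Delta)
  qed
  note rel = this[unfolded ext_cocycle_def Let_def F_def fst_conv snd_conv dimv_Delta]
  have Z_0: "Z 1 $$ (r, c) = 0" if rc: "r < cnt Y 1" "c < cnt X 2" for r c
  proof -
    have c: "Z 1 \<in> carrier_mat (cnt Y 1) (cnt X (2+1))" using Z[of 1] by (simp add: numeral_3_eq_3 numeral_2_eq_2)
    have z: "bmap ?Y 1 * 0\<^sub>m (cnt Y (2+1)) (cnt X 2) = 0\<^sub>m (cnt Y 1) (cnt X 2)"
      by (rule right_mult_zero_mat) (use bmap_Delta_carrier[of Y 1, where 'a = 'a] in \<open>simp add: numeral_3_eq_3 numeral_2_eq_2\<close>)
    have "Z 1 * amap ?X 2 \<in> carrier_mat (cnt Y 1) (cnt X 2)"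
      by (rule mult_carrier_mat[OF c amap_Delta_carrier])
    then have "Z 1 * amap ?X 2 = 0\<^sub>m (cnt Y 1) (cnt X 2)"
      using rel t z by (auto simp: left_add_zero_mat)
    then show ?thesis using mult_amap_Delta[OF c rc] rc by simp
  qed
  have Z_Suc: "Z (i+1) $$ (r, c) = (if r < cnt Y i then Z i $$ (r, c) else 0)"
    if i: "1 \<le> i" "i + 3 \<le> t" and rc: "r < cnt Y (i+1)" "c < cnt X (i+2)" for i r c
  proof -
    have c: "Z (i+1) \<in> carrier_mat (cnt Y (i+1)) (cnt X (i+2+1))" using Z[of "i+1"] by (simp add: numeral_3_eq_3)
    have z: "bmap ?Y (i+1) * 0\<^sub>m (cnt Y (i+2+1)) (cnt X (i+2)) = 0\<^sub>m (cnt Y (i+1)) (cnt X (i+2))"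
      by (rule right_mult_zero_mat) (use bmap_Delta_carrier[of Y "i+1", where 'a = 'a] in \<open>simp add: numeral_3_eq_3\<close>)
    have z': "0\<^sub>m (cnt Y (i+1)) (cnt X i) * bmap ?X i = 0\<^sub>m (cnt Y (i+1)) (cnt X (i+2))"
      by (rule left_mult_zero_mat[OF bmap_Delta_carrier])
    have 1: "Z (i+1) * amap ?X (i+2) \<in> carrier_mat (cnt Y (i+1)) (cnt X (i+2))"
      by (rule mult_carrier_mat[OF c amap_Delta_carrier])
    have 2: "amap ?Y i * Z i \<in> carrier_mat (cnt Y (i+1)) (cnt X (i+2))"
      by (rule mult_carrier_mat[OF amap_Delta_carrier Z])
    have "bmap ?Y (i+1) * 0\<^sub>m (cnt Y (i+2+1)) (cnt X (i+2)) + Z (i+1) * amap ?X (i+2)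
        = amap ?Y i * Z i + 0\<^sub>m (cnt Y (i+1)) (cnt X i) * bmap ?X i"
      using rel i by blast
    then have "Z (i+1) * amap ?X (i+2) = amap ?Y i * Z i"
      unfolding z z' left_add_zero_mat[OF 1] right_add_zero_mat[OF 2] .
    then show ?thesis
      using mult_amap_Delta[OF c rc] amap_Delta_mult[OF Z rc] by simp
  qed
  \<comment> \<open>The last \<open>\<beta>\<close>, at t-2, has the largest matrix; all others are
    truncations of it.\<close>
  define x where "x r c = (if r < cnt Y (t-2) \<and> c < cnt X t then Z (t-2) $$ (r, c) else 0)" for r c
  have Zx: "Z j $$ (r, c) = x r c" if j: "1 \<le> j" "j + 2 \<le> t" and rc: "r < cnt Y j" "c < cnt X (j+2)" for j r c
  proof -
    have "j \<le> t - 2" using j by simp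
    then show ?thesis using j(1) rc
    proof (induction j rule: inc_induct)
      case base
      moreover have "t - 2 + 2 = t" using t by simp
      ultimately show ?case by (simp only: x_def if_True simp_thms)
    next
      case (step n)
      have n: "n + 3 \<le> t" using step by auto
      have "r < cnt Y (n+1)" "c < cnt X (n+1+2)"
        using step cnt_mono[of n "n+1" Y] cnt_mono[of "n+2" "n+1+2" X] by (meson le_add1 order_less_le_trans add_le_mono1)+
      then have "Z (n+1) $$ (r, c) = x r c" using step by simp
      then show ?case using Z_Suc[of n r c] step n \<open>r < cnt Y (n+1)\<close> by simp
    qed
  qed
  have "edge_supp t X Y x"
    unfolding edge_supp_def
  proof (intro allI impI)
    fix j r c assume j: "j + 2 \<le> t" and c: "c < cnt X (j+2)" and r: "cnt Y j \<le> r"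
    show "x r c = 0"
    proof (cases "r < cnt Y (t-2)")
      case True
      \<comment> \<open>p is the element of Y with index r, so row r first appears at vertex p.
        There \<open>Z_Suc\<close> (or \<open>Z_0\<close> if p = 1) gives 0 in the columns with
        \<open>c < cnt X (p+1)\<close>, which covers c because j < p.\<close>
      then obtain p where p: "1 \<le> p" "p \<le> t - 2" "cnt Y (p-1) = r" "cnt Y p = r + 1"
        using cnt_element[OF Y] by metis
      have jp: "j < p" using cnt_less_imp[of r Y p j] r p by simp
      have c': "c < cnt X (p - 1 + 2)" using c cnt_mono[of "j+2" "p - 1 + 2" X] jp by simp
      have c'': "c < cnt X (p + 2)" using c' cnt_mono[of "p - 1 + 2" "p + 2" X] by simp
      have "x r c = Z p $$ (r, c)" using Zx[of p r c] p c'' by simp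
      also have "\<dots> = 0"
      proof (cases "p = 1")
        case True
        then show ?thesis using Z_0[of r c] p c' by (simp add: numeral_2_eq_2)
      next
        case False
        then show ?thesis using Z_Suc[of "p-1" r c] p c' by simp
      qed
      finally show ?thesis .
    qed (simp add: x_def)
  qed
  moreover have "normal_form t X Y f h x"
    unfolding normal_form_def
  proof (intro conjI allI impI ballI h)
    fix i assume "1 \<le> i \<and> i + 1 \<le> t"
    then show "fst f i = amap ?Y i * h i - h (i+1) * amap ?X i" using fa by blast
  next
    fix j assume j: "1 \<le> j \<and> j + 2 \<le> t"
    have fbc: "snd f j \<in> carrier_mat (cnt Y j) (cnt X (j+2))" using fc(2) j by blast
    have dc: "bmap ?Y j * h (j+2) - h j * bmap ?X j \<in> carrier_mat (cnt Y j) (cnt X (j+2))"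
      using h[of j] by (auto simp: bmap_Delta)
    show "snd f j = bmap ?Y j * h (j+2) - h j * bmap ?X j + mat (cnt Y j) (cnt X (j+2)) (\<lambda>(r,c). x r c)"
    proof (rule eq_matI)
      fix r c assume "r < dim_row (bmap ?Y j * h (j+2) - h j * bmap ?X j + mat (cnt Y j) (cnt X (j+2)) (\<lambda>(r,c). x r c))"
        "c < dim_col (bmap ?Y j * h (j+2) - h j * bmap ?X j + mat (cnt Y j) (cnt X (j+2)) (\<lambda>(r,c). x r c))"
      then have rc: "r < cnt Y j" "c < cnt X (j+2)" by auto
      have "x r c = Z j $$ (r, c)" using Zx[of j r c] j rc by simp
      also have "\<dots> = snd f j $$ (r, c) - (bmap ?Y j * h (j+2) - h j * bmap ?X j) $$ (r, c)"
        unfolding Z_def using rc dc by (intro index_minus_mat) auto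
      finally show "snd f j $$ (r, c) = (bmap ?Y j * h (j+2) - h j * bmap ?X j + mat (cnt Y j) (cnt X (j+2)) (\<lambda>(r,c). x r c)) $$ (r, c)"
        using rc by (subst index_add_mat(1)) auto
    qed (use fbc in auto)
  qed
  ultimately show thesis using that by blast
qed

text \<open>By \<open>near\<close>, each x_c > 1 has an element of Y in {x_c - 1, x_c}. If y_(r+1) >
  x_c, that element is at most y_r, so y_r > x_c - 2 >= x_(c-1): without its end (r+1,c), the edge
  (r,c) and its other end are absent too.\<close>

lemma ext1_zero_Delta:
  assumes X: "standard X" and Y: "standard Y" and t: "3 \<le> t"
    and near: "\<And>x. x \<in> X \<Longrightarrow> x = 1 \<or> x \<in> Y \<or> x - 1 \<in> Y"
  shows "ext1_zero t (Delta X :: 'a::field rep) (Delta Y)"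
  unfolding ext1_zero_def
proof (intro allI impI)
  fix f assume "ext_cocycle t (Delta X :: 'a rep) (Delta Y) f"
  then obtain h x where nf: "normal_form t X Y f h x" and x: "edge_supp t X Y x"
    using normal_form_of_cocycle[OF X Y t] by blast
  \<comment> \<open>Solves each equation for the end (r+1,c), starting with 0 in row 0. The
    equations hold by construction, and the work lies in showing that u vanishes where no vertex is
    present.\<close>
  define u where "u = rec_nat (\<lambda>c. 0) (\<lambda>r ur c. x r c + (if c = 0 then 0 else ur (c - 1)))"
  have u0: "u 0 c = 0" and uSuc: "u (Suc r) c = x r c + (if c = 0 then 0 else u r (c - 1))" for r c
    by (simp_all add: u_def)
  have "u r c = 0" if "i \<le> t" "c < cnt X i" "cnt Y i \<le> r" for i r c
    using that
  proof (induction r arbitrary: c i)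
    case (Suc r)
    obtain p where p: "p \<in> X" "1 \<le> p" "p \<le> i" "cnt X (p-1) = c" "cnt X p = c + 1"
      using cnt_element[OF X Suc.prems(2)] by metis
    show ?case
    proof (cases "p = 1")
      case True
      then have c: "c = 0" using p cnt_0[OF X] by simp
      have "0 < cnt X 2" using p True cnt_mono[of 1 2 X] by simp
      then have "x r 0 = 0" using edge_suppD[OF x, of 0 0 r] t cnt_0[OF Y] by (simp add: numeral_2_eq_2)
      then show ?thesis using c uSuc by simp
    next
      case False
      define q where "q = p - 2"
      have q: "p = q + 2" using False p by (simp add: q_def)
      \<comment> \<open>Y meets {q+1, q+2} = {p-1, p}, so the element with index r already lies
        beyond q.\<close>
      have "cnt Y q < cnt Y p" using near[OF p(1)] False unfolding q by (auto simp: cnt_Suc)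
      also have "\<dots> \<le> Suc r" using cnt_mono[OF p(3), of Y] Suc.prems by simp
      finally have r: "cnt Y q \<le> r" by simp
      have "x r c = 0" using edge_suppD[OF x, of q c r] r p Suc.prems(1) unfolding q by auto
      moreover have "u r (c-1) = 0" if "c \<noteq> 0"
      proof (rule Suc.IH[of q])
        show "q \<le> t" using q p Suc.prems by simp
        show "c - 1 < cnt X q" using cnt_add_2[OF X, of q] p(5) that unfolding q by simp
        show "cnt Y q \<le> r" by (rule r)
      qed
      ultimately show ?thesis using uSuc by simp
    qed
  qed (simp add: u0)
  then have "vertex_supp t X Y u" unfolding vertex_supp_def by blast
  then show "ext_coboundary t (Delta X) (Delta Y) f"
    by (rule ext_coboundary_of_normal_form[OF X nf]) (simp add: uSuc)
qed

text \<open>\<open>steps\<close> says that J moves by two except at b+2, where it jumps from b-1.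
  Hence every present edge has its lower end (r,c-1), except the edge from b in K to b+2 in J. That
  edge also lacks its upper end, as K contains neither b+1 nor b+2, so it is isolated and spans the
  cokernel.\<close>

lemma ext1_dim_one_Delta:
  assumes J: "standard J" and K: "standard K"
    and b: "2 \<le> b" "b + 2 \<le> t" "b \<in> K" "b + 1 \<notin> K" "b + 2 \<notin> K"
      "b - 1 \<in> J" "b \<notin> J" "b + 1 \<notin> J" "b + 2 \<in> J"
    and steps: "\<And>j. j \<in> J \<Longrightarrow> j \<le> 2 \<or> j - 2 \<in> J \<or> j = b + 2"
  shows "ext1_dim_one t (Delta J :: 'a::field rep) (Delta K)"
proof -
  let ?J = "Delta J :: 'a rep" and ?K = "Delta K :: 'a rep"
  have t: "3 \<le> t" using b by simp
  \<comment> \<open>Counting from 0, b has index r0 in K and b+2 has index c0 in J; (r0,c0) is the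
    isolated edge.\<close>
  define r0 where "r0 = cnt K (b-1)"
  define c0 where "c0 = cnt J b"
  have cb: "cnt K b = r0 + 1" "cnt K (b+2) = r0 + 1" "cnt J (b-1) = c0" "cnt J (b+1) = c0" "cnt J (b+2) = c0 + 1"
    using b cnt_Suc[of K "b-1"] cnt_Suc[of J "b-1"] by (simp_all add: r0_def c0_def cnt_Suc)
  define e :: "nat \<Rightarrow> nat \<Rightarrow> 'a" where "e r c = (if r = r0 \<and> c = c0 then 1 else 0)" for r c
  define g where "g = (\<lambda>i. 0\<^sub>m (cnt K (i+1)) (cnt J i) :: 'a mat, \<lambda>j. mat (cnt K j) (cnt J (j+2)) (\<lambda>(r,c). e r c))"
  have e_edge: "edge_supp t J K e"
    unfolding edge_supp_def
  proof (intro allI impI)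
    fix j r c assume j: "j + 2 \<le> t" and c: "c < cnt J (j+2)" and r: "cnt K j \<le> r"
    show "e r c = 0"
    proof (rule ccontr)
      assume "e r c \<noteq> 0"
      then have rc: "r = r0" "c = c0" by (auto simp: e_def split: if_splits)
      have "b + 1 < j + 2" using cnt_less_imp[of c J "j+2" "b+1"] c rc cb by simp
      then have "cnt K b \<le> cnt K j" by (intro cnt_mono) simp
      then show False using r rc cb by simp
    qed
  qed
  \<comment> \<open>The relations compare truncations of e at neighbouring vertices. They could
    differ only in a row that is new at i+1, and there \<open>edge_supp\<close> makes e
    vanish.\<close>
  have g_cocycle: "ext_cocycle t ?J ?K g"
    unfolding ext_cocycle_def Let_def g_def fst_conv snd_conv dimv_Delta
  proof (intro conjI allI impI)
    have E: "(mat (cnt K (i+1)) (cnt J (i+1+2)) (\<lambda>(r,c). e r c) * amap ?J (i+2)) $$ (r, c) = e r c"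
      if "r < cnt K (i+1)" "c < cnt J (i+2)" for i r c
      using that cnt_mono[of "i+2" "i+3" J]
      by (subst mult_amap_Delta[of _ "cnt K (i+1)"]) (auto simp: numeral_3_eq_3)
    have z: "bmap ?K (i+1) * 0\<^sub>m (cnt K (i+2+1)) (cnt J (i+2)) = 0\<^sub>m (cnt K (i+1)) (cnt J (i+2))" for i
      by (rule right_mult_zero_mat) (use bmap_Delta_carrier[of K "i+1", where 'a = 'a] in \<open>simp add: numeral_3_eq_3\<close>)
    show "bmap ?K 1 * 0\<^sub>m (cnt K (2+1)) (cnt J 2) + mat (cnt K 1) (cnt J (1+2)) (\<lambda>(r,c). e r c) * amap ?J 2
        = 0\<^sub>m (cnt K 1) (cnt J 2)" (is "?L = _")
    proof (rule eq_matI)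
      fix r c assume "r < dim_row (0\<^sub>m (cnt K 1) (cnt J 2) :: 'a mat)" "c < dim_col (0\<^sub>m (cnt K 1) (cnt J 2) :: 'a mat)"
      then have rc: "r < cnt K 1" "c < cnt J 2" by auto
      then have "e r c = 0" using edge_suppD[OF e_edge, of 0 c r] t cnt_0[OF K] by (simp add: numeral_2_eq_2)
      moreover have "?L $$ (r, c) = (bmap ?K 1 * 0\<^sub>m (cnt K (2+1)) (cnt J 2)) $$ (r, c)
          + (mat (cnt K 1) (cnt J (1+2)) (\<lambda>(r,c). e r c) * amap ?J 2) $$ (r, c)"
        using rc by (intro index_add_mat(1)) (auto simp: amap_Delta)
      ultimately show "?L $$ (r, c) = 0\<^sub>m (cnt K 1) (cnt J 2) $$ (r, c)"
        unfolding z[of 0, unfolded add_0] E[of r 0 c, unfolded add_0, OF rc] using rc by simp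
    qed (auto simp: amap_Delta)
    fix i assume i: "1 \<le> i \<and> i + 3 \<le> t"
    show "bmap ?K (i+1) * 0\<^sub>m (cnt K (i+2+1)) (cnt J (i+2)) + mat (cnt K (i+1)) (cnt J (i+1+2)) (\<lambda>(r,c). e r c) * amap ?J (i+2)
        = amap ?K i * mat (cnt K i) (cnt J (i+2)) (\<lambda>(r,c). e r c) + 0\<^sub>m (cnt K (i+1)) (cnt J i) * bmap ?J i" (is "?L = ?R")
    proof (rule eq_matI)
      fix r c assume "r < dim_row ?R" "c < dim_col ?R"
      then have rc: "r < cnt K (i+1)" "c < cnt J (i+2)" by (auto simp: bmap_Delta)
      have "?L $$ (r, c) = (bmap ?K (i+1) * 0\<^sub>m (cnt K (i+2+1)) (cnt J (i+2))) $$ (r, c)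
          + (mat (cnt K (i+1)) (cnt J (i+1+2)) (\<lambda>(r,c). e r c) * amap ?J (i+2)) $$ (r, c)"
        using rc by (intro index_add_mat(1)) (auto simp: amap_Delta)
      then have "?L $$ (r, c) = e r c" unfolding z E[OF rc] using rc by simp
      moreover have "(amap ?K i * mat (cnt K i) (cnt J (i+2)) (\<lambda>(r,c). e r c)) $$ (r, c) = e r c"
        using rc edge_suppD[OF e_edge, of i c r] i
        by (subst amap_Delta_mult[of _ _ _ "cnt J (i+2)"]) auto
      moreover have "?R $$ (r, c) = (amap ?K i * mat (cnt K i) (cnt J (i+2)) (\<lambda>(r,c). e r c)) $$ (r, c)
          + (0\<^sub>m (cnt K (i+1)) (cnt J i) * bmap ?J i) $$ (r, c)"
        using rc by (intro index_add_mat(1)) (auto simp: bmap_Delta)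
      ultimately show "?L $$ (r, c) = ?R $$ (r, c)"
        unfolding left_mult_zero_mat[OF bmap_Delta_carrier] using rc by simp
    qed (auto simp: amap_Delta bmap_Delta)
  qed auto
  have g_nontrivial: "\<not> ext_coboundary t ?J ?K g"
  proof
    assume "ext_coboundary t ?J ?K g"
    then obtain h where h: "\<And>i. 1 \<le> i \<Longrightarrow> i \<le> t \<Longrightarrow> h i \<in> carrier_mat (cnt K i) (cnt J i)"
      and ha: "\<And>i. 1 \<le> i \<Longrightarrow> i + 1 \<le> t \<Longrightarrow> fst g i = amap ?K i * h i - h (i+1) * amap ?J i"
      and hb: "\<And>j. 1 \<le> j \<Longrightarrow> j + 2 \<le> t \<Longrightarrow> snd g j = bmap ?K j * h (j+2) - h j * bmap ?J j"
      unfolding ext_coboundary_def dimv_Delta by (metis atLeastAtMost_iff)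
    \<comment> \<open>Row r0 is new at vertex b while column c0 - 1 is already present at b-1. The
      \<open>\<alpha>\<close>-equation from b-1 to b, where g is 0, therefore forces this entry of h
      to vanish.\<close>
    have hb0: "h b $$ (r0, c0 - 1) = 0" if c: "c0 \<noteq> 0"
    proof -
      define i where "i = b - 1"
      have i: "1 \<le> i" "i + 1 = b" "i + 1 \<le> t" "i \<le> t" using b by (auto simp: i_def)
      have rc: "r0 < cnt K (i+1)" "c0 - 1 < cnt J i" using cb c unfolding i by (auto simp: i_def)
      have hc: "h i \<in> carrier_mat (cnt K i) (cnt J i)" "h (i+1) \<in> carrier_mat (cnt K (i+1)) (cnt J (i+1))"
        using h i by auto
      have "0 = fst g i $$ (r0, c0 - 1)" using rc by (simp add: g_def)
      also have "\<dots> = (amap ?K i * h i) $$ (r0, c0 - 1) - (h (i+1) * amap ?J i) $$ (r0, c0 - 1)"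
        unfolding ha[OF i(1,3)] using rc hc by (intro index_minus_mat) (auto simp: amap_Delta)
      also have "\<dots> = (if r0 < cnt K i then h i $$ (r0, c0 - 1) else 0) - h (i+1) $$ (r0, c0 - 1)"
        unfolding amap_Delta_mult[OF hc(1) rc] mult_amap_Delta[OF hc(2) rc] ..
      also have "\<dots> = - h b $$ (r0, c0 - 1)"
        unfolding i(2) by (simp add: r0_def i_def)
      finally show ?thesis by simp
    qed
    have rc: "r0 < cnt K b" "c0 < cnt J (b+2)" using cb by auto
    have hc: "h b \<in> carrier_mat (cnt K b) (cnt J b)" "h (b+2) \<in> carrier_mat (cnt K (b+2)) (cnt J (b+2))"
      using h b by auto
    \<comment> \<open>In the equation for \<open>\<beta>\<close> from b+2 to b, the upper end
      contributes 0 since row r0 + 1 does not exist at b+2, and the lower end contributes 0 by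
      \<open>hb0\<close>.\<close>
    have "1 = snd g b $$ (r0, c0)" using rc by (simp add: g_def e_def)
    also have "\<dots> = (bmap ?K b * h (b+2)) $$ (r0, c0) - (h b * bmap ?J b) $$ (r0, c0)"
      using hb[of b] b rc hc by (simp add: bmap_Delta del: index_mult_mat(1))
    also have "\<dots> = 0"
      unfolding bmap_Delta_mult[OF hc(2) rc] mult_bmap_Delta[OF J hc(1) rc] using hb0 cb by simp
    finally show False by simp
  qed
  have generates: "\<exists>c. ext_coboundary t ?J ?K (ext_comb c f g)" if f: "ext_cocycle t ?J ?K f" for f
  proof -
    obtain h y where nf: "normal_form t J K f h y" and y: "edge_supp t J K y"
      using normal_form_of_cocycle[OF J K t f] by blast
    \<comment> \<open>The coefficient at the isolated edge; once k g is subtracted, the rest has to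
      bound.\<close>
    define k where "k = y r0 c0"
    define x where "x r c = y r c - k * e r c" for r c
    have x: "edge_supp t J K x"
      unfolding edge_supp_def x_def using edge_suppD[OF y] edge_suppD[OF e_edge] by auto
    have x0: "x r0 c0 = 0" by (simp add: x_def k_def e_def)
    have nf': "normal_form t J K (ext_comb k f g) h x"
      unfolding normal_form_def
    proof (intro conjI allI impI)
      show "\<forall>i\<in>{1..t}. h i \<in> carrier_mat (cnt K i) (cnt J i)" using nf unfolding normal_form_def by blast
      fix i assume i: "1 \<le> i \<and> i + 1 \<le> t"
      have "fst (ext_comb k f g) i = fst f i"
        using ext_cocycle_carriers(1)[OF f, of i] i by (auto simp: ext_comb_def g_def dimv_Delta)
      then show "fst (ext_comb k f g) i = amap ?K i * h i - h (i+1) * amap ?J i"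
        using nf i unfolding normal_form_def by simp
    next
      fix j assume j: "1 \<le> j \<and> j + 2 \<le> t"
      define D where "D = bmap ?K j * h (j+2) - h j * bmap ?J j"
      have "snd f j = D + mat (cnt K j) (cnt J (j+2)) (\<lambda>(r,c). y r c)"
        using nf j unfolding normal_form_def D_def by blast
      then have "snd (ext_comb k f g) j = D + mat (cnt K j) (cnt J (j+2)) (\<lambda>(r,c). x r c)"
        by (intro eq_matI) (auto simp: ext_comb_def g_def x_def)
      then show "snd (ext_comb k f g) j = bmap ?K j * h (j+2) - h j * bmap ?J j + mat (cnt K j) (cnt J (j+2)) (\<lambda>(r,c). x r c)"
        by (simp only: D_def)
    qed
    \<comment> \<open>\<open>E r c\<close> and \<open>V r c\<close> express that the edge,
      respectively the vertex, at (r,c) is allowed.\<close>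
    define E where "E r c \<longleftrightarrow> (\<forall>j. j + 2 \<le> t \<longrightarrow> c < cnt J (j+2) \<longrightarrow> r < cnt K j)" for r c
    define V where "V r c \<longleftrightarrow> (\<forall>i. i \<le> t \<longrightarrow> c < cnt J i \<longrightarrow> r < cnt K i)" for r c
    \<comment> \<open>The smallest element of J is 1 or 2: from a larger n, \<open>steps\<close>
      produces a smaller element, n - 2 or, for n = b+2, the element b - 1.\<close>
    have first: "n \<le> 2" if "n \<in> J" "cnt J (n-1) = 0" for n
    proof (rule ccontr)
      assume n: "\<not> n \<le> 2"
      have pos: "0 < cnt J m" if "m \<in> J" "1 \<le> m" for m using that cnt_Suc[of J "m-1"] by simp
      from steps[OF that(1)] n consider "n - 2 \<in> J" | "n = b + 2" by auto
      then show False
      proof cases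
        case 1
        moreover have "1 \<le> n - 2" "n - 2 \<le> n - 1" using n by auto
        ultimately show ?thesis using pos[of "n-2"] that(2) cnt_mono[of "n-2" "n-1" J] by simp
      next
        case 2
        moreover have "1 \<le> b - 1" "b - 1 \<le> n - 1" using b 2 by auto
        ultimately show ?thesis using pos[of "b-1"] b that(2) cnt_mono[of "b-1" "n-1" J] by simp
      qed
    qed
    \<comment> \<open>Let p = x_(c+1), so the edge gives y_r <= p - 2. Off the jump p - 2 is x_c. At
      the jump p - 2 = b and x_c = b - 1, which differ only for y_r = b, the excluded edge.\<close>
    have left: "V r c" if c: "c + 1 < cnt J t" and E: "E r (c+1)" and ne: "\<not> (r = r0 \<and> c + 1 = c0)" for r c
    proof -
      obtain p where p: "p \<in> J" "1 \<le> p" "p \<le> t" "cnt J (p-1) = c + 1" "cnt J p = c + 2"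
        using cnt_element[OF J c] by auto
      have p2: "3 \<le> p"
      proof (rule ccontr)
        assume "\<not> 3 \<le> p"
        then have "cnt J p \<le> cnt J 2" by (intro cnt_mono) simp
        then show False using p(5) cnt_add_2[OF J, of 0] cnt_0[OF J] by (simp add: numeral_2_eq_2)
      qed
      have "\<exists>q. r < cnt K q \<and> cnt J (q-1) = c \<and> 1 \<le> q"
      proof (cases "p = b + 2")
        case True
        have c': "c + 1 = c0" using p True cb by simp
        have "r < cnt K b" using E b(2) cb c' unfolding E_def by auto
        then have "r < cnt K (b-1)" using ne c' cb by (simp add: r0_def)
        moreover have "Suc (b - 1 - 1) = b - 1" using b by simp
        then have "cnt J (b - 1 - 1) = c"
          using cb(3) c' b(6) cnt_Suc[of J "b - 1 - 1"] by simp
        ultimately show ?thesis using b by (intro exI[of _ "b-1"]) auto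
      next
        case False
        define q where "q = p - 2"
        have q: "p = q + 2" "1 \<le> q" using p2 by (auto simp: q_def)
        have qJ: "q \<in> J" using steps[OF p(1)] False p2 by (auto simp: q_def)
        then have "q + 1 \<notin> J" using J unfolding standard_def by blast
        then have "cnt J q = c + 1" using p q by (simp add: cnt_Suc)
        then have "cnt J (q-1) = c" using cnt_Suc[of J "q-1"] q qJ by simp
        moreover have "r < cnt K q" using E p(3,5) unfolding E_def q(1) by auto
        ultimately show ?thesis using q by blast
      qed
      then obtain q where q: "r < cnt K q" "cnt J (q-1) = c" "1 \<le> q" by blast
      show ?thesis
        unfolding V_def
      proof (intro allI impI)
        fix i assume "c < cnt J i"
        then have "q \<le> i" using cnt_less_imp[of c J i "q-1"] q by simp
        then show "r < cnt K i" using q cnt_mono[of q i K] by simp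
      qed
    qed
    \<comment> \<open>An allowed edge anywhere up the diagonal forces the vertex (r,c). Its lower
      end is the upper end of the preceding edge, and since K has gaps of at least 2, an allowed
      upper end makes that edge allowed.\<close>
    have chain: "V r c" if "c + 1 + n < cnt J t" "E (r + n) (c + 1 + n)" "\<not> (r + n = r0 \<and> c + 1 + n = c0)" for n r c
      using that
    proof (induction n)
      case 0
      then show ?case using left[of c r] by simp
    next
      case (Suc n)
      have V: "V (r + n + 1) (c + 1 + n)" using left[of "c + 1 + n" "r + n + 1"] Suc.prems by simp
      have "E (r + n) (c + 1 + n)"
        unfolding E_def
      proof (intro allI impI)
        fix j assume "j + 2 \<le> t" "c + 1 + n < cnt J (j+2)"
        then have "r + n + 1 < cnt K (j+2)" using V unfolding V_def by blast
        then show "r + n < cnt K j" using cnt_add_2[OF K, of j] by simp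
      qed
      \<comment> \<open>The descent cannot run into the isolated edge, because it would arrive
        through the missing vertex (r0+1,c0).\<close>
      moreover have "\<not> (r + n = r0 \<and> c + 1 + n = c0)"
      proof
        assume "r + n = r0 \<and> c + 1 + n = c0"
        then have "V (r0 + 1) c0" using V by simp
        moreover have "c0 < cnt J (b+2)" using cb by simp
        ultimately have "r0 + 1 < cnt K (b+2)" using b(2) unfolding V_def by blast
        then show False using cb by simp
      qed
      ultimately show ?case using Suc by simp
    qed
    \<comment> \<open>Solves each diagonal downwards, starting with 0 at its upper end: the sum
      collects the edges above the vertex (r,c), and the coboundary equation telescopes.\<close>
    define u where "u r c = - (\<Sum>n<cnt J t - (c+1). x (r + n) (c + 1 + n))" for r c
    have u: "vertex_supp t J K u"
      unfolding vertex_supp_def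
    proof (intro allI impI)
      fix i r c assume i: "i \<le> t" and c: "c < cnt J i" and r: "cnt K i \<le> r"
      have "x (r + n) (c + 1 + n) = 0" if n: "n < cnt J t - (c+1)" for n
      proof (rule ccontr)
        assume nz: "x (r + n) (c + 1 + n) \<noteq> 0"
        have "E (r + n) (c + 1 + n)" unfolding E_def using edge_suppD[OF x, of _ "c + 1 + n" "r + n"] nz by (meson not_less)
        moreover have "\<not> (r + n = r0 \<and> c + 1 + n = c0)" using nz x0 by auto
        ultimately have "V r c" using chain[of c n r] n by simp
        then show False using i c r unfolding V_def by (meson not_less)
      qed
      then show "u r c = 0" by (simp add: u_def)
    qed
    have "x r c = u (Suc r) c - (if c = 0 then 0 else u r (c-1))" if c: "c < cnt J t" for r c
    proof (cases c)
      case 0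
      \<comment> \<open>In column 0 there is no lower end to absorb an entry. As x_0 <= 2, no edge
        is allowed in this column and a vertex only in row 0, so both sides are 0.\<close>
      obtain p where p: "p \<in> J" "cnt J (p-1) = 0" "cnt J p = 1"
        using cnt_element[OF J c] 0 by auto
      have "cnt J p \<le> cnt J 2" using first[OF p(1,2)] by (rule cnt_mono)
      then have n2: "0 < cnt J 2" using p by simp
      have "x r 0 = 0" using edge_suppD[OF x, of 0 0 r] n2 t cnt_0[OF K] by (simp add: numeral_2_eq_2)
      moreover have "cnt K 2 \<le> Suc r" using cnt_add_2[OF K, of 0] cnt_0[OF K] by (simp add: numeral_2_eq_2)
      then have "u (Suc r) 0 = 0" using vertex_suppD[OF u, of 2 0 "Suc r"] n2 t by simp
      ultimately show ?thesis using 0 by simp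
    next
      case (Suc c')
      then obtain m where m: "cnt J t - (c'+1) = Suc m" "cnt J t - (Suc c' + 1) = m"
        using c by (cases "cnt J t - (c'+1)") auto
      show ?thesis
        using Suc by (simp add: u_def m[simplified] sum.lessThan_Suc_shift del: sum.lessThan_Suc)
    qed
    then have "ext_coboundary t ?J ?K (ext_comb k f g)"
      by (rule ext_coboundary_of_normal_form[OF J nf' u])
    then show ?thesis by blast
  qed
  show ?thesis
    unfolding ext1_dim_one_def using g_cocycle g_nontrivial generates by blast
qed

subsection \<open>The sets \<open>J(d)\<close> and \<open>K\<close>\<close>

text \<open>With a single even internal string the middle clause of \<open>Jset\<close> is void, and
  the two residue conditions become parity comparisons with b.\<close>

lemma Jset_single:
  assumes "thin_dimvec t d" "e_num t d = 1"
  obtains b where "2 \<le> b" "b + 2 \<le> t" "d b = 1" "d (b+1) = 0"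
    "Jset t d = {j\<in>{1..t}. j + 1 \<le> b \<and> odd (b + j) \<or> b + 2 \<le> j \<and> even (b + j)}"
proof -
  obtain b where B: "{p. even_internal_end t d p} = {b}"
    using assms(2) unfolding e_num_def by (rule card_1_singletonE)
  then have "even_internal_end t d b" by blast
  then have b: "b < t" "d b = 1" "d (b+1) = 0" "2 \<le> b"
    unfolding even_internal_end_def by auto
  \<comment> \<open>The last entry of d is 1, so the zero at b+1 is not the last entry.\<close>
  moreover have "b + 1 \<noteq> t" using b(3) assms(1) unfolding thin_dimvec_def by auto
  moreover have "Jset t d = {j\<in>{1..t}. j + 1 \<le> b \<and> odd (b + j) \<or> b + 2 \<le> j \<and> even (b + j)}"
  proof -
    have "j mod 2 = (b - 1) mod 2 \<longleftrightarrow> odd (b + j)" "j mod 2 = b mod 2 \<longleftrightarrow> even (b + j)" for j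
      using b(4) by (cases b; auto simp: mod2_eq_if)+
    then show ?thesis unfolding Jset_def bpos_def B by (simp add: Let_def)
  qed
  ultimately show thesis using that by auto
qed

text \<open>Explicitly J = {..., b-3, b-1, b+2, b+4, ...}. Removing J and the zero at b+1 leaves K
  inside {..., b-2, b, b+3, b+5, ...}. Every k > 1 in K thus follows an element of J, while J has
  its only jump of length 3 around b, b+1.\<close>

lemma JK_combinatorics:
  assumes b: "2 \<le> b" "b + 2 \<le> t" "d b = 1" "d (b+1) = 0"
    and J: "J = {j\<in>{1..t}. j + 1 \<le> b \<and> odd (b + j) \<or> b + 2 \<le> j \<and> even (b + j)}"
    and K: "K = supp t d - J"
  shows "standard J" "standard K" "\<And>k. k \<in> K \<Longrightarrow> k = 1 \<or> k - 1 \<in> J"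
    "b \<in> K" "b + 1 \<notin> K" "b + 2 \<notin> K" "b - 1 \<in> J" "b \<notin> J" "b + 1 \<notin> J" "b + 2 \<in> J"
    "\<And>j. j \<in> J \<Longrightarrow> j \<le> 2 \<or> j - 2 \<in> J \<or> j = b + 2"
proof -
  show "standard J" unfolding standard_def J by auto
  have Kb: "k \<le> b \<and> even (b + k) \<or> b + 3 \<le> k \<and> odd (b + k)" if k: "k \<in> K" for k
  proof -
    have "k \<noteq> b + 1" using k b(4) unfolding K supp_def by auto
    then consider "k < b" | "k = b" | "b + 2 \<le> k" by linarith
    moreover have "\<not> (k + 1 \<le> b \<and> odd (b + k))" "\<not> (b + 2 \<le> k \<and> even (b + k))"
      using k unfolding K J supp_def by auto
    ultimately show ?thesis by cases (auto simp: le_eq_less_or_eq Suc_le_eq)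
  qed
  have K1: "1 \<le> k" "k \<le> t" if "k \<in> K" for k using that unfolding K supp_def by auto
  show "standard K"
    unfolding standard_def
  proof (intro conjI ballI notI)
    assume "0 \<in> K" then show False using K1 by fastforce
  next
    fix k assume "k \<in> K" "k + 1 \<in> K"
    from Kb[OF this(1)] Kb[OF this(2)] show False by auto
  qed
  show "k = 1 \<or> k - 1 \<in> J" if "k \<in> K" for k
    using Kb[OF that] K1[OF that] unfolding J by (cases k) auto
  show "b \<in> K" "b + 1 \<notin> K" "b + 2 \<notin> K" "b - 1 \<in> J" "b \<notin> J" "b + 1 \<notin> J" "b + 2 \<in> J"
    using b unfolding K J supp_def by auto
  show "j \<le> 2 \<or> j - 2 \<in> J \<or> j = b + 2" if "j \<in> J" for j
  proof (cases "j \<le> 2 \<or> j = b + 2")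
    case False
    define i where "i = j - 2"
    have i: "j = i + 2" "1 \<le> i" "i \<noteq> b" using False by (auto simp: i_def)
    moreover have "i \<noteq> b + 1" using that i unfolding J by auto
    ultimately have "i \<in> J" using that unfolding J by auto
    then show ?thesis using i by simp
  qed auto
qed

theorem theorem4p2:
  fixes t :: nat and d :: "nat \<Rightarrow> nat"
  assumes k_alg_closed: "alg_closed TYPE('a::field)"
    and thin: "thin_dimvec t d"
    and e1: "e_num t d = 1"
  defines "J \<equiv> Jset t d"
    and "K \<equiv> supp t d - Jset t d"
  defines "T \<equiv> (Delta J :: 'a rep)"
    and "S \<equiv> (Delta K :: 'a rep)"
  shows "(ext1_dim_one t T S \<and> ext1_zero t S T)
    \<and> (\<forall>(M :: 'a rep) \<iota> \<pi>. is_module t M \<and> is_ses t S M T \<iota> \<pi> \<and> \<not> ses_splits t M T \<pi>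
          \<longrightarrow> ext1_zero t M M)
    \<and> (\<forall>(M :: 'a rep) \<iota> \<pi> (M' :: 'a rep) \<iota>' \<pi>'.
          is_module t M \<and> is_ses t S M T \<iota> \<pi> \<and> \<not> ses_splits t M T \<pi> \<and>
          is_module t M' \<and> is_ses t S M' T \<iota>' \<pi>' \<and> \<not> ses_splits t M' T \<pi>'
          \<longrightarrow> is_iso t M M')"
proof -
  obtain b where b: "2 \<le> b" "b + 2 \<le> t" "d b = 1" "d (b+1) = 0"
    and J: "J = {j\<in>{1..t}. j + 1 \<le> b \<and> odd (b + j) \<or> b + 2 \<le> j \<and> even (b + j)}"
    unfolding J_def by (rule Jset_single[OF thin e1])
  have K: "K = supp t d - J" by (simp add: J_def K_def)
  note JK = JK_combinatorics[OF b J K]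
  have t: "3 \<le> t" using b by simp
  have mT: "is_module t T" and mS: "is_module t S"
    unfolding T_def S_def by (rule is_module_Delta, rule JK)+
  note lT = linear_rep_of_module[OF mT] and lS = linear_rep_of_module[OF mS]
  have TS: "ext1_dim_one t T S"
    unfolding T_def S_def by (rule ext1_dim_one_Delta[OF JK(1,2) b(1,2) JK(4-11)])
  \<comment> \<open>The condition \<open>near\<close> holds for (K,J) since k = 1 or k - 1 lies in
    J, and for (K,K) and (J,J) because X = Y.\<close>
  have ST: "ext1_zero t S T" and SS: "ext1_zero t S S" and TT: "ext1_zero t T T"
    unfolding T_def S_def by (rule ext1_zero_Delta[OF _ _ t]; use JK in blast)+
  note ext = ST[unfolded ext1_zero_iff[OF mS mT], rule_format]
    SS[unfolded ext1_zero_iff[OF mS mS], rule_format]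
    TT[unfolded ext1_zero_iff[OF mT mT], rule_format]
  obtain ga gb where "cocycle t T S ga gb" and gen: "\<And>fa fb. cocycle t T S fa fb \<Longrightarrow>
      \<exists>c h. cobounds t T S h (\<lambda>i. fa i - scal c * ga i) (\<lambda>j. fb j - scal c * gb j)"
    using ext1_dim_oneD[OF mT mS TS] by blast
  have nonsplit: "\<nexists>\<sigma>. linear_hom t T M \<sigma> \<and> (\<forall>i\<in>{1..t}. endo_fam \<pi> i * \<sigma> i = idn (dimv T i))"
    if "is_module t M" "is_ses t S M T \<iota> \<pi>" "\<not> ses_splits t M T \<pi>" for M \<iota> \<pi>
    using that ses_splits_of_linear[OF that(1) mT, of \<pi>] unfolding is_ses_def by blast
  have "ext1_zero t M M"
    if M: "is_module t M" and ses: "is_ses t S M T \<iota> \<pi>" and ns: "\<not> ses_splits t M T \<pi>" for M \<iota> \<pi>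
  proof -
    obtain r s where "split_ses t S M T (endo_fam \<iota>) (endo_fam \<pi>) r s"
      using split_ses_of_ses[OF mS M mT ses] by blast
    then interpret E: split_ses t S M T "endo_fam \<iota>" "endo_fam \<pi>" r s .
    \<comment> \<open>Ext(S,M) vanishes from the two outer terms; Ext(T,M) vanishes although
      Ext(T,S) does not, because the sequence is non-split.\<close>
    note SM = E.ext_middle_covariant[OF lS ext(2) ext(1)]
    note TM = E.ext_middle_of_generator[OF gen ext(3) nonsplit[OF M ses ns]]
    show ?thesis
      unfolding ext1_zero_iff[OF M M]
      using E.ext_middle_contravariant[OF linear_rep_of_module[OF M] SM TM] by blast
  qed
  moreover have "is_iso t M M'"
    if M: "is_module t M" and ses: "is_ses t S M T \<iota> \<pi>" and ns: "\<not> ses_splits t M T \<pi>"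
      and M': "is_module t M'" and ses': "is_ses t S M' T \<iota>' \<pi>'" and ns': "\<not> ses_splits t M' T \<pi>'"
    for M \<iota> \<pi> M' \<iota>' \<pi>'
  proof -
    obtain r s where sp: "split_ses t S M T (endo_fam \<iota>) (endo_fam \<pi>) r s"
      using split_ses_of_ses[OF mS M mT ses] by blast
    obtain r' s' where sp': "split_ses t S M' T (endo_fam \<iota>') (endo_fam \<pi>') r' s'"
      using split_ses_of_ses[OF mS M' mT ses'] by blast
    show ?thesis
      using split_ses.iso_if_nonsplit[OF sp sp' gen nonsplit[OF M ses ns] nonsplit[OF M' ses' ns']]
        is_iso_of_linear[OF M M'] by blast
  qed
  ultimately show ?thesis using TS ST by blast
qed

end
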